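(* Let $p\in(0,1)$ be fixed. Suppose that $d=n^\alpha$ (rounded down to an integer) and $q=n^{-\beta}$ for some fixed $\alpha,\beta>0$. (a) If $\beta>1$ or $\alpha+2\beta>3$, then as $n\to\infty$, $\mathrm{TV}(\mathcal{G}(n,p),\mathcal{G}(n,p,d,q))\to 0$. (b) If $\alpha+6\beta<3$, then as $n\to\infty$, $\mathrm{TV}(\mathcal{G}(n,p),\mathcal{G}(n,p,d,q))\to 1$.
   Context: $\mathcal{G}(n,p)$ denotes the Erdős–Rényi random graph on vertex set $[n]=\{1,\dots,n\}$ in which each pair is an edge independently with probability $p$. $\mathcal{G}(n,p,d,q)$ (for $d\ge 2$, which holds for all large $n$ here) denotes the following random graph on $[n]$: let $\mathbf{x}_1,\dots,\mathbf{x}_n$ be independent and uniformly distributed on the unit sphere $\mathbb{S}^{d-1}\subset\mathbb{R}^d$, and let $t_{p,d}$ be the threshold determined by $\mathbb{P}(\langle\mathbf{x}_1,\mathbf{x}_2\rangle\ge t_{p,d})=p$ for two independent uniform points. Conditionally on $\mathbf{x}_1,\dots,\mathbf{x}_n$, the pairs $\{i,j\}$, $i\neq j$, are edges independently with probability $\phi_q(\langle\mathbf{x}_i,\mathbf{x}_j\rangle)$, where $\phi_q(x)=(1-q)p+q\,\mathbf{1}\{x\ge t_{p,d}\}$. $\mathrm{TV}(\mathcal P,\mathcal Q)=\sup_A|\mathcal P(A)-\mathcal Q(A)|$ is the total variation distance between the laws of the two random graphs. *)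

theory Defs
  imports "HOL-Probability.Probability"
begin

text \<open>
  The dimension of the ambient space is a natural number that varies with the number of vertices,
  so a point of Euclidean \<open>d\<close>-space is a function in \<open>space (Pi\<^sub>M {..<d} (\<lambda>_. borel))\<close>,
  that is, a function on \<open>{..<d}\<close> that is \<open>undefined\<close> elsewhere.
\<close>

definition dot :: "nat \<Rightarrow> (nat \<Rightarrow> real) \<Rightarrow> (nat \<Rightarrow> real) \<Rightarrow> real" where
  "dot d x y = (\<Sum>k<d. x k * y k)"

definition enorm :: "nat \<Rightarrow> (nat \<Rightarrow> real) \<Rightarrow> real" where
  "enorm d x = sqrt (\<Sum>k<d. (x k)\<^sup>2)"

definition unit_ball :: "nat \<Rightarrow> (nat \<Rightarrow> real) set" where
  "unit_ball d = {x \<in> space (\<Pi>\<^sub>M k\<in>{..<d}. lborel). enorm d x \<le> 1}"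

text \<open>
  Normalised surface measure on the unit sphere, as a measure on \<open>d\<close>-space: a set \<open>E\<close> of unit
  vectors gets the Lebesgue volume of the cone \<open>{r \<theta> | 0 < r \<le> 1, \<theta> \<in> E}\<close> divided by the volume
  of the unit ball. (The origin, where the radial projection is meaningless, is a null set.)
\<close>

definition uniform_sphere :: "nat \<Rightarrow> (nat \<Rightarrow> real) measure" where
  "uniform_sphere d =
     distr (uniform_measure (\<Pi>\<^sub>M k\<in>{..<d}. lborel) (unit_ball d)) (\<Pi>\<^sub>M k\<in>{..<d}. borel)
       (\<lambda>x. \<lambda>k\<in>{..<d}. x k / enorm d x)"

text \<open>
  For \<open>d \<ge> 2\<close> and \<open>0 < p < 1\<close> there is exactly one such threshold, because the inner product of two
  independent uniform points then has a density that is positive on \<open>(-1, 1)\<close>.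
\<close>

definition threshold :: "real \<Rightarrow> nat \<Rightarrow> real" where
  "threshold p d =
     (THE t. measure (uniform_sphere d \<Otimes>\<^sub>M uniform_sphere d)
               {z \<in> space (uniform_sphere d \<Otimes>\<^sub>M uniform_sphere d). t \<le> dot d (fst z) (snd z)} = p)"

definition connection :: "real \<Rightarrow> nat \<Rightarrow> real \<Rightarrow> real \<Rightarrow> real" where
  "connection p d q x = (1 - q) * p + q * of_bool (threshold p d \<le> x)"

text \<open>
  A graph on the vertex set \<open>{1..n}\<close> is given by its set of edges \<open>{i, j}\<close>. The coin that decides
  on the edge \<open>{i, j}\<close> is indexed by the pair \<open>(i, j)\<close> with \<open>i < j\<close>.
\<close>

definition vertex_pairs :: "nat \<Rightarrow> (nat \<times> nat) set" where
  "vertex_pairs n = {(i, j). 1 \<le> i \<and> i < j \<and> j \<le> n}"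

definition independent_edges :: "nat \<Rightarrow> (nat \<Rightarrow> nat \<Rightarrow> real) \<Rightarrow> nat set set pmf" where
  "independent_edges n w =
     map_pmf (\<lambda>\<omega>. {{i, j} | i j. (i, j) \<in> vertex_pairs n \<and> \<omega> (i, j)})
       (Pi_pmf (vertex_pairs n) False (\<lambda>(i, j). bernoulli_pmf (w i j)))"

definition erdos_renyi :: "nat \<Rightarrow> real \<Rightarrow> nat set set measure" where
  "erdos_renyi n p = measure_pmf (independent_edges n (\<lambda>i j. p))"

definition noisy_geometric_graph :: "nat \<Rightarrow> real \<Rightarrow> nat \<Rightarrow> real \<Rightarrow> nat set set measure" where
  "noisy_geometric_graph n p d q =
     (\<Pi>\<^sub>M i\<in>{1..n}. uniform_sphere d) \<bind>
       (\<lambda>x. measure_pmf (independent_edges n (\<lambda>i j. connection p d q (dot d (x i) (x j)))))"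

definition total_variation :: "'a measure \<Rightarrow> 'a measure \<Rightarrow> real" where
  "total_variation P Q = (SUP A\<in>sets P. \<bar>measure P A - measure Q A\<bar>)"

end

theory Submission
  imports Defs
begin

text \<open>
  Write \<open>K(x, y) = 1{t \<le> \<langle>x, y\<rangle>} - p\<close> and let \<open>f(y, y')\<close> be the expectation of \<open>K(x, y) K(x, y')\<close> over
  a uniform point \<open>x\<close> of the sphere. By invariance \<open>f(y, y')\<close> is a function of the angle \<open>\<theta>\<close> between
  \<open>y\<close> and \<open>y'\<close>; averaging over the rotations of their plane turns it into the mean overlap of two
  circular arcs at distance \<open>\<theta>\<close>. Hence it is decreasing and Lipschitz in \<open>\<theta>\<close>, with slope
  bounded away from zero near \<open>\<theta> = \<pi>/2\<close>. As \<open>\<langle>y, y'\<rangle>\<close> is of order \<open>1 / \<surd>d\<close>, the second moment of \<open>f\<close>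
  is at most \<open>1 / d\<close>, and the signed triangle \<open>K(x, y) K(y, z) K(z, x)\<close> has mean at least \<open>c / \<surd>d\<close>.

  For part (a), the chain rule bounds the relative entropy of the noisy graph with respect to the
  Erdos--Renyi graph by the sum over \<open>k < n\<close> of
  \<open>E (1 + q\<^sup>2 f(y, y') / (p (1 - p)))\<^sup>k - 1\<close>, which is of order \<open>k\<^sup>2 q\<^sup>4 / d\<close>. So it vanishes as soon as
  \<open>n\<^sup>3 q\<^sup>4 / d \<longlonglongrightarrow> 0\<close>, and both alternatives of (a) imply \<open>\<alpha> + 4 \<beta> > 3\<close>.

  For part (b), Chebyshev's inequality applies to the number of signed triangles with one vertex in each
  of three disjoint sets of \<open>m\<close> vertices: its mean is at least \<open>c m\<^sup>3 q\<^sup>3 / \<surd>d\<close> in the geometric graph and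
  zero in the other one, and the variances are at most \<open>m\<^sup>3 + 3 m\<^sup>4 q\<^sup>4 / d\<close>, because triangles without a
  common edge are uncorrelated.
\<close>

section \<open>The uniform measure on the sphere\<close>

text \<open>No density of the inner product is computed. The uniform measure enters through its
  invariance under rotations of coordinate planes, inherited from Lebesgue measure because such a
  rotation is a product of three shears. Invariance yields the moments of a coordinate, and it makes
  the dependence of the covariance on the angle explicit for each point, before averaging over the
  sphere.

  The obstacle in part (a) is that the edges are dependent through the hidden points. Relative
  entropy, unlike the chi-square divergence, is additive over the vertices as they arrive. At each
  arrival the old graph is replaced by the old points, which by convexity can only increase the
  bound. The chi-square divergence of the new neighbourhood is a mean over two independent copies y,
  y' of the new point; given these, the old points are independent, whence the power with exponent
  k. The term linear in f vanishes because the kernel has mean zero, and the quadratic one remains.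

  In part (b) the three separate vertex sets limit the ways in which two triangles can meet: only
  vertices in the same position can coincide.\<close>

abbreviation lebesgue_space :: "nat \<Rightarrow> (nat \<Rightarrow> real) measure" where
  "lebesgue_space d \<equiv> \<Pi>\<^sub>M k\<in>{..<d}. lborel"

abbreviation borel_space :: "nat \<Rightarrow> (nat \<Rightarrow> real) measure" where
  "borel_space d \<equiv> \<Pi>\<^sub>M k\<in>{..<d}. borel"

lemma sets_lebesgue_space: "sets (lebesgue_space d) = sets (borel_space d)"
  by (rule sets_PiM_cong) auto

lemma measurable_lebesgue_space:
  "measurable (lebesgue_space d) N = measurable (borel_space d) N"
  "measurable N (lebesgue_space d) = measurable N (borel_space d)"
  by (rule measurable_cong_sets; simp add: sets_lebesgue_space)+

lemma borel_measurable_coordinate: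
  "k < d \<Longrightarrow> (\<lambda>x. x k) \<in> borel_measurable (borel_space d)"
  by (rule measurable_component_singleton) auto

lemma borel_measurable_dot [measurable]:
  assumes "f \<in> measurable M (borel_space d)" "g \<in> measurable M (borel_space d)"
  shows "(\<lambda>x. dot d (f x) (g x)) \<in> borel_measurable M"
  unfolding dot_def
  by (intro borel_measurable_sum borel_measurable_times
      measurable_compose[OF assms(1) borel_measurable_coordinate]
      measurable_compose[OF assms(2) borel_measurable_coordinate]) auto

lemma enorm_eq: "enorm d x = sqrt (dot d x x)"
  by (simp add: enorm_def dot_def power2_eq_square)

lemma dot_self: "dot d x x = (enorm d x)\<^sup>2"
  by (simp add: enorm_def dot_def power2_eq_square sum_nonneg)

lemma dot_commute: "dot d x y = dot d y x"
  by (simp add: dot_def mult.commute)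

lemma enorm_nonneg: "0 \<le> enorm d x"
  by (simp add: enorm_def sum_nonneg)

lemma enorm_eq_0_iff: "enorm d x = 0 \<longleftrightarrow> (\<forall>k<d. x k = 0)"
  by (auto simp: enorm_def sum_nonneg_eq_0_iff)

lemma borel_measurable_enorm [measurable]:
  assumes "f \<in> measurable M (borel_space d)"
  shows "(\<lambda>x. enorm d (f x)) \<in> borel_measurable M"
  unfolding enorm_eq using assms by measurable

lemma dot_Cauchy_Schwarz: "\<bar>dot d x y\<bar> \<le> enorm d x * enorm d y"
  unfolding dot_def enorm_def L2_set_def[symmetric]
  using L2_set_mult_ineq[of x y "{..<d}"] sum_abs[of "\<lambda>k. x k * y k" "{..<d}"]
  by (simp add: abs_mult)

section \<open>Lebesgue measure under shears and plane rotations\<close>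

interpretation lborel_family: product_sigma_finite "\<lambda>_::nat. lborel :: real measure"
  by standard

lemma measurable_shear:
  assumes "i < d" "j < d"
  shows "(\<lambda>x. x(i := a * x i + c * x j)) \<in> measurable (borel_space d) (borel_space d)"
proof (rule measurable_PiM_single')
  fix k assume "k \<in> {..<d}"
  then show "(\<lambda>x. (x(i := a * x i + c * x j)) k) \<in> borel_measurable (borel_space d)"
    using assms by (cases "k = i") (simp_all add: borel_measurable_coordinate)
next
  show "(\<lambda>x. x(i := a * x i + c * x j)) \<in> space (borel_space d) \<rightarrow> (\<Pi>\<^sub>E i\<in>{..<d}. space borel)"
    using assms by (auto simp: space_PiM PiE_def extensional_def)
qed

text \<open>Fubini with coordinate \<open>i\<close> innermost: once the other coordinates are
  frozen, the shear translates a line by \<open>c * x j\<close>. The condition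
  \<open>i \<noteq> j\<close> makes this translation constant along the line.\<close>

lemma distr_shear:
  assumes ij: "i < d" "j < d" "i \<noteq> j"
  shows "distr (lebesgue_space d) (lebesgue_space d) (\<lambda>x. x(i := x i + c * x j)) = lebesgue_space d"
    (is "distr ?L ?L ?g = ?L")
proof (rule measure_eqI)
  fix A assume "A \<in> sets (distr ?L ?L ?g)"
  then have A: "A \<in> sets ?L" by simp
  have g: "?g \<in> measurable ?L ?L"
    using measurable_shear[OF ij(1,2), of 1 c] by (simp add: measurable_lebesgue_space)
  let ?I = "{..<d} - {i}"
  have I: "finite ?I" "i \<notin> ?I" "insert i ?I = {..<d}" using ij by auto
  have ind: "(indicator A :: _ \<Rightarrow> ennreal) \<in> borel_measurable ?L" using A by measurable
  have "emeasure (distr ?L ?L ?g) A = (\<integral>\<^sup>+x. indicator A (?g x) \<partial>?L)"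
    using A g by (simp flip: nn_integral_indicator add: nn_integral_distr)
  also have "\<dots> = (\<integral>\<^sup>+x. \<integral>\<^sup>+y. indicator A (?g (x(i := y))) \<partial>lborel \<partial>Pi\<^sub>M ?I (\<lambda>_. lborel))"
    using lborel_family.product_nn_integral_insert[OF I(1,2), of "\<lambda>x. indicator A (?g x)"]
      measurable_compose[OF g ind] unfolding I(3) by simp
  also have "\<dots> = (\<integral>\<^sup>+x. \<integral>\<^sup>+y. indicator A (x(i := y)) \<partial>lborel \<partial>Pi\<^sub>M ?I (\<lambda>_. lborel))"
  proof (rule nn_integral_cong)
    fix x assume x: "x \<in> space (Pi\<^sub>M ?I (\<lambda>_. lborel :: real measure))"
    have upd: "(\<lambda>y. x(i := y)) \<in> measurable borel (borel_space d)"
    proof (rule measurable_PiM_single')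
      show "(\<lambda>y. (x(i := y)) k) \<in> borel_measurable borel" for k by (cases "k = i") auto
      show "(\<lambda>y. x(i := y)) \<in> space borel \<rightarrow> (\<Pi>\<^sub>E i\<in>{..<d}. space borel)"
        using x ij by (auto simp: space_PiM PiE_def extensional_def)
    qed
    have m: "(\<lambda>y. indicator A (x(i := y)) :: ennreal) \<in> borel_measurable borel"
      using ind unfolding measurable_lebesgue_space by (rule measurable_compose[OF upd])
    have "(\<integral>\<^sup>+y. indicator A (?g (x(i := y))) \<partial>lborel) = (\<integral>\<^sup>+y. indicator A (x(i := c * x j + 1 * y)) \<partial>lborel)"
      using ij by (simp add: add.commute)
    also have "\<dots> = (\<integral>\<^sup>+y. indicator A (x(i := y)) \<partial>lborel)"
      by (subst nn_integral_real_affine[OF m, of 1 "c * x j"]) simp_all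
    finally show "(\<integral>\<^sup>+y. indicator A (?g (x(i := y))) \<partial>lborel) = (\<integral>\<^sup>+y. indicator A (x(i := y)) \<partial>lborel)" .
  qed
  also have "\<dots> = (\<integral>\<^sup>+x. indicator A x \<partial>?L)"
    using lborel_family.product_nn_integral_insert[OF I(1,2), of "indicator A"] ind
    unfolding I(3) by simp
  finally show "emeasure (distr ?L ?L ?g) A = emeasure ?L A" using A by simp
qed simp

text \<open>The pair \<open>(a, s)\<close> stands for the cosine and sine of the angle. Any point of
  the unit circle will do, so no angle has to be found when a vector is to be aligned with an
  axis.\<close>

definition rot :: "nat \<Rightarrow> nat \<Rightarrow> real \<Rightarrow> real \<Rightarrow> (nat \<Rightarrow> real) \<Rightarrow> nat \<Rightarrow> real" where
  "rot i j a s x = x(i := a * x i - s * x j, j := s * x i + a * x j)"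

text \<open>The last clause makes \<open>g\<close> commute with radial scaling and hence with the
  projection to the sphere. Together with the invariance of Lebesgue measure and of inner products
  this carries the uniform measure on the sphere to itself, and every clause is stable under
  composition.\<close>

definition isometry :: "nat \<Rightarrow> ((nat \<Rightarrow> real) \<Rightarrow> nat \<Rightarrow> real) \<Rightarrow> bool" where
  "isometry d g \<longleftrightarrow> g \<in> measurable (lebesgue_space d) (lebesgue_space d) \<and>
     distr (lebesgue_space d) (lebesgue_space d) g = lebesgue_space d \<and>
     (\<forall>x y. dot d (g x) (g y) = dot d x y) \<and>
     (\<forall>x c. g (\<lambda>k\<in>{..<d}. x k / c) = (\<lambda>k\<in>{..<d}. g x k / c))"

lemma isometry_comp:
  assumes g: "isometry d g" and h: "isometry d h"
  shows "isometry d (g \<circ> h)"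
proof -
  have "distr (lebesgue_space d) (lebesgue_space d) (g \<circ> h) =
      distr (distr (lebesgue_space d) (lebesgue_space d) h) (lebesgue_space d) g"
    using g h by (subst distr_distr) (auto simp: isometry_def)
  then show ?thesis
    using g h unfolding isometry_def by (auto intro: measurable_comp)
qed

lemma isometry_id: "isometry d id"
proof -
  have "distr (lebesgue_space d) (lebesgue_space d) id = lebesgue_space d"
    by (simp add: id_def distr_id)
  then show ?thesis by (auto simp: isometry_def)
qed

text \<open>The classical factorisation of a rotation by \<theta> into three shears:
  \<open>c\<close> is minus the tangent of \<theta>/2, which is infinite exactly for the excluded
  half-turn. It reduces the invariance of Lebesgue measure under rotations to that under
  shears.\<close>

lemma rot_eq_shears:
  assumes "i \<noteq> j" "a\<^sup>2 + s\<^sup>2 = 1" "a \<noteq> -1"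
  defines "c \<equiv> - s / (1 + a)"
  shows "rot i j a s =
    (\<lambda>x. x(i := x i + c * x j)) \<circ> (\<lambda>x. x(j := x j + s * x i)) \<circ> (\<lambda>x. x(i := x i + c * x j))"
proof -
  have 0: "1 + a \<noteq> 0" using assms(3) by auto
  have sq: "s * s = (1 + a) * (1 - a)" using assms(2) by (simp add: power2_eq_square algebra_simps)
  have 1: "1 + c * s = a"
    using 0 unfolding c_def by (simp add: field_simps sq)
  have 2: "c * (1 + a) = - s"
    using 0 by (simp add: c_def)
  have "x i + c * x j + c * (x j + s * (x i + c * x j)) = a * x i - s * x j" for x :: "nat \<Rightarrow> real"
  proof -
    have "x i + c * x j + c * (x j + s * (x i + c * x j)) = (1 + c * s) * x i + (c * (1 + (1 + c * s))) * x j"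
      by algebra
    then show ?thesis by (simp add: 1 2)
  qed
  moreover have "x j + s * (x i + c * x j) = s * x i + a * x j" for x :: "nat \<Rightarrow> real"
  proof -
    have "x j + s * (x i + c * x j) = s * x i + (1 + c * s) * x j" by algebra
    then show ?thesis by (simp add: 1)
  qed
  ultimately show ?thesis
    using assms(1) by (auto simp: rot_def fun_eq_iff)
qed

lemma dot_rot:
  assumes ij: "i < d" "j < d" "i \<noteq> j" and as: "a\<^sup>2 + s\<^sup>2 = 1"
  shows "dot d (rot i j a s x) (rot i j a s y) = dot d x y"
proof -
  have split: "dot d u v = u i * v i + (u j * v j + (\<Sum>k\<in>{..<d} - {i} - {j}. u k * v k))" for u v
    unfolding dot_def using ij by (subst sum.remove[of _ i], simp, simp, subst sum.remove[of _ j], auto)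
  have *: "(\<Sum>k\<in>{..<d} - {i} - {j}. rot i j a s x k * rot i j a s y k) = (\<Sum>k\<in>{..<d} - {i} - {j}. x k * y k)"
    by (intro sum.cong) (auto simp: rot_def)
  have "(a * x i - s * x j) * (a * y i - s * y j) + (s * x i + a * x j) * (s * y i + a * y j)
      = (a\<^sup>2 + s\<^sup>2) * (x i * y i + x j * y j)"
    by (simp add: power2_eq_square algebra_simps)
  then show ?thesis
    unfolding split[of "rot i j a s x"] split[of x] * using ij as by (simp add: rot_def)
qed

lemma isometry_rot_aux:
  assumes ij: "i < d" "j < d" "i \<noteq> j" and as: "a\<^sup>2 + s\<^sup>2 = 1" "a \<noteq> -1"
  shows "isometry d (rot i j a s)"
proof -
  define c where "c = - s / (1 + a)"
  let ?g = "\<lambda>x. x(i := x i + c * x j) :: nat \<Rightarrow> real"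
  let ?h = "\<lambda>x. x(j := x j + s * x i) :: nat \<Rightarrow> real"
  let ?L = "lebesgue_space d"
  have eq: "rot i j a s = ?g \<circ> ?h \<circ> ?g"
    using rot_eq_shears[OF ij(3) as] by (simp add: c_def)
  have g: "?g \<in> measurable ?L ?L" "distr ?L ?L ?g = ?L"
    using measurable_shear[OF ij(1,2), of 1 c] distr_shear[OF ij] by (simp_all add: measurable_lebesgue_space)
  have h: "?h \<in> measurable ?L ?L" "distr ?L ?L ?h = ?L"
    using measurable_shear[OF ij(2,1), of 1 s] distr_shear[OF ij(2,1)] ij
    by (simp_all add: measurable_lebesgue_space)
  have gh: "?g \<circ> ?h \<in> measurable ?L ?L"
    using g(1) h(1) by (rule measurable_comp[rotated])
  have "rot i j a s \<in> measurable ?L ?L"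
    unfolding eq by (rule measurable_comp[OF g(1) gh])
  moreover have "distr ?L ?L (rot i j a s) = ?L"
    unfolding eq distr_distr[OF gh g(1), symmetric] g(2)
    unfolding distr_distr[OF g(1) h(1), symmetric] h(2) g(2) ..
  moreover have "rot i j a s (\<lambda>k\<in>{..<d}. x k / c) = (\<lambda>k\<in>{..<d}. rot i j a s x k / c)" for x c
    using ij by (auto simp: rot_def fun_eq_iff diff_divide_distrib add_divide_distrib)
  ultimately show ?thesis
    using dot_rot[OF ij as(1)] by (auto simp: isometry_def)
qed

lemma isometry_rot:
  assumes ij: "i < d" "j < d" "i \<noteq> j" and as: "a\<^sup>2 + s\<^sup>2 = 1"
  shows "isometry d (rot i j a s)"
proof (cases "a = -1")
  case True
  then have "s = 0" using as by simp
  \<comment> \<open>The half-turn, for which the tangent is infinite, is composed of two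
    quarter-turns.\<close>
  then have "rot i j a s = rot i j 0 1 \<circ> rot i j 0 1"
    using True ij by (auto simp: rot_def fun_eq_iff)
  then show ?thesis
    using isometry_comp[OF isometry_rot_aux[OF ij, of 0 1] isometry_rot_aux[OF ij, of 0 1]] by simp
qed (use isometry_rot_aux assms in blast)

lemma isometry_enorm: "isometry d g \<Longrightarrow> enorm d (g x) = enorm d x"
  by (simp add: isometry_def enorm_eq)

section \<open>From the unit ball to the sphere\<close>

lemma unit_ball_measurable [measurable]: "unit_ball d \<in> sets (lebesgue_space d)"
proof -
  have [measurable]: "enorm d \<in> borel_measurable (lebesgue_space d)"
    using borel_measurable_enorm[of "\<lambda>x. x" "lebesgue_space d" d] by (simp add: measurable_lebesgue_space)
  show ?thesis unfolding unit_ball_def by measurable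
qed

lemma emeasure_unit_ball: "emeasure (lebesgue_space d) (unit_ball d) = ennreal (unit_ball_vol d)"
proof -
  have "unit_ball d = {f. sqrt (\<Sum>i\<in>{..<d}. (f i)\<^sup>2) \<le> 1} \<inter> space (lebesgue_space d)"
    by (auto simp: unit_ball_def enorm_def)
  then show ?thesis using emeasure_cball_aux[of "{..<d}" 1] by simp
qed

lemma emeasure_unit_ball_pos_finite:
  "emeasure (lebesgue_space d) (unit_ball d) \<noteq> 0" "emeasure (lebesgue_space d) (unit_ball d) \<noteq> \<infinity>"
  using unit_ball_vol_pos[of "real d"] less_imp_neq[of 0 "unit_ball_vol (real d)"]
  by (simp_all add: emeasure_unit_ball)

definition normalise :: "nat \<Rightarrow> (nat \<Rightarrow> real) \<Rightarrow> nat \<Rightarrow> real" where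
  "normalise d x = (\<lambda>k\<in>{..<d}. x k / enorm d x)"

lemma normalise_measurable [measurable]: "normalise d \<in> measurable (borel_space d) (borel_space d)"
  unfolding normalise_def
  by (intro measurable_restrict borel_measurable_divide borel_measurable_enorm borel_measurable_coordinate)
    auto

definition ball_measure :: "nat \<Rightarrow> (nat \<Rightarrow> real) measure" where
  "ball_measure d = uniform_measure (lebesgue_space d) (unit_ball d)"

lemma sets_ball_measure [measurable_cong]: "sets (ball_measure d) = sets (borel_space d)"
  by (simp add: ball_measure_def sets_lebesgue_space)

lemma prob_space_ball_measure: "prob_space (ball_measure d)"
  unfolding ball_measure_def
  by (rule prob_space_uniform_measure) (use emeasure_unit_ball_pos_finite in auto)

lemma uniform_sphere_eq: "uniform_sphere d = distr (ball_measure d) (borel_space d) (normalise d)"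
  by (simp add: uniform_sphere_def ball_measure_def normalise_def[abs_def])

lemma sets_uniform_sphere [simp, measurable_cong]: "sets (uniform_sphere d) = sets (borel_space d)"
  by (simp add: uniform_sphere_def)

lemma space_uniform_sphere: "space (uniform_sphere d) = space (borel_space d)"
  by (simp add: uniform_sphere_def)

lemma prob_space_uniform_sphere: "prob_space (uniform_sphere d)"
proof -
  have "normalise d \<in> measurable (ball_measure d) (borel_space d)" by measurable
  then show ?thesis
    unfolding uniform_sphere_eq by (rule prob_space.prob_space_distr[OF prob_space_ball_measure])
qed

lemma AE_ball_measureI:
  assumes "AE x in lebesgue_space d. P x"
  shows "AE x in ball_measure d. P x"
  unfolding ball_measure_def
  by (rule AE_uniform_measureI) (use assms in auto)

lemma AE_enorm_uniform_sphere:
  assumes "0 < d" shows "AE x in uniform_sphere d. enorm d x = 1"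
proof -
  have eq: "{x \<in> space (lebesgue_space d). \<not> enorm d x \<noteq> 0} = PiE {..<d} (\<lambda>_. {0})"
    by (auto simp: enorm_eq_0_iff space_PiM PiE_iff extensional_def)
  have null: "emeasure (lebesgue_space d) (PiE {..<d} (\<lambda>_. {0})) = 0"
    using assms by (subst lborel_family.emeasure_PiM) auto
  have "PiE {..<d} (\<lambda>_. {0::real}) \<in> sets (lebesgue_space d)"
    by (rule sets_PiM_I_finite) auto
  then have "AE x in lebesgue_space d. enorm d x \<noteq> 0"
    using null eq by (intro AE_I[of _ _ "PiE {..<d} (\<lambda>_. {0})"]) simp_all
  then have "AE x in ball_measure d. enorm d x \<noteq> 0" by (rule AE_ball_measureI)
  moreover have "enorm d (normalise d x) = 1" if "enorm d x \<noteq> 0" for x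
  proof -
    have "dot d (normalise d x) (normalise d x) = dot d x x / (enorm d x)\<^sup>2"
      by (simp add: dot_def normalise_def power2_eq_square sum_divide_distrib)
    then show ?thesis using that unfolding enorm_eq[of d "normalise d x"] by (simp add: dot_self)
  qed
  ultimately have "AE x in ball_measure d. enorm d (normalise d x) = 1"
    by (auto elim!: eventually_mono)
  then show ?thesis
    unfolding uniform_sphere_eq
  proof (subst AE_distr_iff)
    show "normalise d \<in> measurable (ball_measure d) (borel_space d)" by measurable
    show "{x \<in> space (borel_space d). enorm d x = 1} \<in> sets (borel_space d)" by measurable
  qed
qed

text \<open>Norms are preserved, so the preimage of the ball is the ball and the uniform measure on
  it is invariant. As \<open>g\<close> also commutes with \<open>normalise\<close>, the invariance
  passes to the image measure.\<close>

lemma distr_isometry: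
  assumes g: "isometry d g"
  shows "distr (uniform_sphere d) (borel_space d) g = uniform_sphere d"
proof -
  have gm: "g \<in> measurable (borel_space d) (borel_space d)" and gL: "g \<in> measurable (lebesgue_space d) (lebesgue_space d)"
    using g by (auto simp: isometry_def measurable_lebesgue_space)
  have gm': "g \<in> measurable (ball_measure d) (borel_space d)"
    using gm by (simp cong: measurable_cong_sets add: sets_ball_measure)
  have nm': "normalise d \<in> measurable (ball_measure d) (borel_space d)" by measurable
  have ball: "distr (ball_measure d) (borel_space d) g = ball_measure d"
  proof (rule measure_eqI)
    fix A assume "A \<in> sets (distr (ball_measure d) (borel_space d) g)"
    then have A: "A \<in> sets (borel_space d)" "A \<in> sets (lebesgue_space d)"
      by (auto simp: sets_lebesgue_space)
    have sp: "space (ball_measure d) = space (lebesgue_space d)" by (simp add: ball_measure_def)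
    have gA: "g -` A \<inter> space (lebesgue_space d) \<in> sets (lebesgue_space d)"
      using gL A(2) by (rule measurable_sets)
    have "unit_ball d \<inter> (g -` A \<inter> space (lebesgue_space d)) = g -` (unit_ball d \<inter> A) \<inter> space (lebesgue_space d)"
      using measurable_space[OF gL] by (auto simp: unit_ball_def isometry_enorm[OF g])
    moreover have "emeasure (lebesgue_space d) (g -` (unit_ball d \<inter> A) \<inter> space (lebesgue_space d)) =
       emeasure (distr (lebesgue_space d) (lebesgue_space d) g) (unit_ball d \<inter> A)"
      using A(2) gL by (subst emeasure_distr) auto
    ultimately show "emeasure (distr (ball_measure d) (borel_space d) g) A = emeasure (ball_measure d) A"
      using A gm' gA g
      by (simp add: emeasure_distr sp, simp add: ball_measure_def isometry_def)
  qed (simp add: sets_ball_measure)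
  have "distr (uniform_sphere d) (borel_space d) g = distr (ball_measure d) (borel_space d) (g \<circ> normalise d)"
    unfolding uniform_sphere_eq by (rule distr_distr[OF gm nm'])
  also have "g \<circ> normalise d = normalise d \<circ> g"
    using g by (auto simp: fun_eq_iff normalise_def isometry_enorm[OF g]) (simp_all add: isometry_def)
  also have "distr (ball_measure d) (borel_space d) (normalise d \<circ> g) =
      distr (distr (ball_measure d) (borel_space d) g) (borel_space d) (normalise d)"
    by (rule distr_distr[symmetric, OF normalise_measurable gm'])
  also have "\<dots> = uniform_sphere d" by (simp add: ball uniform_sphere_eq)
  finally show ?thesis .
qed

lemma integral_isometry:
  fixes f :: "(nat \<Rightarrow> real) \<Rightarrow> real"
  assumes g: "isometry d g" and f: "f \<in> borel_measurable (borel_space d)"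
  shows "(\<integral>x. f (g x) \<partial>uniform_sphere d) = (\<integral>x. f x \<partial>uniform_sphere d)"
proof -
  have "g \<in> measurable (uniform_sphere d) (borel_space d)"
    using g by (simp add: isometry_def measurable_lebesgue_space cong: measurable_cong_sets)
  then have "(\<integral>x. f x \<partial>distr (uniform_sphere d) (borel_space d) g) = (\<integral>x. f (g x) \<partial>uniform_sphere d)"
    by (rule integral_distr[OF _ f])
  then show ?thesis by (simp add: distr_isometry[OF g])
qed

text \<open>Givens rotations: the rotation in the plane of the coordinates \<open>k\<close> and
  \<open>m\<close> moves the whole length of that pair into coordinate \<open>k\<close>, and the
  induction clears the coordinates above \<open>k\<close> one at a time. Coordinates below
  \<open>k\<close> are left alone for every vector, so that alignments of several vectors can be
  chained. The sign of coordinate \<open>k\<close> is controlled only once a rotation has taken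
  place, hence \<open>k + 1 < m\<close>.\<close>

lemma align_vector_aux:
  assumes "k < m" "m \<le> d"
  shows "\<exists>g. isometry d g \<and> (\<forall>y. \<forall>i<k. g y i = y i) \<and> (\<forall>i. k < i \<longrightarrow> i < m \<longrightarrow> g x i = 0) \<and>
    (k + 1 < m \<longrightarrow> 0 \<le> g x k)"
  using assms
proof (induction m)
  case (Suc m)
  show ?case
  proof (cases "k = m")
    case True
    then show ?thesis using isometry_id[of d] by (intro exI[of _ id]) (simp add: id_def)
  next
    case False
    then have km: "k < m" "m < d" using Suc.prems by auto
    then obtain g where g: "isometry d g" "\<And>y i. i < k \<Longrightarrow> g y i = y i"
      "\<And>i. k < i \<Longrightarrow> i < m \<Longrightarrow> g x i = 0" using Suc.IH by auto
    define r where "r = sqrt ((g x k)\<^sup>2 + (g x m)\<^sup>2)"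
    show ?thesis
    proof (cases "r = 0")
      case True
      then have "g x k = 0" "g x m = 0" by (auto simp: r_def sum_power2_eq_zero_iff)
      then show ?thesis using g km by (intro exI[of _ g]) (auto simp: less_Suc_eq)
    next
      case False
      have r2: "r\<^sup>2 = (g x k)\<^sup>2 + (g x m)\<^sup>2" and r0: "0 \<le> r" by (auto simp: r_def)
      define a s where "a = g x k / r" and "s = - g x m / r"
      have as: "a\<^sup>2 + s\<^sup>2 = 1"
        using False by (simp add: a_def s_def power_divide r2[symmetric] flip: add_divide_distrib)
      have new: "a * g x k - s * g x m = r" "s * g x k + a * g x m = 0"
        using False r2 by (simp_all add: a_def s_def field_simps power2_eq_square)
      define h where "h = rot k m a s \<circ> g"
      have "isometry d h"
        unfolding h_def using km by (intro isometry_comp isometry_rot g as) auto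
      moreover have "h y i = g y i" if "i \<noteq> k" "i \<noteq> m" for y i
        using that by (simp add: h_def rot_def)
      moreover have "h x k = r" "h x m = 0" using new km by (simp_all add: h_def rot_def)
      ultimately show ?thesis
        using g km r0 by (intro exI[of _ h]) (auto simp: less_Suc_eq)
    qed
  qed
qed simp

lemma align_vector:
  assumes "k + 1 < d"
  obtains g where "isometry d g" "\<And>y i. i < k \<Longrightarrow> g y i = y i" "\<And>i. k < i \<Longrightarrow> i < d \<Longrightarrow> g x i = 0"
    "0 \<le> g x k"
proof -
  have "k < d" "k + 1 < d" using assms by auto
  from align_vector_aux[OF this(1) order_refl, of x] obtain g where
    "isometry d g" "\<forall>y. \<forall>i<k. g y i = y i" "\<forall>i. k < i \<longrightarrow> i < d \<longrightarrow> g x i = 0"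
    "k + 1 < d \<longrightarrow> 0 \<le> g x k" by blast
  then show thesis using that[of g] \<open>k + 1 < d\<close> by blast
qed

text \<open>Gram--Schmidt orthonormalisation by rotations: \<open>y\<close> becomes the first basis
  vector, and \<open>y'\<close> is moved into the plane of the first two with nonnegative second
  coordinate. Fixing that sign takes a third coordinate to rotate with, which is where
  \<open>3 \<le> d\<close> comes from.\<close>

lemma align_pair:
  assumes d: "3 \<le> d" and y: "enorm d y = 1" and y': "enorm d y' = 1"
  defines "r \<equiv> dot d y y'"
  obtains g where "isometry d g" "\<And>x. dot d x y = g x 0"
    "\<And>x. dot d x y' = r * g x 0 + sqrt (1 - r\<^sup>2) * g x 1"
proof -
  obtain g1 where g1: "isometry d g1" "\<And>i. 0 < i \<Longrightarrow> i < d \<Longrightarrow> g1 y i = 0" "0 \<le> g1 y 0"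
    using align_vector[of 0 d y] d by auto
  obtain g2 where g2: "isometry d g2" "\<And>z i. i < 1 \<Longrightarrow> g2 z i = z i"
    "\<And>i. 1 < i \<Longrightarrow> i < d \<Longrightarrow> g2 (g1 y') i = 0" "0 \<le> g2 (g1 y') 1"
    using align_vector[of 1 d "g1 y'"] d by auto
  define g where "g = g2 \<circ> g1"
  have g: "isometry d g" unfolding g_def by (intro isometry_comp g1 g2)
  then have dot: "dot d (g u) (g v) = dot d u v" for u v by (simp add: isometry_def)
  have split1: "dot d u v = u 0 * v 0 + (\<Sum>k\<in>{..<d} - {0}. u k * v k)" for u v
    unfolding dot_def using d by (subst sum.remove[of _ 0]) auto
  have split2: "dot d u v = u 0 * v 0 + (u 1 * v 1 + (\<Sum>k\<in>{..<d} - {0} - {1}. u k * v k))" for u v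
    unfolding split1 using d by (subst sum.remove[of _ 1]) auto
  have "dot d (g1 y) (g1 y) = 1" using g1(1) y by (simp add: dot_self isometry_enorm)
  moreover have "dot d (g1 y) (g1 y) = g1 y 0 * g1 y 0" unfolding split1 using g1(2) by simp
  ultimately have "g1 y 0 = 1" using g1(3)
    by (simp add: power2_eq_1_iff flip: power2_eq_square)
  then have u0: "g y 0 = 1" by (simp add: g_def g2(2))
  have "dot d (g y) (g y) = 1" unfolding dot by (simp add: dot_self y)
  then have "(\<Sum>k\<in>{..<d} - {0}. g y k * g y k) = 0" unfolding split1 u0 by simp
  then have u: "g y k = 0" if "0 < k" "k < d" for k
    using that by (subst (asm) sum_nonneg_eq_0_iff) auto
  have v: "g y' k = 0" if "1 < k" "k < d" for k using g2(3) that by (simp add: g_def)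
  have v0: "g y' 0 = r"
    using dot[of y y'] unfolding r_def split1 u0 by (simp add: u)
  have "dot d (g y') (g y') = 1" unfolding dot by (simp add: dot_self y')
  then have "r\<^sup>2 + (g y' 1)\<^sup>2 = 1" unfolding split2 v0 using v by (simp add: power2_eq_square)
  then have "(g y' 1)\<^sup>2 = 1 - r\<^sup>2" by simp
  then have v1: "g y' 1 = sqrt (1 - r\<^sup>2)" using g2(4) by (simp add: g_def real_sqrt_unique)
  show ?thesis
  proof (rule that[OF g])
    show "dot d x y = g x 0" for x
      unfolding dot[of x y, symmetric] split1[of "g x"] u0 by (simp add: u)
    show "dot d x y' = r * g x 0 + sqrt (1 - r\<^sup>2) * g x 1" for x
      unfolding dot[of x y', symmetric] split2[of "g x"] v0 v1 by (simp add: v mult.commute)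
  qed
qed

lemma integral_dot_unit:
  fixes f :: "real \<Rightarrow> real"
  assumes "3 \<le> d" "enorm d y = 1" "f \<in> borel_measurable borel"
  shows "(\<integral>x. f (dot d x y) \<partial>uniform_sphere d) = (\<integral>x. f (x 0) \<partial>uniform_sphere d)"
proof -
  obtain g where g: "isometry d g" "\<And>x. dot d x y = g x 0"
    using align_pair[OF assms(1,2,2)] by metis
  have "(\<lambda>x. f (x 0)) \<in> borel_measurable (borel_space d)"
    using assms by (intro measurable_compose[OF borel_measurable_coordinate assms(3)]) auto
  from integral_isometry[OF g(1) this] show ?thesis by (simp add: g(2))
qed

section \<open>The threshold\<close>

text \<open>Fubini along the lines parallel to axis \<open>k\<close>: each of them meets the
  exceptional set in countably many points, hence in a null set.\<close>

lemma AE_lebesgue_space_section: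
  assumes k: "k < d" and P: "{x \<in> space (lebesgue_space d). P x} \<in> sets (lebesgue_space d)"
    and c: "\<And>x. countable {y. \<not> P (x(k := y))}"
  shows "AE x in lebesgue_space d. P x"
proof -
  let ?L = "lebesgue_space d" and ?I = "{..<d} - {k}"
  have I: "finite ?I" "k \<notin> ?I" "insert k ?I = {..<d}" using k by auto
  define A where "A = {x \<in> space ?L. \<not> P x}"
  have A: "A \<in> sets ?L"
    using sets.compl_sets[OF P] unfolding A_def by (rule back_subst[of "\<lambda>X. X \<in> _"]) auto
  have ind: "(indicator A :: _ \<Rightarrow> ennreal) \<in> borel_measurable ?L" using A by measurable
  have "emeasure ?L A = (\<integral>\<^sup>+x. indicator A x \<partial>?L)" using A by simp
  also have "\<dots> = (\<integral>\<^sup>+x. \<integral>\<^sup>+y. indicator A (x(k := y)) \<partial>lborel \<partial>Pi\<^sub>M ?I (\<lambda>_. lborel))"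
    using lborel_family.product_nn_integral_insert[OF I(1,2), of "indicator A"] ind
    unfolding I(3) by simp
  also have "\<dots> = (\<integral>\<^sup>+x. 0 \<partial>Pi\<^sub>M ?I (\<lambda>_. lborel :: real measure))"
  proof (rule nn_integral_cong)
    fix x
    have "AE y in lborel. y \<notin> {y. \<not> P (x(k := y))}"
      by (intro AE_not_in countable_imp_null_set_lborel c)
    then have "AE y in lborel. indicator A (x(k := y)) = (0 :: ennreal)"
      by eventually_elim (auto simp: A_def indicator_def)
    then show "(\<integral>\<^sup>+y. indicator A (x(k := y)) \<partial>lborel) = 0"
      by (subst nn_integral_cong_AE[of _ "\<lambda>_. 0"]) auto
  qed
  finally show ?thesis using A by (intro AE_I[of _ _ A]) (auto simp: A_def)
qed

lemma AE_uniform_sphereI: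
  assumes "{x \<in> space (borel_space d). P x} \<in> sets (borel_space d)"
    and "AE x in ball_measure d. P (normalise d x)"
  shows "AE x in uniform_sphere d. P x"
proof -
  have "normalise d \<in> measurable (ball_measure d) (borel_space d)" by measurable
  then show ?thesis unfolding uniform_sphere_eq using assms by (subst AE_distr_iff) auto
qed

text \<open>The cone over the slice at height \<open>s\<close> is a null set because lines in a
  suitable axis direction meet it in at most two points: axis 0 if \<open>s = 0\<close>, and
  otherwise axis 1, since the length of the vector must then be \<open>x 0 / s\<close>, which
  determines the square of coordinate 1.\<close>

lemma AE_uniform_sphere_coordinate_neq:
  assumes d: "2 \<le> d"
  shows "AE x in uniform_sphere d. x 0 \<noteq> s"
proof (rule AE_uniform_sphereI)
  have [measurable]: "(\<lambda>x. x 0) \<in> borel_measurable (borel_space d)"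
    using d by (intro borel_measurable_coordinate) auto
  show "{x \<in> space (borel_space d). x 0 \<noteq> s} \<in> sets (borel_space d)" by measurable
  have m: "{x \<in> space (lebesgue_space d). normalise d x 0 \<noteq> s} \<in> sets (lebesgue_space d)"
  proof -
    have "{x \<in> space (borel_space d). normalise d x 0 \<noteq> s} \<in> sets (borel_space d)" by measurable
    then show ?thesis by (simp add: sets_lebesgue_space space_PiM)
  qed
  have "AE x in lebesgue_space d. normalise d x 0 \<noteq> s"
  proof (cases "s = 0")
    case True
    have "{y. \<not> normalise d (x(0 := y)) 0 \<noteq> s} \<subseteq> {0}" for x
    proof
      fix y assume y: "y \<in> {y. \<not> normalise d (x(0 := y)) 0 \<noteq> s}"
      then have "y = 0 \<or> enorm d (x(0 := y)) = 0" using True d by (auto simp: normalise_def)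
      then show "y \<in> {0}" using d by (auto simp: enorm_eq_0_iff dest: spec[of _ 0])
    qed
    then have "countable {y. \<not> normalise d (x(0 := y)) 0 \<noteq> s}" for x
      by (rule countable_subset) simp
    then show ?thesis using d by (intro AE_lebesgue_space_section[of 0, OF _ m]) auto
  next
    case False
    have "{y. \<not> normalise d (x(1 := y)) 0 \<noteq> s} \<subseteq> (let c = sqrt ((x 0)\<^sup>2 / s\<^sup>2 - (\<Sum>k\<in>{..<d} - {1}. (x k)\<^sup>2)) in {c, - c})" for x
    proof
      fix y assume y: "y \<in> {y. \<not> normalise d (x(1 := y)) 0 \<noteq> s}"
      let ?R = "\<Sum>k\<in>{..<d} - {1}. (x k)\<^sup>2"
      have e: "(enorm d (x(1 := y)))\<^sup>2 = y\<^sup>2 + ?R"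
        unfolding enorm_def using d
        by (simp add: sum_nonneg, subst sum.remove[of _ 1]) (auto intro!: sum.cong)
      have "x 0 / enorm d (x(1 := y)) = s" using y d by (simp add: normalise_def)
      then have "x 0 = s * enorm d (x(1 := y))" using False by auto
      then have "(x 0)\<^sup>2 / s\<^sup>2 = y\<^sup>2 + ?R" using False e by (simp add: power_mult_distrib)
      then have "sqrt ((x 0)\<^sup>2 / s\<^sup>2 - ?R) = \<bar>y\<bar>" by simp
      then show "y \<in> (let c = sqrt ((x 0)\<^sup>2 / s\<^sup>2 - (\<Sum>k\<in>{..<d} - {1}. (x k)\<^sup>2)) in {c, - c})"
        by (auto simp: Let_def abs_if)
    qed
    then have "countable {y. \<not> normalise d (x(1 := y)) 0 \<noteq> s}" for x
      by (rule countable_subset) (simp add: Let_def)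
    then show ?thesis using d by (intro AE_lebesgue_space_section[of 1, OF _ m]) auto
  qed
  then show "AE x in ball_measure d. normalise d x 0 \<noteq> s" by (rule AE_ball_measureI)
qed

lemma continuous_on_enorm: "continuous_on UNIV (enorm d)"
  unfolding enorm_def by (intro continuous_intros continuous_on_product_coordinates)

text \<open>The vectors in the open unit ball whose direction has first coordinate between
  \<open>a\<close> and \<open>b\<close> form an open set. It contains a box around each of its
  points, and a finite product of nonempty open sets of reals has positive Lebesgue measure.\<close>

lemma measure_uniform_sphere_coordinate_pos:
  assumes d: "2 \<le> d" and ab: "-1 \<le> a" "a < b" "b \<le> 1"
  shows "0 < measure (uniform_sphere d) {x \<in> space (uniform_sphere d). a < x 0 \<and> x 0 < b}"
proof -
  let ?U = "{u. a * enorm d u < u 0 \<and> u 0 < b * enorm d u \<and> enorm d u < 1} :: (nat \<Rightarrow> real) set"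
  define c where "c = (a + b) / 2"
  \<comment> \<open>Half of a unit vector with first coordinate \<open>c\<close>: the direction is
    right, and the factor 1/2 keeps the vector strictly inside the ball.\<close>
  define w :: "nat \<Rightarrow> real" where "w = (\<lambda>i. if i = 0 then c / 2 else if i = 1 then sqrt (1 - c\<^sup>2) / 2 else 0)"
  have c: "a < c" "c < b" "-1 < c" "c < 1" using ab by (auto simp: c_def)
  then have c2: "c\<^sup>2 < 1" by (simp add: power2_less_1_iff abs_less_iff)
  have "(\<Sum>k<d. (w k)\<^sup>2) = (\<Sum>k\<in>{0,1}. (w k)\<^sup>2)"
    using d by (intro sum.mono_neutral_right) (auto simp: w_def)
  also have "\<dots> = (1/2)\<^sup>2" using c2 by (simp add: w_def power_divide field_simps)
  finally have w: "enorm d w = 1 / 2" by (simp add: enorm_def)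
  have w0: "w 0 = c / 2" by (simp add: w_def)
  have "w \<in> ?U" using c by (simp add: w w0)
  moreover have "open ?U"
    by (intro open_Collect_conj open_Collect_less continuous_intros continuous_on_enorm
        continuous_on_product_coordinates)
  then have "openin (product_topology (\<lambda>_. euclidean) UNIV) ?U"
    by (simp add: open_fun_def)
  ultimately have "\<exists>X. w \<in> PiE UNIV X \<and> (\<forall>i. openin euclidean (X i)) \<and>
      finite {i. X i \<noteq> topspace euclidean} \<and> PiE UNIV X \<subseteq> ?U"
    by (intro product_topology_open_contains_basis)
  then obtain X where X: "w \<in> PiE UNIV X" "\<And>i. open (X i)" "PiE UNIV X \<subseteq> ?U"
    by (auto simp only: open_openin)
  have "PiE {..<d} X \<subseteq> {x \<in> space (lebesgue_space d). a * enorm d x < x 0 \<and> x 0 < b * enorm d x \<and> enorm d x < 1}"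
  proof
    fix u assume u: "u \<in> PiE {..<d} X"
    \<comment> \<open>The box lives in the space of all sequences; the coordinates from
      \<open>d\<close> on are filled with those of \<open>w\<close>, which \<open>enorm d\<close>
      does not see.\<close>
    let ?v = "\<lambda>i. if i < d then u i else w i"
    have "?v \<in> PiE UNIV X" using u X(1) by (auto simp: PiE_iff)
    then have "?v \<in> ?U" using X(3) by auto
    moreover have "enorm d ?v = enorm d u" by (simp add: enorm_def)
    ultimately show "u \<in> {x \<in> space (lebesgue_space d). a * enorm d x < x 0 \<and> x 0 < b * enorm d x \<and> enorm d x < 1}"
      using d u by (auto simp: space_PiM PiE_iff)
  qed
  also have "\<dots> \<subseteq> {x \<in> space (lebesgue_space d). x \<in> unit_ball d \<and> a < normalise d x 0 \<and> normalise d x 0 < b}"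
  proof (safe)
    fix x assume x: "x \<in> space (lebesgue_space d)" "a * enorm d x < x 0" "x 0 < b * enorm d x" "enorm d x < 1"
    then have "enorm d x \<noteq> 0" by auto
    then have e: "0 < enorm d x" using enorm_nonneg[of d x] by simp
    show "x \<in> unit_ball d" using x by (simp add: unit_ball_def)
    show "a < normalise d x 0" "normalise d x 0 < b"
      using x e d by (auto simp: normalise_def field_simps)
  qed
  finally have sub: "PiE {..<d} X \<subseteq> \<dots>" .
  have [measurable]: "(\<lambda>x. x 0) \<in> borel_measurable (borel_space d)"
    using d by (intro borel_measurable_coordinate) auto
  define E where "E = {x \<in> space (borel_space d). a < x 0 \<and> x 0 < b}"
  have E: "E \<in> sets (borel_space d)" unfolding E_def by measurable
  have nE: "normalise d -` E \<inter> space (lebesgue_space d) \<in> sets (lebesgue_space d)"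
    using measurable_sets[OF normalise_measurable E] by (simp add: sets_lebesgue_space space_PiM)
  have "emeasure lborel (X i) \<noteq> 0" for i
  proof -
    have "X i \<noteq> {}" using X(1) by (auto simp: PiE_iff)
    then have "\<not> negligible (X i)" using X(2) open_not_negligible by blast
    then show ?thesis using X(2)[of i] by (simp add: negligible_iff_emeasure0)
  qed
  then have "emeasure (lebesgue_space d) (PiE {..<d} X) \<noteq> 0"
    using X(2) by (subst lborel_family.emeasure_PiM) (auto simp: prod_zero_iff)
  moreover have "PiE {..<d} X \<subseteq> unit_ball d \<inter> (normalise d -` E \<inter> space (lebesgue_space d))"
    using sub measurable_space[OF normalise_measurable] unfolding E_def by (auto simp: space_PiM)
  ultimately have "emeasure (lebesgue_space d) (unit_ball d \<inter> (normalise d -` E \<inter> space (lebesgue_space d))) \<noteq> 0"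
    using emeasure_mono[of "PiE {..<d} X" "unit_ball d \<inter> (normalise d -` E \<inter> space (lebesgue_space d))" "lebesgue_space d"] nE
    by auto
  then have "emeasure (ball_measure d) (normalise d -` E \<inter> space (lebesgue_space d)) \<noteq> 0"
    unfolding ball_measure_def using nE emeasure_unit_ball_pos_finite[of d]
    by (simp add: ennreal_divide_eq_0_iff)
  moreover have "normalise d \<in> measurable (ball_measure d) (borel_space d)" by measurable
  moreover have "space (ball_measure d) = space (lebesgue_space d)" by (simp add: ball_measure_def)
  ultimately have "emeasure (uniform_sphere d) E \<noteq> 0"
    unfolding uniform_sphere_eq using E by (simp add: emeasure_distr)
  then show ?thesis
    using finite_measure.emeasure_eq_measure[OF prob_space.finite_measure[OF prob_space_uniform_sphere]]
    unfolding E_def space_uniform_sphere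
    by (simp add: zero_less_measure_iff)
qed

lemma AE_uniform_sphere_coordinate_le:
  assumes "k < d" shows "AE x in uniform_sphere d. \<bar>x k\<bar> \<le> 1"
proof -
  have "AE x in uniform_sphere d. enorm d x = 1" using assms by (intro AE_enorm_uniform_sphere) auto
  then show ?thesis
  proof eventually_elim
    case (elim x)
    have "(x k)\<^sup>2 \<le> (\<Sum>k<d. (x k)\<^sup>2)" using assms by (intro member_le_sum) auto
    also have "\<dots> = 1" using elim by (simp add: enorm_def)
    finally show ?case by (simp add: abs_square_le_1)
  qed
qed

lemma integral_of_bool:
  "{x \<in> space M. P x} \<in> sets M \<Longrightarrow> (\<integral>x. of_bool (P x) \<partial>M) = measure M {x \<in> space M. P x}"
proof -
  have "(\<integral>x. of_bool (P x) \<partial>M) = (\<integral>x. indicator {x \<in> space M. P x} x \<partial>M :: real)"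
    by (intro Bochner_Integration.integral_cong) (auto simp: indicator_def)
  also have "\<dots> = measure M ({x \<in> space M. P x} \<inter> space M)" by simp
  also have "{x \<in> space M. P x} \<inter> space M = {x \<in> space M. P x}" by auto
  finally show ?thesis .
qed

lemma coordinate_measurable:
  "k < d \<Longrightarrow> (\<lambda>x. x k) \<in> borel_measurable (uniform_sphere d)"
  by (simp add: borel_measurable_coordinate cong: measurable_cong_sets)

text \<open>Given one of the two points, rotation invariance gives its inner product with the other
  the law of a single coordinate. From here on the threshold is a quantile of coordinate 0.\<close>

lemma threshold_event_measure:
  assumes d: "3 \<le> d"
  shows "measure (uniform_sphere d \<Otimes>\<^sub>M uniform_sphere d)
      {z \<in> space (uniform_sphere d \<Otimes>\<^sub>M uniform_sphere d). t \<le> dot d (fst z) (snd z)} =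
    measure (uniform_sphere d) {x \<in> space (uniform_sphere d). t \<le> x 0}"
proof -
  let ?S = "uniform_sphere d"
  interpret S: prob_space ?S by (rule prob_space_uniform_sphere)
  interpret P: pair_prob_space ?S ?S ..
  have m: "(\<lambda>z. of_bool (t \<le> dot d (fst z) (snd z)) :: real) \<in> borel_measurable (?S \<Otimes>\<^sub>M ?S)"
    by measurable
  have "measure (?S \<Otimes>\<^sub>M ?S) {z \<in> space (?S \<Otimes>\<^sub>M ?S). t \<le> dot d (fst z) (snd z)} =
      (\<integral>z. of_bool (t \<le> dot d (fst z) (snd z)) \<partial>(?S \<Otimes>\<^sub>M ?S))"
    by (rule integral_of_bool[symmetric]) measurable
  also have "\<dots> = (\<integral>z. (case z of (x, y) \<Rightarrow> of_bool (t \<le> dot d x y)) \<partial>(?S \<Otimes>\<^sub>M ?S))"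
    by (simp add: case_prod_beta)
  also have "\<dots> = (\<integral>y. \<integral>x. of_bool (t \<le> dot d x y) \<partial>?S \<partial>?S)"
    using m by (intro P.integral_snd[symmetric] P.integrable_const_bound[of _ 1])
      (auto simp: case_prod_beta)
  also have "\<dots> = (\<integral>y. (\<integral>x. of_bool (t \<le> x 0) \<partial>?S) \<partial>?S)"
  proof (rule integral_cong_AE)
    have "AE y in ?S. enorm d y = 1" using d by (intro AE_enorm_uniform_sphere) auto
    then show "AE y in ?S. (\<integral>x. of_bool (t \<le> dot d x y) \<partial>?S) = (\<integral>x. of_bool (t \<le> x 0) \<partial>?S :: real)"
    proof eventually_elim
      case (elim y)
      then show ?case using integral_dot_unit[OF d, of y "\<lambda>u. of_bool (t \<le> u)"] by simp
    qed
  qed measurable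
  also have "\<dots> = (\<integral>x. of_bool (t \<le> x 0) \<partial>?S)" by (simp add: S.prob_space)
  also have "\<dots> = measure ?S {x \<in> space ?S. t \<le> x 0}"
  proof (rule integral_of_bool)
    have [measurable]: "(\<lambda>x. x 0) \<in> borel_measurable ?S" using d by (intro coordinate_measurable) auto
    show "{x \<in> space ?S. t \<le> x 0} \<in> sets ?S" by measurable
  qed
  finally show ?thesis .
qed

lemma (in prob_space) measure_Collect_eq_0:
  "{x \<in> space M. P x} \<in> sets M \<Longrightarrow> AE x in M. \<not> P x \<Longrightarrow> measure M {x \<in> space M. P x} = 0"
  by (subst prob_eq_0) auto

lemma (in prob_space) measure_Collect_eq_1:
  "{x \<in> space M. P x} \<in> sets M \<Longrightarrow> AE x in M. P x \<Longrightarrow> measure M {x \<in> space M. P x} = 1"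
  by (subst prob_eq_1) auto

text \<open>The intermediate value theorem for the distribution function of coordinate 0, which is
  continuous because no single value has positive probability. The endpoints -2 and 2 lie outside
  the range of the coordinate, so the function is 0 and 1 there.\<close>

lemma ex_threshold:
  assumes d: "3 \<le> d" and p: "0 < p" "p < 1"
  shows "\<exists>t. measure (uniform_sphere d) {x \<in> space (uniform_sphere d). t \<le> x 0} = p"
proof -
  let ?S = "uniform_sphere d"
  interpret S: prob_space ?S by (rule prob_space_uniform_sphere)
  have m [measurable]: "(\<lambda>x. x 0) \<in> borel_measurable ?S" using d by (intro coordinate_measurable) auto
  define D where "D = distr ?S borel (\<lambda>x. x 0)"
  interpret D: real_distribution D
    unfolding D_def by (intro S.real_distribution_distr m)
  have D: "measure D A = measure ?S {x \<in> space ?S. x 0 \<in> A}" if "A \<in> sets borel" for A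
    unfolding D_def using measure_distr[OF m that] by (simp add: vimage_def Int_def conj_commute)
  have cdf: "cdf D s = measure ?S {x \<in> space ?S. x 0 \<le> s}" for s
    using D[of "{..s}"] by (simp add: cdf_def)
  have "isCont (cdf D) s" for s
  proof -
    have "AE x in ?S. x 0 \<noteq> s"
      using d by (intro AE_uniform_sphere_coordinate_neq) auto
    then have "measure ?S {x \<in> space ?S. x 0 = s} = 0"
      by (intro S.measure_Collect_eq_0) measurable
    then have "measure D {s} = 0"
      using D[of "{s}"] by simp
    then show ?thesis by (simp add: D.isCont_cdf)
  qed
  then have cont: "continuous_on {-2..2} (cdf D)" by (simp add: continuous_at_imp_continuous_on)
  have le: "AE x in ?S. \<bar>x 0\<bar> \<le> 1" using d by (intro AE_uniform_sphere_coordinate_le) auto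
  have "AE x in ?S. \<not> x 0 \<le> -2" using le by eventually_elim auto
  then have "cdf D (-2) = 0" unfolding cdf by (intro S.measure_Collect_eq_0) measurable
  moreover have "AE x in ?S. x 0 \<le> 2" using le by eventually_elim auto
  then have "cdf D 2 = 1" unfolding cdf by (intro S.measure_Collect_eq_1) measurable
  ultimately obtain t where t: "cdf D t = 1 - p"
    using IVT'[of "cdf D" "-2" "1 - p" 2] cont p by auto
  have neq: "AE x in ?S. x 0 \<noteq> t"
    using d by (intro AE_uniform_sphere_coordinate_neq) auto
  have "measure ?S {x \<in> space ?S. t \<le> x 0} = measure ?S {x \<in> space ?S. \<not> x 0 \<le> t}"
  proof (rule S.finite_measure_eq_AE)
    show "AE x in ?S. (x \<in> {x \<in> space ?S. t \<le> x 0}) = (x \<in> {x \<in> space ?S. \<not> x 0 \<le> t})"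
      using neq by eventually_elim auto
  qed measurable
  also have "\<dots> = 1 - measure ?S {x \<in> space ?S. x 0 \<le> t}"
    by (rule S.prob_neg) measurable
  also have "\<dots> = p" using t by (simp add: cdf)
  finally show ?thesis by blast
qed

text \<open>One half of uniqueness; the other follows by exchanging \<open>t\<close> and
  \<open>t'\<close>. Two different quantiles would enclose an interval of probability zero, against
  the positivity of intervals inside (-1, 1).\<close>

lemma threshold_unique:
  assumes d: "3 \<le> d" and p: "0 < p" "p < 1"
    and t: "measure (uniform_sphere d) {x \<in> space (uniform_sphere d). t \<le> x 0} = p"
    and t': "measure (uniform_sphere d) {x \<in> space (uniform_sphere d). t' \<le> x 0} = p"
  shows "t \<le> t'"
proof (rule ccontr)
  let ?S = "uniform_sphere d"
  interpret S: prob_space ?S by (rule prob_space_uniform_sphere)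
  have [measurable]: "(\<lambda>x. x 0) \<in> borel_measurable ?S" using d by (intro coordinate_measurable) auto
  have le: "AE x in ?S. \<bar>x 0\<bar> \<le> 1" using d by (intro AE_uniform_sphere_coordinate_le) auto
  let ?A = "\<lambda>s. {x \<in> space ?S. s \<le> x 0}"
  have A: "?A s \<in> S.events" for s by measurable
  assume "\<not> t \<le> t'"
  then have less: "t' < t" by simp
  \<comment> \<open>As \<open>p\<close> is neither 0 nor 1, \<open>t\<close> lies above -1 and
    \<open>t'\<close> below 1. So the interval from \<open>t'\<close> to \<open>t\<close> remains
    nonempty when it is clipped to (-1, 1).\<close>
  have "\<not> t \<le> -1"
  proof
    assume "t \<le> -1"
    have "AE x in ?S. t \<le> x 0" using le by eventually_elim (use \<open>t \<le> -1\<close> in auto)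
    then have "measure ?S {x \<in> space ?S. t \<le> x 0} = 1"
      by (intro S.measure_Collect_eq_1) measurable
    then show False using t p by simp
  qed
  moreover have "\<not> 1 \<le> t'"
  proof
    assume "1 \<le> t'"
    have "AE x in ?S. x 0 \<noteq> 1" using d by (intro AE_uniform_sphere_coordinate_neq) auto
    with le have "AE x in ?S. \<not> t' \<le> x 0" by eventually_elim (use \<open>1 \<le> t'\<close> in auto)
    then have "measure ?S {x \<in> space ?S. t' \<le> x 0} = 0"
      by (intro S.measure_Collect_eq_0) measurable
    then show False using t' p by simp
  qed
  ultimately have "0 < measure ?S {x \<in> space ?S. max (-1) t' < x 0 \<and> x 0 < min 1 t}"
    using less d by (intro measure_uniform_sphere_coordinate_pos) auto
  also have "\<dots> \<le> measure ?S (?A t' - ?A t)"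
    using A by (intro S.finite_measure_mono) auto
  also have "\<dots> = measure ?S (?A t') - measure ?S (?A t)"
    using A less by (intro S.finite_measure_Diff) auto
  finally show False using t t' by simp
qed

lemma threshold_prob:
  assumes d: "3 \<le> d" and p: "0 < p" "p < 1"
  shows "measure (uniform_sphere d) {x \<in> space (uniform_sphere d). threshold p d \<le> x 0} = p"
proof -
  have "\<exists>!t. measure (uniform_sphere d) {x \<in> space (uniform_sphere d). t \<le> x 0} = p"
    using ex_threshold[OF assms] by (auto intro!: order_antisym threshold_unique[OF assms])
  from theI'[OF this] show ?thesis
    unfolding threshold_def threshold_event_measure[OF d] .
qed

section \<open>Averaging over rotations of a plane\<close>

definition half_line :: "real \<Rightarrow> real \<Rightarrow> real" where
  "half_line t u = of_bool (t \<le> u)"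

lemma half_line_measurable [measurable]: "half_line t \<in> borel_measurable borel"
  unfolding half_line_def by measurable

lemma half_line_range: "0 \<le> half_line t u" "half_line t u \<le> 1"
  by (auto simp: half_line_def)

text \<open>Here \<open>a\<close> and \<open>b\<close> are the coordinates of a point in the plane,
  and the two caps are centred at the angles \<open>\<phi>\<close> and
  \<open>\<phi> + \<theta>\<close>: the integral is the length of the set of rotations for which
  both caps contain the point.\<close>

definition arc_overlap :: "real \<Rightarrow> real \<Rightarrow> real \<Rightarrow> real \<Rightarrow> real" where
  "arc_overlap t a b \<theta> = integral {0..2*pi} (\<lambda>\<phi>. half_line t (a * cos \<phi> + b * sin \<phi>) *
     half_line t (a * cos (\<phi> + \<theta>) + b * sin (\<phi> + \<theta>)))"

lemma set_integrable_bounded_Icc: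
  fixes f :: "real \<Rightarrow> real"
  assumes "f \<in> borel_measurable borel" "\<And>x. \<bar>f x\<bar> \<le> 1"
  shows "set_integrable lborel {a..b} f"
  using assms unfolding set_integrable_def
  by (intro integrableI_bounded_set[of "{a..b}" _ _ 1]) (auto simp: indicator_def emeasure_lborel_Icc_eq)

lemma integrable_on_bounded_Icc:
  fixes f :: "real \<Rightarrow> real"
  assumes "f \<in> borel_measurable borel" "\<And>x. \<bar>f x\<bar> \<le> 1"
  shows "f integrable_on {a..b}"
  by (rule set_borel_integral_eq_integral(1)[OF set_integrable_bounded_Icc[OF assms]])

lemma integral_periodic:
  fixes f :: "real \<Rightarrow> real"
  assumes f: "f \<in> borel_measurable borel" "\<And>x. \<bar>f x\<bar> \<le> 1" and per: "\<And>x. f (x + c) = f x"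
    and ab: "a \<le> b" "b \<le> a + c"
  shows "integral {a..a+c} f = integral {b..b+c} f"
proof -
  have i: "f integrable_on {x..y}" for x y by (rule integrable_on_bounded_Icc[OF f])
  have "f \<circ> (+) c = f" using per by (auto simp: fun_eq_iff add.commute)
  then have "integral {a..b} f = integral {a+c..b+c} f"
    using integral_shift_Icc_real[of a b f c] by simp
  moreover have "integral {a..b} f + integral {b..a+c} f = integral {a..a+c} f"
    using ab i by (intro Henstock_Kurzweil_Integration.integral_combine) auto
  moreover have "integral {b..a+c} f + integral {a+c..b+c} f = integral {b..b+c} f"
    using ab i by (intro Henstock_Kurzweil_Integration.integral_combine) auto
  ultimately show ?thesis by simp
qed

lemma polar_coordinates:
  obtains \<psi> where "0 \<le> \<psi>" "\<psi> < 2 * pi" "a = sqrt (a\<^sup>2 + b\<^sup>2) * cos \<psi>" "b = sqrt (a\<^sup>2 + b\<^sup>2) * sin \<psi>"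
proof (cases "a\<^sup>2 + b\<^sup>2 = 0")
  case True
  then show ?thesis using that[of 0] by (simp add: sum_power2_eq_zero_iff)
next
  case False
  let ?r = "sqrt (a\<^sup>2 + b\<^sup>2)"
  have r: "?r \<noteq> 0" "?r\<^sup>2 = a\<^sup>2 + b\<^sup>2" using False by auto
  then have "(a / ?r)\<^sup>2 + (b / ?r)\<^sup>2 = 1"
    using False by (simp add: power_divide flip: add_divide_distrib)
  then obtain \<psi> where "0 \<le> \<psi>" "\<psi> < 2 * pi" "a / ?r = cos \<psi>" "b / ?r = sin \<psi>"
    by (rule sincos_total_2pi)
  then show ?thesis using that[of \<psi>] r(1) by (simp add: field_simps)
qed

text \<open>
  In polar coordinates both factors are indicators of arcs; placing the two arcs symmetrically about
  the origin reduces their overlap to the part of a single arc seen through a half-circle window.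
\<close>
lemma arc_overlap_eq:
  fixes a b :: real
  assumes \<theta>: "0 \<le> \<theta>" "\<theta> \<le> pi"
  defines "r \<equiv> sqrt (a\<^sup>2 + b\<^sup>2)"
  shows "arc_overlap t a b \<theta> = 2 * integral {\<theta>/2..pi + \<theta>/2} (\<lambda>u. half_line t (r * cos u))"
proof -
  obtain \<psi> where \<psi>: "0 \<le> \<psi>" "\<psi> < 2 * pi" "a = r * cos \<psi>" "b = r * sin \<psi>"
    unfolding r_def by (rule polar_coordinates)
  define c where "c u = half_line t (r * cos u)" for u
  define G where "G u = c (u - \<theta>/2) * c (u + \<theta>/2)" for u
  have [measurable]: "c \<in> borel_measurable borel" unfolding c_def by measurable
  have c01: "0 \<le> c u" "c u \<le> 1" for u by (auto simp: c_def half_line_range)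
  have G: "G \<in> borel_measurable borel" unfolding G_def by measurable
  have G1: "\<bar>G x\<bar> \<le> 1" for x
    using c01 by (auto simp: G_def abs_mult intro!: mult_le_one)
  have per: "G (x + 2 * pi) = G x" for x
  proof -
    have "c (x + 2 * pi + e) = c (x + e)" for x e
      using cos_periodic[of "x + e"] by (simp add: c_def algebra_simps)
    from this[of x "\<theta>/2"] this[of x "- \<theta>/2"] show ?thesis by (simp add: G_def)
  qed
  have i: "G integrable_on {x..y}" for x y by (rule integrable_on_bounded_Icc[OF G G1])
  \<comment> \<open>Shifting the variable by \<open>s\<close> places the arc centres at \<theta>/2
    and -\<theta>/2. As \<open>s\<close> lies between -2\<pi> and \<pi>/2, less than a full period
    separates it from -\<pi>.\<close>
  define s where "s = \<theta>/2 - \<psi>"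
  have "half_line t (a * cos u + b * sin u) = c (u - \<psi>)" for u
    unfolding c_def \<psi>(3,4) cos_diff by (simp add: algebra_simps)
  then have "arc_overlap t a b \<theta> = integral {0..2*pi} (G \<circ> (+) s)"
    unfolding arc_overlap_def G_def s_def by (simp add: o_def algebra_simps)
  also have "\<dots> = integral {s..s + 2*pi} G"
    by (subst integral_shift_Icc_real) (simp add: add.commute)
  also have "\<dots> = integral {-pi..-pi + 2 * pi} G"
  proof (cases "s \<le> - pi")
    case True
    then show ?thesis using \<psi> \<theta> by (intro integral_periodic[OF G G1 per]) (auto simp: s_def)
  next
    case False
    then show ?thesis using \<psi> \<theta> by (intro integral_periodic[OF G G1 per, symmetric]) (auto simp: s_def)
  qed
  also have "\<dots> = integral {-pi..0} G + integral {0..pi} G"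
    using i by (subst Henstock_Kurzweil_Integration.integral_combine) auto
  also have "integral {-pi..0} G = integral {0..pi} G"
  proof -
    have "c (- u) = c u" for u by (simp add: c_def)
    then have "G (- u) = G u" for u
      using \<open>\<And>u. c (- u) = c u\<close>[of "u + \<theta>/2"] \<open>\<And>u. c (- u) = c u\<close>[of "u - \<theta>/2"]
      by (simp add: G_def algebra_simps)
    then show ?thesis using Henstock_Kurzweil_Integration.integral_reflect_real[of pi 0 G] by simp
  qed
  \<comment> \<open>On this half of the circle the cosine at \<open>u + \<theta>/2\<close> is the
    smaller one, so the second factor implies the first.\<close>
  also have "integral {0..pi} G = integral {0..pi} (c \<circ> (+) (\<theta>/2))"
  proof (rule Henstock_Kurzweil_Integration.integral_cong)
    fix u assume "u \<in> {0..pi}"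
    then have "0 \<le> sin u * sin (\<theta>/2)" using \<theta> by (intro mult_nonneg_nonneg sin_ge_zero) auto
    then have "r * cos (u + \<theta>/2) \<le> r * cos (u - \<theta>/2)"
      unfolding cos_add cos_diff by (intro mult_left_mono) (auto simp: r_def)
    then show "G u = (c \<circ> (+) (\<theta>/2)) u"
      by (auto simp: G_def c_def half_line_def add.commute)
  qed
  also have "\<dots> = integral {\<theta>/2..pi + \<theta>/2} c"
    by (subst integral_shift_Icc_real) simp
  finally show ?thesis by (simp add: c_def[abs_def])
qed

text \<open>Moving the window from \<open>\<theta>/2\<close> to \<open>\<theta>'/2\<close> loses a
  short piece at one end and gains its antipode at the other. The difference is therefore twice the
  integral of \<open>c u - c (pi + u)\<close> over the lost piece. The cosine is nonnegative there
  and opposite at the antipode, so the integrand is 0 or 1, and it is 1 as soon as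
  \<open>r * cos u\<close> exceeds \<open>\<bar>t\<bar>\<close>. The factor 2 compensates for the
  half angles.\<close>

lemma arc_overlap_diff:
  assumes \<theta>: "0 \<le> \<theta>" "\<theta> \<le> \<theta>'" "\<theta>' \<le> pi"
  shows "0 \<le> arc_overlap t a b \<theta> - arc_overlap t a b \<theta>'"
    and "arc_overlap t a b \<theta> - arc_overlap t a b \<theta>' \<le> \<theta>' - \<theta>"
    and "\<bar>t\<bar> < sqrt (a\<^sup>2 + b\<^sup>2) * cos (\<theta>'/2) \<Longrightarrow> arc_overlap t a b \<theta> - arc_overlap t a b \<theta>' = \<theta>' - \<theta>"
proof -
  define r where "r = sqrt (a\<^sup>2 + b\<^sup>2)"
  define c where "c u = half_line t (r * cos u)" for u
  have r0: "0 \<le> r" by (simp add: r_def)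
  have [measurable]: "c \<in> borel_measurable borel" unfolding c_def by measurable
  have c01: "0 \<le> c u" "c u \<le> 1" for u by (auto simp: c_def half_line_range)
  have i: "c integrable_on {x..y}" for x y
    using c01 by (intro integrable_on_bounded_Icc) (auto simp: abs_le_iff intro: order_trans[of _ 0])
  have i': "(\<lambda>u. c (pi + u)) integrable_on {x..y}" for x y
    using c01 by (intro integrable_on_bounded_Icc) (auto simp: abs_le_iff intro: order_trans[of _ 0])
  let ?I = "\<lambda>x y. integral {x..y} c"
  have comb: "?I x y + ?I y z = ?I x z" if "x \<le> y" "y \<le> z" for x y z
    using that i by (intro Henstock_Kurzweil_Integration.integral_combine)
  have "\<theta>'/2 \<le> pi + \<theta>/2" using \<theta> pi_gt_zero by linarith
  then have "?I (\<theta>/2) (\<theta>'/2) + ?I (\<theta>'/2) (pi + \<theta>/2) = ?I (\<theta>/2) (pi + \<theta>/2)"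
    "?I (\<theta>'/2) (pi + \<theta>/2) + ?I (pi + \<theta>/2) (pi + \<theta>'/2) = ?I (\<theta>'/2) (pi + \<theta>'/2)"
    using \<theta> by (auto intro!: comb)
  then have "arc_overlap t a b \<theta> - arc_overlap t a b \<theta>' = 2 * (?I (\<theta>/2) (\<theta>'/2) - ?I (pi + \<theta>/2) (pi + \<theta>'/2))"
    using \<theta> unfolding c_def r_def by (simp add: arc_overlap_eq)
  also have "?I (pi + \<theta>/2) (pi + \<theta>'/2) = integral {\<theta>/2..\<theta>'/2} (\<lambda>u. c (pi + u))"
    using integral_shift_Icc_real[of "\<theta>/2" "\<theta>'/2" c pi] by (simp add: o_def add.commute)
  also have "?I (\<theta>/2) (\<theta>'/2) - \<dots> = integral {\<theta>/2..\<theta>'/2} (\<lambda>u. c u - c (pi + u))"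
    using i i' by (simp add: Henstock_Kurzweil_Integration.integral_diff)
  finally have eq: "arc_overlap t a b \<theta> - arc_overlap t a b \<theta>' = 2 * integral {\<theta>/2..\<theta>'/2} (\<lambda>u. c u - c (pi + u))" .
  have j: "(\<lambda>u. c u - c (pi + u)) integrable_on {\<theta>/2..\<theta>'/2}" using i i' by (rule integrable_diff)
  have anti: "cos (pi + u) = - cos u" for u by (simp add: cos_add)
  have cos: "0 \<le> r * cos u" if "u \<in> {\<theta>/2..\<theta>'/2}" for u
    using that \<theta> r0 by (intro mult_nonneg_nonneg cos_ge_zero) auto
  have pos: "0 \<le> c u - c (pi + u)" if "u \<in> {\<theta>/2..\<theta>'/2}" for u
    using cos[OF that] by (auto simp: c_def half_line_def anti)
  then show "0 \<le> arc_overlap t a b \<theta> - arc_overlap t a b \<theta>'"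
    unfolding eq using integral_nonneg[OF j] by simp
  have "integral {\<theta>/2..\<theta>'/2} (\<lambda>u. c u - c (pi + u)) \<le> integral {\<theta>/2..\<theta>'/2} (\<lambda>u. 1)"
  proof (rule integral_le[OF j])
    show "c u - c (pi + u) \<le> 1" for u using c01(2)[of u] c01(1)[of "pi + u"] by linarith
  qed auto
  then show "arc_overlap t a b \<theta> - arc_overlap t a b \<theta>' \<le> \<theta>' - \<theta>"
    unfolding eq using \<theta> by simp
  assume big: "\<bar>t\<bar> < sqrt (a\<^sup>2 + b\<^sup>2) * cos (\<theta>'/2)"
  have "integral {\<theta>/2..\<theta>'/2} (\<lambda>u. c u - c (pi + u)) = integral {\<theta>/2..\<theta>'/2} (\<lambda>u. 1)"
  proof (rule Henstock_Kurzweil_Integration.integral_cong)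
    fix u assume u: "u \<in> {\<theta>/2..\<theta>'/2}"
    have "cos (\<theta>'/2) \<le> cos u" using u \<theta> by (intro cos_monotone_0_pi_le) auto
    then have "r * cos (\<theta>'/2) \<le> r * cos u" using r0 by (rule mult_left_mono)
    then have "\<bar>t\<bar> < r * cos u" using big by (simp add: r_def)
    then have "t \<le> r * cos u" "\<not> t \<le> - (r * cos u)" by linarith+
    then show "c u - c (pi + u) = 1" by (simp add: c_def half_line_def anti)
  qed
  then show "arc_overlap t a b \<theta> - arc_overlap t a b \<theta>' = \<theta>' - \<theta>"
    unfolding eq using \<theta> by simp
qed

definition cap_overlap :: "nat \<Rightarrow> real \<Rightarrow> real \<Rightarrow> real" where
  "cap_overlap d t \<theta> = (\<integral>x. half_line t (x 0) * half_line t (x 0 * cos \<theta> + x 1 * sin \<theta>) \<partial>uniform_sphere d)"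

text \<open>As the integral does not depend on \<open>\<phi>\<close>, averaging over \<open>\<phi>\<close> expresses it by arc overlaps.\<close>
lemma cap_overlap_rotated:
  assumes d: "2 \<le> d"
  shows "(\<integral>x. half_line t (x 0 * cos \<phi> + x 1 * sin \<phi>) *
      half_line t (x 0 * cos (\<phi> + \<theta>) + x 1 * sin (\<phi> + \<theta>)) \<partial>uniform_sphere d) = cap_overlap d t \<theta>"
proof -
  have iso: "isometry d (rot 0 1 (cos \<phi>) (- sin \<phi>))" using d by (intro isometry_rot) auto
  have [measurable]: "(\<lambda>x. x 0) \<in> borel_measurable (borel_space d)" "(\<lambda>x. x (Suc 0)) \<in> borel_measurable (borel_space d)"
    using d by (auto intro!: borel_measurable_coordinate)
  have "(\<lambda>x. half_line t (x 0) * half_line t (x 0 * cos \<theta> + x 1 * sin \<theta>)) \<in> borel_measurable (borel_space d)"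
    by (simp, measurable)
  from integral_isometry[OF iso this] show ?thesis
    by (simp add: cap_overlap_def rot_def cos_add sin_add algebra_simps)
qed

lemma cap_overlap_eq:
  assumes d: "2 \<le> d"
  shows "(\<lambda>x. arc_overlap t (x 0) (x 1) \<theta>) \<in> borel_measurable (uniform_sphere d)"
    and "2 * pi * cap_overlap d t \<theta> = (\<integral>x. arc_overlap t (x 0) (x 1) \<theta> \<partial>uniform_sphere d)"
proof -
  let ?S = "uniform_sphere d"
  interpret S: prob_space ?S by (rule prob_space_uniform_sphere)
  interpret P: pair_sigma_finite ?S lborel ..
  have [measurable]: "(\<lambda>x. x 0) \<in> borel_measurable ?S" "(\<lambda>x. x (Suc 0)) \<in> borel_measurable ?S"
    using d by (auto intro!: coordinate_measurable)
  define F where "F x \<phi> = half_line t (x 0 * cos \<phi> + x (Suc 0) * sin \<phi>) *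
      half_line t (x 0 * cos (\<phi> + \<theta>) + x (Suc 0) * sin (\<phi> + \<theta>))" for x :: "nat \<Rightarrow> real" and \<phi>
  have F01: "0 \<le> F x \<phi>" "F x \<phi> \<le> 1" for x \<phi>
    by (auto simp: F_def half_line_range intro!: mult_le_one)
  have Fm [measurable]: "(\<lambda>z. F (fst z) (snd z)) \<in> borel_measurable (?S \<Otimes>\<^sub>M borel)"
    unfolding F_def by measurable
  have Fx: "F x \<in> borel_measurable borel" for x unfolding F_def by measurable
  have arc: "arc_overlap t (x 0) (x 1) \<theta> = (\<integral>\<phi>. indicator {0..2*pi} \<phi> * F x \<phi> \<partial>lborel)" for x
  proof -
    have "\<bar>F x \<phi>\<bar> \<le> 1" for \<phi> using F01[of x \<phi>] by linarith
    from set_borel_integral_eq_integral(2)[OF set_integrable_bounded_Icc[OF Fx this]]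
    have "integral {0..2*pi} (F x) = (\<integral>\<phi>. indicator {0..2*pi} \<phi> * F x \<phi> \<partial>lborel)"
      by (simp add: set_lebesgue_integral_def)
    then show ?thesis by (simp add: arc_overlap_def F_def[abs_def])
  qed
  show "(\<lambda>x. arc_overlap t (x 0) (x 1) \<theta>) \<in> borel_measurable ?S"
    unfolding arc by measurable
  have int: "integrable (?S \<Otimes>\<^sub>M lborel) (\<lambda>(x, \<phi>). indicator {0..2*pi} \<phi> * F x \<phi>)"
  proof (rule integrableI_bounded_set[of "space ?S \<times> {0..2*pi}" _ _ 1])
    show "space ?S \<times> {0..2*pi} \<in> sets (?S \<Otimes>\<^sub>M lborel)"
      by (intro pair_measureI sets.top) auto
    show "emeasure (?S \<Otimes>\<^sub>M lborel) (space ?S \<times> {0..2*pi}) < \<infinity>"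
      by (subst lborel.emeasure_pair_measure_Times) (auto simp: S.emeasure_space_1 simp flip: space_uniform_sphere sets_uniform_sphere)
    show "AE x in ?S \<Otimes>\<^sub>M lborel. x \<in> space ?S \<times> {0..2*pi} \<longrightarrow> norm (case x of (x, \<phi>) \<Rightarrow> indicator {0..2*pi} \<phi> * F x \<phi>) \<le> 1"
      using F01 by (auto simp: abs_mult)
    show "AE x in ?S \<Otimes>\<^sub>M lborel. x \<notin> space ?S \<times> {0..2*pi} \<longrightarrow> (case x of (x, \<phi>) \<Rightarrow> indicator {0..2*pi} \<phi> * F x \<phi>) = 0"
      by (rule AE_I2) (auto simp: space_pair_measure indicator_def)
  qed (simp add: case_prod_beta, measurable)
  have "(\<integral>x. arc_overlap t (x 0) (x 1) \<theta> \<partial>?S) = (\<integral>x. \<integral>\<phi>. indicator {0..2*pi} \<phi> * F x \<phi> \<partial>lborel \<partial>?S)"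
    unfolding arc ..
  also have "\<dots> = (\<integral>\<phi>. \<integral>x. indicator {0..2*pi} \<phi> * F x \<phi> \<partial>?S \<partial>lborel)"
    using P.Fubini_integral[OF int] by simp
  also have "\<dots> = (\<integral>\<phi>. indicator {0..2*pi} \<phi> * cap_overlap d t \<theta> \<partial>lborel)"
    using cap_overlap_rotated[OF d, of t _ \<theta>] by (simp add: F_def)
  also have "\<dots> = 2 * pi * cap_overlap d t \<theta>" by simp
  finally show "2 * pi * cap_overlap d t \<theta> = (\<integral>x. arc_overlap t (x 0) (x 1) \<theta> \<partial>?S)" ..
qed

lemma arc_overlap_bounds: "0 \<le> arc_overlap t a b \<theta>" "arc_overlap t a b \<theta> \<le> 2 * pi"
proof -
  let ?F = "\<lambda>\<phi>. half_line t (a * cos \<phi> + b * sin \<phi>) * half_line t (a * cos (\<phi> + \<theta>) + b * sin (\<phi> + \<theta>))"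
  have F01: "0 \<le> ?F \<phi>" "?F \<phi> \<le> 1" for \<phi>
    by (auto simp: half_line_range intro!: mult_le_one)
  have "?F integrable_on {0..2*pi}"
  proof (rule integrable_on_bounded_Icc)
    show "\<bar>?F \<phi>\<bar> \<le> 1" for \<phi> using F01[of \<phi>] by linarith
  qed measurable
  then have "0 \<le> integral {0..2*pi} ?F" "integral {0..2*pi} ?F \<le> integral {0..2*pi} (\<lambda>_. 1)"
    using F01 by (auto intro!: integral_nonneg Henstock_Kurzweil_Integration.integral_le[where g = "\<lambda>_. 1"]
        simp del: integral_const_real)
  then show "0 \<le> arc_overlap t a b \<theta>" "arc_overlap t a b \<theta> \<le> 2 * pi" by (simp_all add: arc_overlap_def)
qed

text \<open>For \<open>\<theta>' \<le> 2 * pi / 3\<close> the cosine of \<open>\<theta>'/2\<close>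
  is at least 1/2, and \<open>2 * \<bar>t\<bar> < \<bar>x 0\<bar>\<close> then puts the point into
  the regime where the arc overlap has slope exactly -1; at other points monotonicity suffices. The
  bound on the angle leaves a margin beyond the right angle, where the angles of random points
  concentrate.\<close>

lemma cap_overlap_diff:
  assumes d: "2 \<le> d" and \<theta>: "0 \<le> \<theta>" "\<theta> \<le> \<theta>'" "\<theta>' \<le> pi"
  shows "0 \<le> cap_overlap d t \<theta> - cap_overlap d t \<theta>'"
    and "cap_overlap d t \<theta> - cap_overlap d t \<theta>' \<le> (\<theta>' - \<theta>) / (2 * pi)"
    and "\<theta>' \<le> 2 * pi / 3 \<Longrightarrow> (\<theta>' - \<theta>) / (2 * pi) *
      measure (uniform_sphere d) {x \<in> space (uniform_sphere d). 2 * \<bar>t\<bar> < \<bar>x 0\<bar>} \<le>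
      cap_overlap d t \<theta> - cap_overlap d t \<theta>'"
proof -
  let ?S = "uniform_sphere d"
  interpret S: prob_space ?S by (rule prob_space_uniform_sphere)
  let ?D = "\<lambda>x. arc_overlap t (x 0) (x 1) \<theta> - arc_overlap t (x 0) (x 1) \<theta>'"
  have int: "integrable ?S (\<lambda>x. arc_overlap t (x 0) (x 1) u)" for u
    using cap_overlap_eq(1)[OF d] arc_overlap_bounds by (intro S.integrable_const_bound[of _ "2 * pi"]) auto
  then have eq: "cap_overlap d t \<theta> - cap_overlap d t \<theta>' = (\<integral>x. ?D x \<partial>?S) / (2 * pi)"
    using cap_overlap_eq(2)[OF d, of t \<theta>] cap_overlap_eq(2)[OF d, of t \<theta>'] by (simp add: field_simps)
  have intD: "integrable ?S ?D" using int by auto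
  show "0 \<le> cap_overlap d t \<theta> - cap_overlap d t \<theta>'"
    unfolding eq using arc_overlap_diff(1)[OF \<theta>] by (intro divide_nonneg_nonneg integral_nonneg) auto
  have "(\<integral>x. ?D x \<partial>?S) \<le> (\<integral>x. \<theta>' - \<theta> \<partial>?S)"
    using arc_overlap_diff(2)[OF \<theta>] intD by (intro integral_mono) auto
  then have "(\<integral>x. ?D x \<partial>?S) \<le> \<theta>' - \<theta>" by (simp add: S.prob_space)
  then show "cap_overlap d t \<theta> - cap_overlap d t \<theta>' \<le> (\<theta>' - \<theta>) / (2 * pi)"
    unfolding eq by (intro divide_right_mono) auto
  assume small: "\<theta>' \<le> 2 * pi / 3"
  let ?A = "{x \<in> space ?S. 2 * \<bar>t\<bar> < \<bar>x 0\<bar>}"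
  have A: "?A \<in> sets ?S"
  proof -
    have [measurable]: "(\<lambda>x. x 0) \<in> borel_measurable ?S" using d by (intro coordinate_measurable) auto
    show ?thesis by measurable
  qed
  have "(\<theta>' - \<theta>) * indicator ?A x \<le> ?D x" for x
  proof (cases "x \<in> ?A")
    case True
    have "cos (pi / 3) \<le> cos (\<theta>'/2)" using small \<theta> by (intro cos_monotone_0_pi_le) auto
    then have "1 / 2 \<le> cos (\<theta>'/2)" by (simp add: cos_60)
    moreover have "\<bar>x 0\<bar> \<le> sqrt ((x 0)\<^sup>2 + (x 1)\<^sup>2)" by (simp add: real_le_rsqrt)
    ultimately have "\<bar>x 0\<bar> * (1 / 2) \<le> sqrt ((x 0)\<^sup>2 + (x 1)\<^sup>2) * cos (\<theta>'/2)" by (intro mult_mono) auto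
    then have "\<bar>t\<bar> < sqrt ((x 0)\<^sup>2 + (x 1)\<^sup>2) * cos (\<theta>'/2)" using True by auto
    from arc_overlap_diff(3)[OF \<theta> this] show ?thesis using \<theta> by (simp add: indicator_def)
  qed (use arc_overlap_diff(1)[OF \<theta>] in simp)
  then have "(\<integral>x. (\<theta>' - \<theta>) * indicator ?A x \<partial>?S) \<le> (\<integral>x. ?D x \<partial>?S)"
    using intD A by (intro integral_mono integrable_mult_right integrable_real_indicator)
      (auto simp: S.emeasure_eq_measure)
  then have "(\<theta>' - \<theta>) * measure ?S ?A \<le> (\<integral>x. ?D x \<partial>?S)" using A by (simp add: Int_absorb1 sets.sets_into_space)
  then show "(\<theta>' - \<theta>) / (2 * pi) * measure ?S ?A \<le> cap_overlap d t \<theta> - cap_overlap d t \<theta>'"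
    unfolding eq by (simp add: divide_right_mono)
qed

section \<open>Moments of a coordinate\<close>

definition sphere_moment :: "nat \<Rightarrow> nat \<Rightarrow> real" where
  "sphere_moment d j = (\<integral>x. (x 0) ^ (2 * j) \<partial>uniform_sphere d)"

lemma integrable_coordinate_powers:
  assumes "k < d" "l < d"
  shows "integrable (uniform_sphere d) (\<lambda>x. (x k) ^ i * (x l) ^ j)"
proof -
  interpret S: prob_space "uniform_sphere d" by (rule prob_space_uniform_sphere)
  have [measurable]: "(\<lambda>x. x k) \<in> borel_measurable (uniform_sphere d)" "(\<lambda>x. x l) \<in> borel_measurable (uniform_sphere d)"
    using assms by (auto intro: coordinate_measurable)
  have "AE x in uniform_sphere d. \<bar>x k\<bar> \<le> 1" "AE x in uniform_sphere d. \<bar>x l\<bar> \<le> 1"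
    using assms by (auto intro: AE_uniform_sphere_coordinate_le)
  then have "AE x in uniform_sphere d. norm ((x k) ^ i * (x l) ^ j) \<le> 1"
    by eventually_elim (auto simp: abs_mult power_abs intro!: mult_le_one power_le_one)
  then show ?thesis by (rule S.integrable_const_bound) measurable
qed

lemma sum_even_powers:
  fixes f :: "nat \<Rightarrow> real"
  shows "(\<Sum>i\<le>2*n. (if even i then f (i div 2) else 0) * s ^ i) = (\<Sum>k\<le>n. f k * (s\<^sup>2) ^ k)"
  by (induction n) (simp_all add: power_mult power2_eq_square)

text \<open>By invariance \<open>s * x 1 + x 0\<close> is distributed like
  \<open>sqrt (1 + s\<^sup>2) * x 0\<close>, so their moments of order \<open>2 * Suc j\<close>
  agree as polynomials in \<open>s\<close>. The claim compares the coefficients of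
  \<open>s\<^sup>2\<close>.\<close>

lemma sphere_moment_mixed:
  assumes d: "2 \<le> d"
  shows "(2 * real j + 1) * (\<integral>x. (x 1)\<^sup>2 * (x 0) ^ (2 * j) \<partial>uniform_sphere d) = sphere_moment d (Suc j)"
proof -
  let ?S = "uniform_sphere d" and ?n = "Suc j"
  have [measurable]: "(\<lambda>x. x 0) \<in> borel_measurable (borel_space d)" "(\<lambda>x. x (Suc 0)) \<in> borel_measurable (borel_space d)"
    using d by (auto intro: borel_measurable_coordinate)
  define E where "E k = (\<integral>x. (x 1) ^ k * (x 0) ^ (2 * ?n - k) \<partial>?S)" for k
  have "(\<Sum>k\<le>2 * ?n. (real (2 * ?n choose k) * E k) * s ^ k) =
      (\<Sum>k\<le>2 * ?n. ((if even k then real (?n choose (k div 2)) * sphere_moment d ?n else 0)) * s ^ k)" for s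
  proof -
    define r where "r = sqrt (1 + s\<^sup>2)"
    have r: "r\<^sup>2 = 1 + s\<^sup>2" "r \<noteq> 0" by (auto simp: r_def add_nonneg_eq_0_iff)
    have "isometry d (rot 0 1 (1 / r) (- s / r))"
      using d r by (intro isometry_rot) (auto simp: power_divide simp flip: add_divide_distrib)
    moreover have "(\<lambda>x. (x 0) ^ (2 * ?n)) \<in> borel_measurable (borel_space d)" by measurable
    ultimately have "(\<integral>x. (rot 0 1 (1 / r) (- s / r) x 0) ^ (2 * ?n) \<partial>?S) = sphere_moment d ?n"
      unfolding sphere_moment_def by (rule integral_isometry)
    moreover have "rot 0 1 (1 / r) (- s / r) x 0 = (s * x 1 + x 0) / r" for x
      by (simp add: rot_def add_divide_distrib)
    ultimately have "(\<integral>x. (s * x 1 + x 0) ^ (2 * ?n) / r ^ (2 * ?n) \<partial>?S) = sphere_moment d ?n"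
      by (simp only: power_divide)
    then have "(\<integral>x. (s * x 1 + x 0) ^ (2 * ?n) \<partial>?S) = r ^ (2 * ?n) * sphere_moment d ?n"
      using r(2) by (simp add: field_simps del: power_Suc)
    moreover have "r ^ (2 * ?n) = (s\<^sup>2 + 1) ^ ?n" by (simp only: power_mult r(1) add.commute)
    moreover have "(s\<^sup>2 + 1) ^ ?n = (\<Sum>k\<le>?n. real (?n choose k) * (s\<^sup>2) ^ k)"
      using binomial_ring[of "s\<^sup>2" 1 ?n] by simp
    ultimately have "(\<integral>x. (s * x 1 + x 0) ^ (2 * ?n) \<partial>?S) =
        (\<Sum>k\<le>?n. (real (?n choose k) * sphere_moment d ?n) * (s\<^sup>2) ^ k)"
      by (simp only: sum_distrib_left sum_distrib_right mult_ac)
    then have R: "(\<integral>x. (s * x 1 + x 0) ^ (2 * ?n) \<partial>?S) =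
        (\<Sum>k\<le>2 * ?n. ((if even k then real (?n choose (k div 2)) * sphere_moment d ?n else 0)) * s ^ k)"
      by (rule trans[OF _ sum_even_powers[symmetric]])
    have "(s * x 1 + x 0) ^ (2 * ?n) =
        (\<Sum>k\<le>2 * ?n. (real (2 * ?n choose k) * s ^ k) * ((x 1) ^ k * (x 0) ^ (2 * ?n - k)))" for x :: "nat \<Rightarrow> real"
      by (subst binomial_ring) (simp only: power_mult_distrib mult_ac)
    then have "(\<integral>x. (s * x 1 + x 0) ^ (2 * ?n) \<partial>?S) =
        (\<integral>x. (\<Sum>k\<le>2 * ?n. (real (2 * ?n choose k) * s ^ k) * ((x 1) ^ k * (x 0) ^ (2 * ?n - k))) \<partial>?S)"
      by (simp only:)
    also have "\<dots> = (\<Sum>k\<le>2 * ?n. \<integral>x. (real (2 * ?n choose k) * s ^ k) * ((x 1) ^ k * (x 0) ^ (2 * ?n - k)) \<partial>?S)"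
      using d integrable_coordinate_powers[of 1 d 0]
      by (intro Bochner_Integration.integral_sum integrable_mult_right) auto
    also have "\<dots> = (\<Sum>k\<le>2 * ?n. (real (2 * ?n choose k) * E k) * s ^ k)"
      by (simp only: integral_mult_right_zero E_def) (simp only: mult_ac)
    finally show ?thesis using R by (simp only:)
  qed
  then have "\<forall>k\<le>2 * ?n. real (2 * ?n choose k) * E k =
      (if even k then real (?n choose (k div 2)) * sphere_moment d ?n else 0)"
    by (intro polyfun_eq_coeffs[THEN iffD1] allI)
  from this[rule_format, of 2]
  have "real (2 * ?n choose 2) * E 2 = real ?n * sphere_moment d ?n" by simp
  moreover have "real (2 * ?n choose 2) = real ?n * (2 * real j + 1)"
    by (simp add: choose_two field_simps)
  ultimately have "real ?n * ((2 * real j + 1) * E 2) = real ?n * sphere_moment d ?n" by (simp only: mult.assoc)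
  then have "(2 * real j + 1) * E 2 = sphere_moment d ?n"
    by (simp del: of_nat_Suc)
  then show ?thesis by (simp add: E_def)
qed

text \<open>Inserting \<open>1 = (\<Sum>k<d. (x k)\<^sup>2)\<close> splits the moment into
  \<open>d\<close> terms. The term with \<open>k = 0\<close> is the next moment, and by symmetry all
  others equal the mixed moment, a known multiple of it.\<close>

lemma sphere_moment_Suc:
  assumes d: "2 \<le> d"
  shows "sphere_moment d (Suc j) = sphere_moment d j * (2 * real j + 1) / (real d + 2 * real j)"
proof -
  let ?S = "uniform_sphere d"
  have [measurable]: "(\<lambda>x. x 0) \<in> borel_measurable (borel_space d)" "(\<lambda>x. x (Suc 0)) \<in> borel_measurable (borel_space d)"
    using d by (auto intro: borel_measurable_coordinate)
  let ?E = "\<lambda>k. \<integral>x. (x k)\<^sup>2 * (x 0) ^ (2 * j) \<partial>?S"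
  have E: "?E k = ?E 1" if k: "k \<in> {..<d} - {0}" for k
  proof (cases "k = 1")
    case False
    have iso: "isometry d (rot 1 k 0 1)" using k d False by (intro isometry_rot) auto
    have "(\<lambda>x. (x 1)\<^sup>2 * (x 0) ^ (2 * j)) \<in> borel_measurable (borel_space d)" by simp
    from integral_isometry[OF iso this] show ?thesis using k False by (simp add: rot_def)
  qed simp
  have "AE x in ?S. enorm d x = 1" using d by (intro AE_enorm_uniform_sphere) auto
  then have "AE x in ?S. (x 0) ^ (2 * j) = (\<Sum>k<d. (x k)\<^sup>2 * (x 0) ^ (2 * j))"
  proof eventually_elim
    case (elim x)
    then have "(\<Sum>k<d. (x k)\<^sup>2) = 1" by (simp add: enorm_def)
    then show ?case by (simp flip: sum_distrib_right)
  qed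
  then have "sphere_moment d j = (\<integral>x. (\<Sum>k<d. (x k)\<^sup>2 * (x 0) ^ (2 * j)) \<partial>?S)"
    unfolding sphere_moment_def using d
    by (intro integral_cong_AE borel_measurable_sum borel_measurable_times borel_measurable_power coordinate_measurable) auto
  also have "\<dots> = (\<Sum>k<d. ?E k)"
    using d by (intro Bochner_Integration.integral_sum integrable_coordinate_powers) auto
  also have "\<dots> = ?E 0 + (\<Sum>k\<in>{..<d} - {0}. ?E k)" using d by (intro sum.remove) auto
  also have "(\<Sum>k\<in>{..<d} - {0}. ?E k) = (\<Sum>k\<in>{..<d} - {0}. ?E 1)"
    by (rule sum.cong[OF refl E])
  also have "\<dots> = (real d - 1) * ?E 1"
    using d by (simp add: of_nat_diff)
  also have "?E 0 = sphere_moment d (Suc j)"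
    by (simp add: sphere_moment_def power2_eq_square mult.assoc)
  also have "?E 1 = sphere_moment d (Suc j) / (2 * real j + 1)"
    using sphere_moment_mixed[OF d, of j] by (simp add: field_simps)
  finally have "sphere_moment d j = sphere_moment d (Suc j) * ((real d + 2 * real j) / (2 * real j + 1))"
    by (simp add: field_simps)
  then show ?thesis using d by (simp add: field_simps)
qed

lemma sphere_moment_0: "sphere_moment d 0 = 1"
  using prob_space.prob_space[OF prob_space_uniform_sphere] by (simp add: sphere_moment_def)

lemma sphere_moment_eq:
  assumes "2 \<le> d"
  shows "sphere_moment d j = (\<Prod>i<j. (2 * real i + 1) / (real d + 2 * real i))"
  by (induction j) (simp_all add: sphere_moment_0 sphere_moment_Suc[OF assms])

text \<open>The double factorial (2j - 1)!!, which is the moment of order 2j of a standard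
  Gaussian.\<close>

definition odd_fact :: "nat \<Rightarrow> real" where
  "odd_fact j = (\<Prod>i<j. 2 * real i + 1)"

lemma odd_fact_pos: "0 < odd_fact j"
  by (auto simp: odd_fact_def intro: prod_pos)

lemma fact_le_odd_fact: "fact j \<le> odd_fact j"
proof (induction j)
  case (Suc j)
  have "fact (Suc j) = (real j + 1) * fact j" by (simp add: algebra_simps)
  also have "\<dots> \<le> (2 * real j + 1) * odd_fact j" using Suc by (intro mult_mono) auto
  finally show ?case by (simp add: odd_fact_def mult.commute)
qed (simp add: odd_fact_def)

lemma sphere_moment_le:
  assumes "2 \<le> d"
  shows "sphere_moment d j \<le> odd_fact j / real d ^ j"
proof -
  have "sphere_moment d j \<le> (\<Prod>i<j. (2 * real i + 1) / real d)"
    unfolding sphere_moment_eq[OF assms] using assms by (intro prod_mono) (auto intro!: divide_left_mono)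
  then show ?thesis by (simp add: odd_fact_def prod_dividef)
qed

lemma sphere_moment_ge:
  assumes "2 \<le> d" "2 * j \<le> d"
  shows "odd_fact j / (2 * real d) ^ j \<le> sphere_moment d j"
proof -
  have "(\<Prod>i<j. (2 * real i + 1) / (2 * real d)) \<le> sphere_moment d j"
    unfolding sphere_moment_eq[OF assms(1)]
  proof (intro prod_mono conjI divide_left_mono)
    fix i assume "i \<in> {..<j}"
    then have "2 * i \<le> d" using assms by auto
    then show "real d + 2 * real i \<le> 2 * real d" by (simp flip: of_nat_le_iff)
  qed (use assms in auto)
  then show ?thesis by (simp add: odd_fact_def prod_dividef)
qed

lemma sphere_moment_1: "2 \<le> d \<Longrightarrow> sphere_moment d 1 = 1 / real d"
  by (simp add: sphere_moment_eq)

lemma sphere_moment_2_le: "2 \<le> d \<Longrightarrow> sphere_moment d 2 \<le> 3 / (real d)\<^sup>2"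
  using sphere_moment_le[of d 2] by (simp add: odd_fact_def numeral_2_eq_2)

lemma integral_coordinate:
  assumes "2 \<le> d" shows "(\<integral>x. x 0 \<partial>uniform_sphere d) = 0"
proof -
  have iso: "isometry d (rot 0 1 (-1) 0)" using assms by (intro isometry_rot) auto
  have "(\<lambda>x. x 0) \<in> borel_measurable (borel_space d)" using assms by (intro borel_measurable_coordinate) auto
  from integral_isometry[OF iso this] show ?thesis by (simp add: rot_def)
qed

section \<open>Exponential moments and lower tails\<close>

lemma even_exp_series:
  fixes z :: real
  shows "(\<lambda>j. z ^ (2 * j) / fact (2 * j)) sums ((exp z + exp (- z)) / 2)"
proof -
  have "(\<lambda>n. (z ^ n /\<^sub>R fact n + (- z) ^ n /\<^sub>R fact n) / 2) sums ((exp z + exp (- z)) / 2)"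
    by (intro sums_divide sums_add exp_converges)
  then have "(\<lambda>j. \<Sum>n = j * 2..<j * 2 + 2. (z ^ n /\<^sub>R fact n + (- z) ^ n /\<^sub>R fact n) / 2) sums ((exp z + exp (- z)) / 2)"
    by (rule sums_group) simp
  moreover have "(\<Sum>n = j * 2..<j * 2 + 2. (z ^ n /\<^sub>R fact n + (- z) ^ n /\<^sub>R fact n) / 2) = z ^ (2 * j) / fact (2 * j)" for j
  proof -
    have "{j * 2..<j * 2 + 2} = {2 * j, Suc (2 * j)}" by auto
    then show ?thesis by (simp only:) (simp add: divide_simps)
  qed
  ultimately show ?thesis by simp
qed

text \<open>In the ratio of consecutive terms the factor \<open>2 * j + 1\<close> cancels against
  the factorial, and what is left is at most \<open>1 / (2 * d * (j + 1))\<close>. This is a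
  termwise comparison with the exponential moments of a Gaussian of variance 1/d.\<close>

lemma sphere_moment_exp_term:
  assumes "2 \<le> d"
  shows "sphere_moment d j / fact (2 * j) \<le> (1 / (2 * real d)) ^ j / fact j"
proof (induction j)
  case (Suc j)
  have "sphere_moment d (Suc j) / fact (2 * Suc j) =
      sphere_moment d j / fact (2 * j) * (1 / ((real d + 2 * real j) * (2 * (real j + 1))))"
    using assms by (simp add: sphere_moment_Suc divide_simps) (simp add: algebra_simps)
  also have "\<dots> \<le> (1 / (2 * real d)) ^ j / fact j * (1 / (real d * (2 * (real j + 1))))"
    using Suc assms by (intro mult_mono divide_left_mono mult_right_mono) auto
  also have "\<dots> = (1 / (2 * real d)) ^ Suc j / fact (Suc j)"
    using assms by (simp add: divide_simps)
  finally show ?case .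
qed (simp add: sphere_moment_0)

text \<open>The integrand is at most twice the hyperbolic cosine of \<open>a * x 0\<close>, whose
  series has only even powers and is integrated term by term.\<close>

lemma integral_exp_coordinate_le:
  assumes d: "2 \<le> d"
  shows "integrable (uniform_sphere d) (\<lambda>x. exp (a * \<bar>x 0\<bar>))"
    and "(\<integral>x. exp (a * \<bar>x 0\<bar>) \<partial>uniform_sphere d) \<le> 2 * exp (a\<^sup>2 / (2 * real d))"
proof -
  let ?S = "uniform_sphere d"
  interpret S: prob_space ?S by (rule prob_space_uniform_sphere)
  have [measurable]: "(\<lambda>x. x 0) \<in> borel_measurable ?S" using d by (intro coordinate_measurable) auto
  have "AE x in ?S. \<bar>x 0\<bar> \<le> 1" using d by (intro AE_uniform_sphere_coordinate_le) auto
  then have "AE x in ?S. norm (exp (a * \<bar>x 0\<bar>)) \<le> exp \<bar>a\<bar>"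
  proof eventually_elim
    case (elim x)
    have "a * \<bar>x 0\<bar> \<le> \<bar>a\<bar> * 1" using elim by (intro mult_mono) auto
    then show ?case by simp
  qed
  then show int: "integrable ?S (\<lambda>x. exp (a * \<bar>x 0\<bar>))"
    by (rule S.integrable_const_bound) measurable
  define f where "f j x = (a * x 0) ^ (2 * j) / fact (2 * j)" for j and x :: "nat \<Rightarrow> real"
  have f0: "0 \<le> f j x" for j x by (simp add: f_def power_mult)
  have fint: "integrable ?S (f j)" for j
    using integrable_coordinate_powers[of 0 d 0 "2 * j" 0] d unfolding f_def[abs_def] by (simp add: power_mult_distrib)
  have feq: "(\<integral>x. f j x \<partial>?S) = a ^ (2 * j) * (sphere_moment d j / fact (2 * j))" for j
    by (simp add: f_def sphere_moment_def power_mult_distrib)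
  have fle: "(\<integral>x. f j x \<partial>?S) \<le> (a\<^sup>2 / (2 * real d)) ^ j / fact j" for j
  proof -
    have "(\<integral>x. f j x \<partial>?S) \<le> a ^ (2 * j) * ((1 / (2 * real d)) ^ j / fact j)"
      unfolding feq using sphere_moment_exp_term[OF d] by (intro mult_left_mono) (auto simp: power_mult)
    then show ?thesis by (simp add: power_mult power_divide)
  qed
  have exps: "(\<lambda>j. (a\<^sup>2 / (2 * real d)) ^ j / fact j) sums exp (a\<^sup>2 / (2 * real d))"
  proof -
    have "y ^ j /\<^sub>R fact j = y ^ j / fact j" for y :: real and j by (simp add: divide_inverse)
    then show ?thesis using exp_converges[of "a\<^sup>2 / (2 * real d)"] by (simp only:)
  qed
  have nf: "norm (f j x) = f j x" for j x using f0[of j x] by simp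
  have summ: "summable (\<lambda>j. \<integral>x. norm (f j x) \<partial>?S)"
    unfolding nf by (rule summable_comparison_test'[OF sums_summable[OF exps], of 0])
      (use fle f0 in \<open>auto simp: Bochner_Integration.integral_nonneg\<close>)
  define h where "h x = (exp (a * x 0) + exp (- (a * x 0))) / 2" for x :: "nat \<Rightarrow> real"
  have series: "(\<lambda>j. f j x) sums h x" for x
    unfolding f_def h_def by (rule even_exp_series)
  have norm_series: "AE x in ?S. summable (\<lambda>j. norm (f j x))"
    unfolding nf using sums_summable[OF series] by simp
  have h_eq: "h = (\<lambda>x. \<Sum>j. f j x)"
    using series by (auto simp: sums_iff)
  have hint: "integrable ?S h"
    unfolding h_eq by (rule integrable_suminf[OF fint norm_series summ])
  have "(\<lambda>j. \<integral>x. f j x \<partial>?S) sums (\<integral>x. h x \<partial>?S)"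
    unfolding h_eq by (rule sums_integral[OF fint norm_series summ])
  then have "(\<integral>x. h x \<partial>?S) \<le> exp (a\<^sup>2 / (2 * real d))"
    by (rule sums_le[OF fle _ exps])
  moreover have "(\<integral>x. exp (a * \<bar>x 0\<bar>) \<partial>?S) \<le> (\<integral>x. 2 * h x \<partial>?S)"
  proof (rule integral_mono[OF int])
    show "integrable ?S (\<lambda>x. 2 * h x)" using hint by simp
    show "exp (a * \<bar>x 0\<bar>) \<le> 2 * h x" for x by (auto simp: h_def abs_if)
  qed
  ultimately show "(\<integral>x. exp (a * \<bar>x 0\<bar>) \<partial>?S) \<le> 2 * exp (a\<^sup>2 / (2 * real d))"
    by simp
qed

lemma (in prob_space) Cauchy_Schwarz_bounded:
  fixes f g :: "'a \<Rightarrow> real"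
  assumes "integrable M (\<lambda>x. (f x)\<^sup>2)" "integrable M (\<lambda>x. (g x)\<^sup>2)" "integrable M (\<lambda>x. f x * g x)"
  shows "(expectation (\<lambda>x. f x * g x))\<^sup>2 \<le> expectation (\<lambda>x. (f x)\<^sup>2) * expectation (\<lambda>x. (g x)\<^sup>2)"
proof -
  let ?A = "expectation (\<lambda>x. (f x)\<^sup>2)" and ?B = "expectation (\<lambda>x. (g x)\<^sup>2)" and ?C = "expectation (\<lambda>x. f x * g x)"
  have q: "0 \<le> ?A * s\<^sup>2 - 2 * ?C * s + ?B" for s
  proof -
    have "0 \<le> expectation (\<lambda>x. (s * f x - g x)\<^sup>2)" by simp
    also have "(\<lambda>x. (s * f x - g x)\<^sup>2) = (\<lambda>x. s\<^sup>2 * (f x)\<^sup>2 - 2 * s * (f x * g x) + (g x)\<^sup>2)"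
      by (auto simp: power2_eq_square algebra_simps)
    also have "expectation \<dots> = s\<^sup>2 * ?A - 2 * s * ?C + ?B"
      using assms by simp
    finally show ?thesis by (simp add: algebra_simps)
  qed
  have A: "0 \<le> ?A" by simp
  show ?thesis
  proof (cases "?A = 0")
    case True
    have "?C = 0"
    proof (rule ccontr)
      assume "?C \<noteq> 0"
      \<comment> \<open>With \<open>?A = 0\<close> the quadratic degenerates to an affine function
        of \<open>s\<close>, which takes the value -1 at this point.\<close>
      then show False using q[of "(?B + 1) / (2 * ?C)"] True by (simp add: field_simps)
    qed
    then show ?thesis using True by simp
  next
    case False
    then have A: "0 < ?A" using A by linarith
    have "?A * (?C / ?A)\<^sup>2 - 2 * ?C * (?C / ?A) + ?B = (?A * ?B - ?C\<^sup>2) / ?A"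
      using A by (simp add: field_simps power2_eq_square)
    then have "0 \<le> ?A * ?B - ?C\<^sup>2" using q[of "?C / ?A"] A by (simp add: zero_le_divide_iff)
    then show ?thesis by simp
  qed
qed

text \<open>The Paley--Zygmund inequality, applied to a high power of the coordinate.\<close>
lemma coordinate_tail:
  fixes K :: real
  assumes K: "0 < K"
  obtains c N where "0 < c" "\<And>d. N \<le> d \<Longrightarrow>
    c \<le> measure (uniform_sphere d) {x \<in> space (uniform_sphere d). K / real d < (x 0)\<^sup>2}"
proof -
  \<comment> \<open>Wanted is a \<open>j\<close> for which \<open>(K / d) ^ j\<close> is at most
    half of the lower bound \<open>odd_fact j / (2 * d) ^ j\<close> for the moment. The powers of
    \<open>d\<close> cancel and the factorial outgrows \<open>(2 * K) ^ j\<close>, so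
    \<open>j\<close> depends on \<open>K\<close> alone.\<close>
  have "(\<lambda>j. (2 * K) ^ j /\<^sub>R fact j) \<longlonglongrightarrow> 0"
    by (intro summable_LIMSEQ_zero summable_exp_generic)
  then have "\<forall>\<^sub>F j in sequentially. (2 * K) ^ j /\<^sub>R fact j < 1 / 2"
    by (rule order_tendstoD) simp
  then obtain j where j: "(2 * K) ^ j / fact j < 1 / 2" "1 \<le> j"
    unfolding eventually_sequentially by (metis divide_real_def max.cobounded1 max.cobounded2 mult.commute real_scaleR_def)
  then have "2 * (2 * K) ^ j \<le> fact j" by (simp add: field_simps)
  also have "\<dots> \<le> odd_fact j" by (rule fact_le_odd_fact)
  finally have jK: "2 * (2 * K) ^ j \<le> odd_fact j" .
  \<comment> \<open>The square of half the lower bound for the moment of order 2j, divided by the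
    upper bound for that of order 4j, with all powers of \<open>d\<close> cancelled.\<close>
  define c where "c = (odd_fact j / 2 ^ j / 2)\<^sup>2 / odd_fact (2 * j)"
  show ?thesis
  proof (rule that[of c "max 3 (2 * j)"])
    show "0 < c" using odd_fact_pos[of j] odd_fact_pos[of "2 * j"] by (simp add: c_def)
    fix d :: nat assume "max 3 (2 * j) \<le> d"
    then have d: "2 \<le> d" "2 * j \<le> d" by auto
    let ?S = "uniform_sphere d"
    interpret S: prob_space ?S by (rule prob_space_uniform_sphere)
    have [measurable]: "(\<lambda>x. x 0) \<in> borel_measurable ?S" using d by (intro coordinate_measurable) auto
    let ?A = "{x \<in> space ?S. K / real d < (x 0)\<^sup>2}"
    have A [measurable]: "?A \<in> sets ?S" by measurable
    have I: "integrable ?S (\<lambda>x. (x 0) ^ n)" for n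
      using integrable_coordinate_powers[of 0 d 0 n 0] d by simp
    let ?m = "odd_fact j / (2 * real d) ^ j"
    have small: "(K / real d) ^ j \<le> ?m / 2"
      using jK d by (simp add: power_mult_distrib power_divide field_simps)
    have pt: "(x 0) ^ (2 * j) \<le> (K / real d) ^ j + (x 0) ^ (2 * j) * indicator ?A x" if "x \<in> space ?S" for x
    proof (cases "x \<in> ?A")
      case False
      then have "((x 0)\<^sup>2) ^ j \<le> (K / real d) ^ j" using that by (intro power_mono) auto
      then show ?thesis using False by (simp add: power_mult)
    qed (use K in simp)
    have I2: "integrable ?S (\<lambda>x. (x 0) ^ (2 * j) * indicator ?A x)"
      using integrable_mult_indicator[OF A I[of "2 * j"]] by (simp add: mult.commute)
    have "?m \<le> sphere_moment d j" using d by (intro sphere_moment_ge)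
    also have "\<dots> \<le> (\<integral>x. (K / real d) ^ j + (x 0) ^ (2 * j) * indicator ?A x \<partial>?S)"
      unfolding sphere_moment_def using pt I I2 by (intro integral_mono) auto
    also have "\<dots> = (K / real d) ^ j + (\<integral>x. (x 0) ^ (2 * j) * indicator ?A x \<partial>?S)"
      using I2 by (simp add: S.prob_space)
    finally have "?m / 2 \<le> (\<integral>x. (x 0) ^ (2 * j) * indicator ?A x \<partial>?S)" using small by simp
    then have "(?m / 2)\<^sup>2 \<le> (\<integral>x. (x 0) ^ (2 * j) * indicator ?A x \<partial>?S)\<^sup>2"
      using odd_fact_pos[of j] by (intro power_mono) auto
    also have "\<dots> \<le> (\<integral>x. ((x 0) ^ (2 * j))\<^sup>2 \<partial>?S) * (\<integral>x. (indicator ?A x)\<^sup>2 \<partial>?S)"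
    proof (rule S.Cauchy_Schwarz_bounded[OF _ _ I2])
      show "integrable ?S (\<lambda>x. ((x 0) ^ (2 * j))\<^sup>2)" using I by (simp flip: power_mult)
      show "integrable ?S (\<lambda>x. (indicator ?A x :: real)\<^sup>2)"
        using A by (intro S.integrable_const_bound[of _ 1]) (auto simp: indicator_def)
    qed
    also have "(\<integral>x. (indicator ?A x)\<^sup>2 \<partial>?S) = measure ?S ?A"
    proof -
      have "(\<integral>x. (indicator ?A x :: real)\<^sup>2 \<partial>?S) = (\<integral>x. indicator ?A x \<partial>?S)"
        by (intro Bochner_Integration.integral_cong) (auto simp: indicator_def)
      then show ?thesis using A by (simp add: Int_absorb1 sets.sets_into_space)
    qed
    also have "(\<integral>x. ((x 0) ^ (2 * j))\<^sup>2 \<partial>?S) = sphere_moment d (2 * j)"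
      by (simp add: sphere_moment_def mult.commute flip: power_mult)
    finally have "(?m / 2)\<^sup>2 \<le> sphere_moment d (2 * j) * measure ?S ?A" .
    also have "\<dots> \<le> odd_fact (2 * j) / real d ^ (2 * j) * measure ?S ?A"
      using d by (intro mult_right_mono sphere_moment_le) auto
    finally have "(?m / 2)\<^sup>2 * real d ^ (2 * j) / odd_fact (2 * j) \<le> measure ?S ?A"
      using d odd_fact_pos[of "2 * j"] by (simp add: field_simps)
    also have "(?m / 2)\<^sup>2 * real d ^ (2 * j) / odd_fact (2 * j) = c"
      using d by (simp add: c_def power_mult_distrib power_divide mult.commute[of 2 j] power_mult)
    finally show "c \<le> measure ?S ?A" .
  qed
qed

section \<open>The covariance of two caps\<close>

text \<open>The mean value theorem gives \<open>y * cos y \<le> sin y\<close>. This is used at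
  \<open>x / 2\<close>, where the squared cosine is at least 1/2, and the double angle formula leads
  back to \<open>x\<close>.\<close>

lemma sin_ge_half:
  fixes x :: real
  assumes "0 \<le> x" "x \<le> pi / 2"
  shows "x / 2 \<le> sin x"
proof -
  have sin_ge: "y * cos y \<le> sin y" if y: "0 \<le> y" "y \<le> pi / 2" for y :: real
  proof (cases "y = 0")
    case False
    then obtain z where z: "0 < z" "z < y" "sin y - sin 0 = (y - 0) * cos z"
      using MVT2[of 0 y sin cos] y by (auto intro: DERIV_sin)
    have "cos y \<le> cos z" using z y by (intro cos_monotone_0_pi_le) auto
    then show ?thesis using z y by (simp add: mult_left_mono)
  qed simp
  have "x * (1 / 2) \<le> x * (cos (x/2))\<^sup>2"
  proof (rule mult_left_mono)
    have "0 \<le> cos x" using assms by (intro cos_ge_zero) auto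
    then show "1 / 2 \<le> (cos (x/2))\<^sup>2" using cos_double_cos[of "x/2"] by simp
  qed (use assms in auto)
  also have "\<dots> = 2 * (x/2 * cos (x/2)) * cos (x/2)" by (simp add: power2_eq_square)
  also have "\<dots> \<le> 2 * sin (x/2) * cos (x/2)"
    using assms sin_ge[of "x/2"] by (intro mult_right_mono cos_ge_zero) auto
  also have "\<dots> = sin x" using sin_double[of "x/2"] by simp
  finally show ?thesis by simp
qed

lemma arccos_near_right_angle:
  assumes "\<bar>u\<bar> \<le> 1" shows "\<bar>arccos u - pi / 2\<bar> \<le> 2 * \<bar>u\<bar>"
proof -
  have pos: "arcsin v \<le> 2 * v" if "0 \<le> v" "v \<le> 1" for v
    using sin_ge_half[of "arcsin v"] that arcsin_bounded[of v] arcsin_nonneg[of v] by auto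
  have nn: "0 \<le> arcsin v" if "0 \<le> v" "v \<le> 1" for v using that by (intro arcsin_nonneg) auto
  have "\<bar>arcsin u\<bar> \<le> 2 * \<bar>u\<bar>"
  proof (cases "0 \<le> u")
    case True
    then show ?thesis using pos[of u] nn[of u] assms by auto
  next
    case False
    then show ?thesis using pos[of "- u"] nn[of "- u"] assms by (auto simp: arcsin_minus)
  qed
  then show ?thesis using assms by (simp add: arccos_arcsin_eq abs_le_iff)
qed

lemma abs_diff_le_arccos:
  assumes "\<bar>u\<bar> \<le> 1" "\<bar>v\<bar> \<le> 1"
  shows "\<bar>u - v\<bar> \<le> \<bar>arccos u - arccos v\<bar>"
proof -
  have cos_diff_le: "\<bar>cos a - cos b\<bar> \<le> \<bar>a - b\<bar>" for a b :: real
  proof -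
    have "\<bar>cos a - cos b\<bar> = 2 * (\<bar>sin ((a + b) / 2)\<bar> * \<bar>sin ((b - a) / 2)\<bar>)"
      by (simp add: cos_diff_cos abs_mult)
    also have "\<dots> \<le> 2 * (1 * \<bar>(b - a) / 2\<bar>)"
      by (intro mult_left_mono mult_mono abs_sin_x_le_abs_x) auto
    finally show ?thesis by (simp add: abs_minus_commute)
  qed
  show ?thesis using cos_diff_le[of "arccos u" "arccos v"] assms by (simp add: abs_le_iff)
qed

text \<open>The analysis depends on the threshold only through the probability of its cap, so
  \<open>t\<close> is any value with that property; it is identified with
  \<open>threshold p d\<close> where the results are applied.\<close>

locale spherical_cap =
  fixes d :: nat and p t :: real
  assumes d: "3 \<le> d" and p: "0 < p" "p < 1"
    and prob_cap: "measure (uniform_sphere d) {x \<in> space (uniform_sphere d). t \<le> x 0} = p"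
begin

abbreviation "S \<equiv> uniform_sphere d"

sublocale S: prob_space S by (rule prob_space_uniform_sphere)

sublocale SS: pair_prob_space S S ..

definition kernel :: "real \<Rightarrow> real" where
  "kernel u = half_line t u - p"

text \<open>The truncation of \<open>u\<close> only serves to make this function continuous on the whole line.\<close>
definition cov :: "real \<Rightarrow> real" where
  "cov u = cap_overlap d t (arccos (max (-1) (min 1 u))) - p\<^sup>2"

text \<open>The function \<open>f\<close> of the overview, defined and jointly measurable for
  arbitrary vectors. For unit vectors it equals \<open>cov\<close> of the inner product, so one is
  exchanged for the other almost everywhere.\<close>

definition cap_cov :: "(nat \<Rightarrow> real) \<Rightarrow> (nat \<Rightarrow> real) \<Rightarrow> real" where
  "cap_cov y y' = (\<integral>x. kernel (dot d x y) * kernel (dot d x y') \<partial>S)"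

lemma kernel_measurable [measurable]: "kernel \<in> borel_measurable borel"
  unfolding kernel_def by measurable

lemma abs_kernel_le: "\<bar>kernel u\<bar> \<le> 1"
  using p by (auto simp: kernel_def half_line_def)

lemma coordinate_meas [measurable]: "(\<lambda>x. x 0) \<in> borel_measurable S" "(\<lambda>x. x (Suc 0)) \<in> borel_measurable S"
  using d by (auto intro: coordinate_measurable)

lemma dot_const_measurable [measurable]:
  "(\<lambda>x. dot d x y) \<in> borel_measurable S" "(\<lambda>x. dot d y x) \<in> borel_measurable S"
  unfolding dot_def using coordinate_measurable
  by (auto intro!: borel_measurable_sum borel_measurable_times)

lemma AE_unit: "AE x in S. enorm d x = 1"
  using d by (intro AE_enorm_uniform_sphere) auto

lemma AE_coordinate_le: "AE x in S. \<bar>x 0\<bar> \<le> 1"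
  using d by (intro AE_uniform_sphere_coordinate_le) auto

lemma integrable_power_coordinate: "integrable S (\<lambda>x. (x 0) ^ n)"
  using integrable_coordinate_powers[of 0 d 0 n 0] d by simp

lemma integral_half_line: "(\<integral>x. half_line t (x 0) \<partial>S) = p"
proof -
  have "{x \<in> space S. t \<le> x 0} \<in> sets S" by measurable
  then show ?thesis using prob_cap by (simp add: half_line_def integral_of_bool)
qed

lemma integral_kernel: "(\<integral>x. kernel (x 0) \<partial>S) = 0"
proof -
  have "integrable S (\<lambda>x. half_line t (x 0))"
    by (intro S.integrable_const_bound[of _ 1]) (auto simp: half_line_range)
  then show ?thesis by (simp add: kernel_def integral_half_line S.prob_space)
qed

lemma integral_kernel_dot: "enorm d y = 1 \<Longrightarrow> (\<integral>x. kernel (dot d x y) \<partial>S) = 0"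
  using integral_dot_unit[OF d, of y kernel] by (simp add: integral_kernel)

lemma cap_overlap_measurable [measurable]: "cap_overlap d t \<in> borel_measurable borel"
proof -
  have "(\<lambda>\<theta>. \<integral>x. half_line t (x 0) * half_line t (x 0 * cos \<theta> + x (Suc 0) * sin \<theta>) \<partial>S) \<in> borel_measurable borel"
    by measurable
  then show ?thesis by (simp add: cap_overlap_def[abs_def])
qed

lemma cov_measurable [measurable]: "cov \<in> borel_measurable borel"
proof -
  have "continuous_on UNIV (\<lambda>u::real. arccos (max (-1) (min 1 u)))"
    by (intro continuous_on_arccos continuous_intros) auto
  then have [measurable]: "(\<lambda>u::real. arccos (max (-1) (min 1 u))) \<in> borel_measurable borel"
    by (rule borel_measurable_continuous_onI)
  show ?thesis unfolding cov_def by measurable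
qed

lemma cov_eq: "\<bar>u\<bar> \<le> 1 \<Longrightarrow> cov u = cap_overlap d t (arccos u) - p\<^sup>2"
proof -
  assume "\<bar>u\<bar> \<le> 1"
  then have "max (-1) (min 1 u) = u" by auto
  then show ?thesis by (simp add: cov_def)
qed

text \<open>Expanding the product of the two centred indicators leaves the overlap minus
  \<open>p\<^sup>2\<close>. After alignment the coefficients \<open>r\<close> and
  \<open>sqrt (1 - r\<^sup>2)\<close> are the cosine and sine of \<open>arccos r\<close>.\<close>

lemma cap_cov_eq:
  assumes y: "enorm d y = 1" "enorm d y' = 1"
  shows "cap_cov y y' = cov (dot d y y')"
proof -
  define r where "r = dot d y y'"
  have r: "\<bar>r\<bar> \<le> 1" using dot_Cauchy_Schwarz[of d y y'] y by (simp add: r_def)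
  have int: "integrable S (\<lambda>x. half_line t (dot d x v))" for v
    by (intro S.integrable_const_bound[of _ 1]) (auto simp: half_line_range, measurable)
  have int2: "integrable S (\<lambda>x. half_line t (dot d x y) * half_line t (dot d x y'))"
    by (intro S.integrable_const_bound[of _ 1]) (auto simp: half_line_range abs_mult intro!: mult_le_one, measurable)
  have one: "(\<integral>x. half_line t (dot d x v) \<partial>S) = p" if "enorm d v = 1" for v
    using integral_dot_unit[OF d that, of "half_line t"] by (simp add: integral_half_line)
  have "cap_cov y y' = (\<integral>x. half_line t (dot d x y) * half_line t (dot d x y') -
      p * half_line t (dot d x y) - p * half_line t (dot d x y') + p\<^sup>2 \<partial>S)"
    by (simp add: cap_cov_def kernel_def algebra_simps power2_eq_square)
  also have "\<dots> = (\<integral>x. half_line t (dot d x y) * half_line t (dot d x y') \<partial>S) - p * p - p * p + p\<^sup>2"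
    using int int2 by (simp add: one y S.prob_space)
  also have "(\<integral>x. half_line t (dot d x y) * half_line t (dot d x y') \<partial>S) = cap_overlap d t (arccos r)"
  proof -
    obtain g where g: "isometry d g" "\<And>x. dot d x y = g x 0"
      "\<And>x. dot d x y' = r * g x 0 + sqrt (1 - r\<^sup>2) * g x 1"
      using align_pair[OF d y, folded r_def] by metis
    let ?F = "\<lambda>x. half_line t (x 0) * half_line t (r * x 0 + sqrt (1 - r\<^sup>2) * x (Suc 0))"
    have "?F \<in> borel_measurable S" by measurable
    then have "?F \<in> borel_measurable (borel_space d)" by (simp cong: measurable_cong_sets)
    from integral_isometry[OF g(1) this]
    have "(\<integral>x. half_line t (dot d x y) * half_line t (dot d x y') \<partial>S) = (\<integral>x. ?F x \<partial>S)"
      by (simp add: g(2,3))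
    then show ?thesis
      using r by (simp add: cap_overlap_def sin_arccos cos_arccos abs_le_iff mult.commute)
  qed
  finally show ?thesis by (simp add: cov_eq[OF r] power2_eq_square flip: r_def)
qed

lemma cap_cov_measurable [measurable]:
  assumes "f \<in> measurable M S" "g \<in> measurable M S"
  shows "(\<lambda>z. cap_cov (f z) (g z)) \<in> borel_measurable M"
proof -
  have [measurable]: "f \<in> measurable M (borel_space d)" "g \<in> measurable M (borel_space d)"
    using assms by (simp_all cong: measurable_cong_sets)
  have [measurable]: "snd \<in> measurable (M \<Otimes>\<^sub>M S) (borel_space d)"
    using measurable_snd[of M S] by (simp cong: measurable_cong_sets)
  show ?thesis unfolding cap_cov_def by measurable
qed

lemma abs_cap_cov_le: "\<bar>cap_cov y y'\<bar> \<le> 1"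
proof -
  have "\<bar>cap_cov y y'\<bar> \<le> (\<integral>x. \<bar>kernel (dot d x y) * kernel (dot d x y')\<bar> \<partial>S)"
    unfolding cap_cov_def by (rule integral_abs_bound)
  also have "\<dots> \<le> (\<integral>x. 1 \<partial>S)"
  proof (rule integral_mono)
    show "integrable S (\<lambda>x. \<bar>kernel (dot d x y) * kernel (dot d x y')\<bar>)"
      by (intro S.integrable_const_bound[of _ 1]) (auto simp: abs_mult abs_kernel_le intro!: mult_le_one, measurable)
  qed (auto simp: abs_mult abs_kernel_le intro!: mult_le_one)
  finally show ?thesis by (simp add: S.prob_space)
qed

lemma ex_unit: "\<exists>y \<in> space S. enorm d y = 1"
proof (rule ccontr)
  assume no: "\<not> ?thesis"
  have "AE x in S. False" using AE_unit AE_space by eventually_elim (use no in auto)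
  then show False by simp
qed

lemma AE_cov_dot:
  assumes "enorm d y = 1" shows "AE x in S. cap_cov x y = cov (dot d x y)"
  using AE_unit by eventually_elim (rule cap_cov_eq[OF _ assms])

text \<open>After the integrals are exchanged, the inner one is a multiple of the mean of
  \<open>kernel (dot d z x)\<close> over \<open>x\<close>, which vanishes for every unit vector
  \<open>z\<close>. This centring removes the linear term in part (a) and bounds
  \<open>cov 0\<close>.\<close>

lemma integral_cap_cov:
  assumes y: "enorm d y = 1"
  shows "(\<integral>x. cap_cov x y \<partial>S) = 0"
proof -
  let ?F = "\<lambda>x z. kernel (dot d z x) * kernel (dot d z y)"
  have "integrable (S \<Otimes>\<^sub>M S) (\<lambda>w. ?F (fst w) (snd w))"
    by (intro SS.integrable_const_bound[of _ 1]) (auto simp: abs_mult abs_kernel_le intro!: mult_le_one, measurable)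
  then have int: "integrable (S \<Otimes>\<^sub>M S) (case_prod ?F)" by (simp add: case_prod_beta')
  have "(\<integral>x. cap_cov x y \<partial>S) = (\<integral>z. (\<integral>x. kernel (dot d z x) * kernel (dot d z y) \<partial>S) \<partial>S)"
    unfolding cap_cov_def using SS.Fubini_integral[OF int] by simp
  also have "\<dots> = (\<integral>z. 0 \<partial>S)"
  proof (rule integral_cong_AE)
    show "AE z in S. (\<integral>x. kernel (dot d z x) * kernel (dot d z y) \<partial>S) = 0"
      using AE_unit
    proof eventually_elim
      case (elim z)
      have "(\<integral>x. kernel (dot d z x) * kernel (dot d z y) \<partial>S) = (\<integral>x. kernel (dot d x z) \<partial>S) * kernel (dot d z y)"
        by (simp add: dot_commute)
      then show ?case using integral_kernel_dot[OF elim] by simp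
    qed
  qed measurable
  finally show ?thesis by simp
qed

lemma integral_dot_measurable:
  assumes "enorm d y = 1" "f \<in> borel_measurable borel"
  shows "(\<integral>x. f (dot d x y) \<partial>S) = (\<integral>x. f (x 0) \<partial>S :: real)"
  by (rule integral_dot_unit[OF d assms])

lemma integral_cov: "(\<integral>x. cov (x 0) \<partial>S) = 0"
proof -
  obtain y where y: "enorm d y = 1" "y \<in> space S" using ex_unit by auto
  have "(\<integral>x. cov (x 0) \<partial>S) = (\<integral>x. cov (dot d x y) \<partial>S)"
    by (rule integral_dot_measurable[OF y(1), symmetric]) measurable
  also have "\<dots> = (\<integral>x. cap_cov x y \<partial>S)"
    using AE_cov_dot[OF y(1)] y(2) by (intro integral_cong_AE) (auto elim!: eventually_mono)
  finally show ?thesis by (simp add: integral_cap_cov[OF y(1)])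
qed

lemma abs_cov_le_1: "AE x in S. \<bar>cov (x 0)\<bar> \<le> 1"
proof -
  have "0 \<le> cap_overlap d t \<theta>" "cap_overlap d t \<theta> \<le> 1" for \<theta>
  proof -
    have "integrable S (\<lambda>x. arc_overlap t (x 0) (x 1) \<theta>)"
      using cap_overlap_eq(1)[of d t \<theta>] d arc_overlap_bounds
      by (intro S.integrable_const_bound[of _ "2 * pi"]) auto
    then have "(\<integral>x. arc_overlap t (x 0) (x 1) \<theta> \<partial>S) \<le> (\<integral>x. 2 * pi \<partial>S)"
      by (rule integral_mono) (auto simp: arc_overlap_bounds simp del: One_nat_def)
    moreover have "0 \<le> (\<integral>x. arc_overlap t (x 0) (x 1) \<theta> \<partial>S)"
      by (rule Bochner_Integration.integral_nonneg) (rule arc_overlap_bounds)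
    ultimately have "2 * pi * cap_overlap d t \<theta> \<le> 2 * pi" "0 \<le> 2 * pi * cap_overlap d t \<theta>"
      using cap_overlap_eq(2)[of d t \<theta>] d by (simp_all add: S.prob_space)
    then show "0 \<le> cap_overlap d t \<theta>" "cap_overlap d t \<theta> \<le> 1"
      using pi_gt_zero by (auto simp: zero_le_mult_iff)
  qed
  moreover have "0 \<le> p\<^sup>2" "p\<^sup>2 \<le> 1" using p by (auto simp: power_le_one)
  ultimately have "\<bar>cov u\<bar> \<le> 1" for u unfolding cov_def
    by (smt (verit))
  then show ?thesis by simp
qed

lemma integral_abs_coordinate_le: "(\<integral>x. \<bar>x 0\<bar> \<partial>S) \<le> 1 / sqrt (real d)"
proof -
  have "(\<integral>x. \<bar>x 0\<bar> * 1 \<partial>S)\<^sup>2 \<le> (\<integral>x. \<bar>x 0\<bar>\<^sup>2 \<partial>S) * (\<integral>x. 1\<^sup>2 \<partial>S)"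
    using integrable_power_coordinate[of 1] integrable_power_coordinate[of 2]
    by (intro S.Cauchy_Schwarz_bounded) auto
  also have "(\<integral>x. \<bar>x 0\<bar>\<^sup>2 \<partial>S) = 1 / real d"
    using sphere_moment_1[of d] d by (simp add: sphere_moment_def)
  finally have "(\<integral>x. \<bar>x 0\<bar> \<partial>S)\<^sup>2 \<le> (1 / sqrt (real d))\<^sup>2"
    by (simp add: S.prob_space power_divide)
  then show ?thesis by (rule power2_le_imp_le) simp
qed

lemma cap_overlap_lipschitz:
  assumes "\<theta> \<in> {0..pi}" "\<theta>' \<in> {0..pi}"
  shows "\<bar>cap_overlap d t \<theta> - cap_overlap d t \<theta>'\<bar> \<le> \<bar>\<theta> - \<theta>'\<bar> / (2 * pi)"
proof -
  have *: "\<bar>cap_overlap d t a - cap_overlap d t b\<bar> \<le> \<bar>a - b\<bar> / (2 * pi)"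
    if "0 \<le> a" "a \<le> b" "b \<le> pi" for a b
    using cap_overlap_diff(1,2)[of d a b t] d that by auto
  show ?thesis
    using *[of \<theta> \<theta>'] *[of \<theta>' \<theta>] assms by (cases "\<theta> \<le> \<theta>'") (auto simp: abs_minus_commute)
qed

lemma abs_cov_diff_right_angle:
  assumes "\<bar>u\<bar> \<le> 1" shows "\<bar>cov u - cov 0\<bar> \<le> \<bar>u\<bar> / 2"
proof -
  have "\<bar>cov u - cov 0\<bar> = \<bar>cap_overlap d t (arccos u) - cap_overlap d t (pi / 2)\<bar>"
    using assms by (simp add: cov_eq)
  also have "\<dots> \<le> \<bar>arccos u - pi / 2\<bar> / (2 * pi)"
    using assms arccos_lbound[of u] arccos_ubound[of u] by (intro cap_overlap_lipschitz) (auto simp: abs_le_iff)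
  also have "\<dots> \<le> 2 * \<bar>u\<bar> / (2 * pi)"
    using assms by (intro divide_right_mono arccos_near_right_angle) auto
  also have "\<dots> \<le> \<bar>u\<bar> / 2" using mult_right_mono[OF pi_ge_two, of "\<bar>u\<bar>"] by (simp add: field_simps)
  finally show ?thesis .
qed

text \<open>The Lipschitz bound controls only differences. Because \<open>cov\<close> has mean zero
  over the sphere, \<open>cov 0\<close> is the mean of \<open>cov 0 - cov (x 0)\<close> and hence at
  most half the first absolute moment of a coordinate.\<close>

lemma abs_cov_le:
  assumes "\<bar>u\<bar> \<le> 1" shows "\<bar>cov u\<bar> \<le> (\<bar>u\<bar> + 1 / sqrt (real d)) / 2"
proof -
  have int: "integrable S (\<lambda>x. cov (x 0))"
    using abs_cov_le_1 by (intro S.integrable_const_bound[of _ 1]) auto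
  have int': "integrable S (\<lambda>x. \<bar>x 0\<bar> / 2)"
    using integrable_power_coordinate[of 1] by auto
  have "\<bar>cov 0\<bar> = \<bar>\<integral>x. cov 0 - cov (x 0) \<partial>S\<bar>"
    using int by (simp add: integral_cov S.prob_space)
  also have "\<dots> \<le> (\<integral>x. \<bar>cov 0 - cov (x 0)\<bar> \<partial>S)" by (rule integral_abs_bound)
  also have "\<dots> \<le> (\<integral>x. \<bar>x 0\<bar> / 2 \<partial>S)"
  proof (rule integral_mono_AE)
    show "AE x in S. \<bar>cov 0 - cov (x 0)\<bar> \<le> \<bar>x 0\<bar> / 2"
      using AE_coordinate_le by eventually_elim (use abs_cov_diff_right_angle in \<open>simp only: abs_minus_commute[of "cov 0"]\<close>)
  qed (use int int' in auto)
  also have "\<dots> \<le> 1 / sqrt (real d) / 2" using integral_abs_coordinate_le by simp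
  finally show ?thesis using abs_cov_diff_right_angle[OF assms] unfolding add_divide_distrib by linarith
qed

lemma integral_cov_squared_le: "(\<integral>x. (cov (x 0))\<^sup>2 \<partial>S) \<le> 1 / real d"
proof -
  have "(\<integral>x. (cov (x 0))\<^sup>2 \<partial>S) \<le> (\<integral>x. ((x 0)\<^sup>2 + 1 / real d) / 2 \<partial>S)"
  proof (rule integral_mono_AE)
    show "integrable S (\<lambda>x. (cov (x 0))\<^sup>2)"
      using abs_cov_le_1 by (intro S.integrable_const_bound[of _ 1]) (auto simp: abs_square_le_1)
    show "AE x in S. (cov (x 0))\<^sup>2 \<le> ((x 0)\<^sup>2 + 1 / real d) / 2"
      using AE_coordinate_le
    proof eventually_elim
      case (elim x)
      let ?s = "1 / sqrt (real d)"
      have "(cov (x 0))\<^sup>2 \<le> ((\<bar>x 0\<bar> + ?s) / 2)\<^sup>2"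
        using abs_cov_le[OF elim] by (metis abs_ge_zero power2_abs power_mono)
      also have "\<dots> \<le> (\<bar>x 0\<bar>\<^sup>2 + ?s\<^sup>2) / 2"
      proof -
        have "((a + b) / 2)\<^sup>2 = (a\<^sup>2 + b\<^sup>2) / 2 - ((a - b) / 2)\<^sup>2" for a b :: real
          by (simp add: power2_eq_square field_simps)
        from this[of "\<bar>x 0\<bar>" ?s] show ?thesis
          using zero_le_power2[of "(\<bar>x 0\<bar> - ?s) / 2"] by linarith
      qed
      finally show ?case by (simp add: power_divide)
    qed
  qed (use integrable_power_coordinate[of 2] in auto)
  also have "\<dots> = ((\<integral>x. (x 0)\<^sup>2 \<partial>S) + 1 / real d) / 2"
    using integrable_power_coordinate[of 2] by (simp add: S.prob_space)
  also have "\<dots> = 1 / real d"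
    using sphere_moment_1[of d] d by (simp add: sphere_moment_def)
  finally show ?thesis .
qed

text \<open>Chebyshev's inequality: the second moment of a coordinate is \<open>1 / d\<close>.\<close>
lemma threshold_square_le: "t\<^sup>2 \<le> 1 / (min p (1 - p) * real d)"
proof -
  have int: "integrable S (\<lambda>x. (x 0)\<^sup>2)" by (rule integrable_power_coordinate)
  have key: "t\<^sup>2 * measure S {x \<in> space S. P x} \<le> 1 / real d"
    if [measurable]: "Measurable.pred S P" and P: "\<And>x. P x \<Longrightarrow> t\<^sup>2 \<le> (x 0)\<^sup>2" for P
  proof -
    have "{x \<in> space S. P x} \<in> sets S" by measurable
    then have "t\<^sup>2 * measure S {x \<in> space S. P x} = (\<integral>x. t\<^sup>2 * of_bool (P x) \<partial>S)"
      using integral_of_bool[of S P] by simp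
    also have "\<dots> \<le> (\<integral>x. (x 0)\<^sup>2 \<partial>S)"
    proof (rule integral_mono[OF _ int])
      show "integrable S (\<lambda>x. t\<^sup>2 * of_bool (P x))"
        by (rule S.integrable_const_bound[of _ "t\<^sup>2"]) (simp, measurable)
      show "t\<^sup>2 * of_bool (P x) \<le> (x 0)\<^sup>2" for x using P by simp
    qed
    also have "\<dots> = 1 / real d"
      using sphere_moment_1[of d] d by (simp add: sphere_moment_def)
    finally show ?thesis .
  qed
  have "t\<^sup>2 * min p (1 - p) \<le> 1 / real d"
  proof (cases "0 \<le> t")
    case True
    have "t\<^sup>2 * min p (1 - p) \<le> t\<^sup>2 * measure S {x \<in> space S. t \<le> x 0}"
      using prob_cap by (intro mult_left_mono) auto
    also have "\<dots> \<le> 1 / real d"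
      using True by (intro key) (auto intro: power_mono)
    finally show ?thesis .
  next
    case False
    have "{x \<in> space S. t \<le> x 0} \<in> sets S" by measurable
    then have "measure S {x \<in> space S. \<not> t \<le> x 0} = 1 - p"
      using S.prob_neg[of "\<lambda>x. t \<le> x 0"] prob_cap by simp
    then have "t\<^sup>2 * min p (1 - p) \<le> t\<^sup>2 * measure S {x \<in> space S. \<not> t \<le> x 0}"
      by (intro mult_left_mono) auto
    also have "\<dots> \<le> 1 / real d"
      using False by (intro key) (auto simp: power2_le_iff_abs_le[symmetric] abs_le_square_iff[symmetric])
    finally show ?thesis .
  qed
  then show ?thesis using p d by (simp add: field_simps)
qed

text \<open>The mean of the signed triangle: its third vertex has been integrated out, leaving
  \<open>cov\<close> of the inner product of the other two.\<close>

definition triangle :: real where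
  "triangle = (\<integral>x. kernel (x 0) * cov (x 0) \<partial>S)"

lemma fourth_moment: "(\<integral>x. (x 0) ^ 4 \<partial>S) \<le> 3 / (real d)\<^sup>2"
  using sphere_moment_2_le[of d] d by (simp add: sphere_moment_def)

text \<open>
  The slope of the covariance as a function of the angle is at least the probability that the point
  projects far from the origin; the first absolute moment of \<open>x 0 - t\<close> is bounded below through its
  second and fourth moments.
\<close>
lemma triangle_ge_aux:
  assumes c: "c \<le> measure S {x \<in> space S. 2 * \<bar>t\<bar> < \<bar>x 0\<bar>}" "0 \<le> c"
    and s: "0 < s" "s \<le> 1 / 4" and t: "\<bar>t\<bar> \<le> 1 / 4"
  shows "min p (1 - p) * c / (2 * pi) * ((1 / real d) / s - 8 * (3 / (real d)\<^sup>2 + t ^ 4) / s ^ 3) \<le> triangle"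
proof -
  let ?m = "min p (1 - p)"
  let ?c = "c / (2 * pi)"
  have m: "0 \<le> ?m" using p by auto
  \<comment> \<open>The slope bound holds for angles up to \<open>2 * pi / 3\<close>, that is for
    cosines from -1/2 on. The smaller argument will be \<open>t\<close> or a point within
    \<open>s\<close> of \<open>t\<close>; the bounds 1/4 on \<open>s\<close> and
    \<open>\<bar>t\<bar>\<close> keep it in this range.\<close>
  have mono: "?c * (u - v) \<le> cov u - cov v"
    if "v \<le> u" "\<bar>v\<bar> \<le> 1 / 2" "\<bar>u\<bar> \<le> 1" for u v
  proof -
    have le: "arccos u \<le> arccos v" using that by (intro arccos_le_arccos) auto
    have "arccos v \<le> arccos (- (1/2))" using that by (intro arccos_le_arccos) auto
    also have "arccos (- (1/2)) = pi - pi / 3" by (subst arccos_minus) auto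
    finally have "arccos v \<le> 2 * pi / 3" by simp
    have "?c * (u - v) \<le> (arccos v - arccos u) / (2 * pi) * c"
    proof -
      have "(u - v) * c \<le> (arccos v - arccos u) * c"
        using abs_diff_le_arccos[of u v] le that c(2) by (intro mult_right_mono) auto
      then have "(u - v) * c / (2 * pi) \<le> (arccos v - arccos u) * c / (2 * pi)"
        by (rule divide_right_mono) simp
      then show ?thesis by (simp add: mult.commute)
    qed
    also have "\<dots> \<le> (arccos v - arccos u) / (2 * pi) * measure S {x \<in> space S. 2 * \<bar>t\<bar> < \<bar>x 0\<bar>}"
      using c(1) le by (intro mult_left_mono) auto
    also have "\<dots> \<le> cap_overlap d t (arccos u) - cap_overlap d t (arccos v)"
      using d that le \<open>arccos v \<le> 2 * pi / 3\<close> arccos_lbound[of u] arccos_ubound[of v]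
      by (intro cap_overlap_diff(3)) auto
    also have "\<dots> = cov u - cov v" using that by (simp add: cov_eq)
    finally show ?thesis .
  qed
  have weak: "0 \<le> cov u - cov v" if "v \<le> u" "\<bar>v\<bar> \<le> 1" "\<bar>u\<bar> \<le> 1" for u v
  proof -
    have "arccos u \<le> arccos v" using that by (intro arccos_le_arccos) auto
    then have "0 \<le> cap_overlap d t (arccos u) - cap_overlap d t (arccos v)"
      using d that arccos_lbound[of u] arccos_ubound[of v] by (intro cap_overlap_diff(1)) auto
    then show ?thesis using that by (simp add: cov_eq)
  qed
  have c0: "0 \<le> ?c" using c(2) by simp
  \<comment> \<open>As the kernel has mean zero, \<open>cov u\<close> may be replaced by
    \<open>cov u - cov t\<close>. Then both factors change sign at \<open>t\<close>, the product is
    nonnegative, and the points far from \<open>t\<close> may be dropped from the lower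
    bound.\<close>
  have point: "?m * ?c * ((u - t)\<^sup>2 / s - (u - t) ^ 4 / s ^ 3) \<le> kernel u * (cov u - cov t)" if u: "\<bar>u\<bar> \<le> 1" for u
  proof -
    define z where "z = \<bar>u - t\<bar>"
    have z0: "0 \<le> z" by (simp add: z_def)
    have z2: "(u - t)\<^sup>2 = z\<^sup>2" "(u - t) ^ 4 = z ^ 4" by (auto simp: z_def)
    have rhs0: "0 \<le> kernel u * (cov u - cov t)"
    proof (cases "t \<le> u")
      case True
      then show ?thesis using weak[of t u] u t p by (auto simp: kernel_def half_line_def)
    next
      case False
      then show ?thesis using weak[of u t] u t p
        by (auto simp: kernel_def half_line_def intro!: mult_nonneg_nonpos)
    qed
    \<comment> \<open>The polynomial lies below \<open>z\<close> up to \<open>s\<close> and is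
      nonpositive beyond. It lets the second and fourth moments bound a truncated first moment from
      below.\<close>
    have poly: "z\<^sup>2 / s - z ^ 4 / s ^ 3 \<le> (if z \<le> s then z else 0)"
    proof -
      define w where "w = z / s"
      have zw: "z = s * w" and w0: "0 \<le> w" using s z0 by (auto simp: w_def)
      have e: "z\<^sup>2 / s - z ^ 4 / s ^ 3 = s * (w\<^sup>2 - w ^ 4)"
        using s by (simp add: zw power_mult_distrib power2_eq_square power3_eq_cube power4_eq_xxxx field_simps)
      show ?thesis
      proof (cases "z \<le> s")
        case True
        then have "w \<le> 1" using s by (simp add: w_def)
        then have "w\<^sup>2 \<le> w" using w0 by (simp add: power2_eq_square mult_left_le)
        then have "w\<^sup>2 - w ^ 4 \<le> w" using zero_le_power[OF w0, of 4] by linarith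
        then show ?thesis using True s unfolding e by (simp add: zw)
      next
        case False
        then have "1 \<le> w" using s by (simp add: w_def)
        then have "w\<^sup>2 \<le> w ^ 4" by (intro power_increasing) auto
        then show ?thesis using False s unfolding e by (simp add: mult_nonneg_nonpos)
      qed
    qed
    show ?thesis
    proof (cases "z \<le> s")
      case True
      then have uh: "\<bar>u\<bar> \<le> 1 / 2" using s t unfolding z_def by linarith
      have "?m * ?c * (z\<^sup>2 / s - z ^ 4 / s ^ 3) \<le> ?m * ?c * z"
        using poly True by (intro mult_left_mono mult_nonneg_nonneg m c0) auto
      also have "\<dots> \<le> kernel u * (cov u - cov t)"
      proof (cases "t \<le> u")
        case tu: True
        have "z = u - t" using tu by (simp add: z_def)
        then have "?c * z \<le> cov u - cov t" using mono[OF tu] t u by simp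
        then have "?m * (?c * z) \<le> (1 - p) * (cov u - cov t)"
          using p by (intro mult_mono mult_nonneg_nonneg[OF c0 z0]) auto
        then show ?thesis using tu by (simp add: kernel_def half_line_def mult.assoc)
      next
        case tu: False
        have "z = t - u" using tu by (simp add: z_def)
        then have "?c * z \<le> cov t - cov u" using mono[of u t] t uh tu by simp
        then have "?m * (?c * z) \<le> p * (cov t - cov u)"
          using p by (intro mult_mono mult_nonneg_nonneg[OF c0 z0]) auto
        then show ?thesis using tu by (simp add: kernel_def half_line_def algebra_simps)
      qed
      finally show ?thesis by (simp add: z2)
    next
      case False
      then have "?m * ?c * (z\<^sup>2 / s - z ^ 4 / s ^ 3) \<le> 0"
        using poly by (intro mult_nonneg_nonpos mult_nonneg_nonneg m c0) auto
      then show ?thesis using rhs0 by (simp add: z2)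
    qed
  qed
  have ik: "integrable S (\<lambda>x. kernel (x 0))"
    by (intro S.integrable_const_bound[of _ 1]) (auto simp: abs_kernel_le)
  have "AE x in S. norm (kernel (x 0) * cov (x 0)) \<le> 1"
    using abs_cov_le_1 by eventually_elim (auto simp: abs_mult abs_kernel_le intro!: mult_le_one)
  then have ic: "integrable S (\<lambda>x. kernel (x 0) * cov (x 0))"
    by (rule S.integrable_const_bound) measurable
  have I: "integrable S (\<lambda>x. x 0)" "integrable S (\<lambda>x. (x 0)\<^sup>2)" "integrable S (\<lambda>x. (x 0) ^ 4)"
    using integrable_power_coordinate[of 1] integrable_power_coordinate[of 2] integrable_power_coordinate[of 4] by auto
  have "AE x in S. \<bar>(x 0 - t) ^ n\<bar> \<le> 2 ^ n" for n
    using AE_coordinate_le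
  proof eventually_elim
    case (elim x)
    then have "\<bar>x 0 - t\<bar> ^ n \<le> 2 ^ n" using t by (intro power_mono) auto
    then show ?case by (simp add: power_abs)
  qed
  then have It: "integrable S (\<lambda>x. (x 0 - t) ^ n)" for n
    by (intro S.integrable_const_bound[of _ "2 ^ n"]) auto
  have sq: "1 / real d \<le> (\<integral>x. (x 0 - t)\<^sup>2 \<partial>S)"
  proof -
    have "(\<integral>x. (x 0 - t)\<^sup>2 \<partial>S) = (\<integral>x. (x 0)\<^sup>2 - 2 * t * x 0 + t\<^sup>2 \<partial>S)"
      by (simp add: power2_diff algebra_simps)
    also have "\<dots> = (\<integral>x. (x 0)\<^sup>2 \<partial>S) + t\<^sup>2"
      using I integral_coordinate[of d] d by (simp add: S.prob_space)
    finally show ?thesis using sphere_moment_1[of d] d by (simp add: sphere_moment_def)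
  qed
  have fourth: "(\<integral>x. (x 0 - t) ^ 4 \<partial>S) \<le> 8 * (3 / (real d)\<^sup>2 + t ^ 4)"
  proof -
    have "(\<integral>x. (x 0 - t) ^ 4 \<partial>S) \<le> (\<integral>x. 8 * ((x 0) ^ 4 + t ^ 4) \<partial>S)"
    proof (intro integral_mono It)
      show "integrable S (\<lambda>x. 8 * ((x 0) ^ 4 + t ^ 4))" using I by auto
      show "(x 0 - t) ^ 4 \<le> 8 * ((x 0) ^ 4 + t ^ 4)" for x :: "nat \<Rightarrow> real"
      proof -
        have sq2: "(a - b)\<^sup>2 \<le> 2 * (a\<^sup>2 + b\<^sup>2)" for a b :: real
          using zero_le_power2[of "a + b"] by (simp add: power2_eq_square algebra_simps)
        have "(x 0 - t) ^ 4 = ((x 0 - t)\<^sup>2)\<^sup>2" by simp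
        also have "\<dots> \<le> (2 * ((x 0)\<^sup>2 + t\<^sup>2))\<^sup>2" by (intro power_mono sq2) auto
        also have "\<dots> = 4 * ((x 0)\<^sup>2 - (- t\<^sup>2))\<^sup>2" by (simp only: power_mult_distrib) simp
        also have "\<dots> \<le> 4 * (2 * (((x 0)\<^sup>2)\<^sup>2 + (- t\<^sup>2)\<^sup>2))" by (intro mult_left_mono sq2) auto
        finally show ?thesis by simp
      qed
    qed
    also have "\<dots> = 8 * ((\<integral>x. (x 0) ^ 4 \<partial>S) + t ^ 4)" using I by (simp add: S.prob_space)
    finally show ?thesis using fourth_moment by simp
  qed
  have "?m * ?c * ((1 / real d) / s - 8 * (3 / (real d)\<^sup>2 + t ^ 4) / s ^ 3) \<le>
      ?m * ?c * ((\<integral>x. (x 0 - t)\<^sup>2 \<partial>S) / s - (\<integral>x. (x 0 - t) ^ 4 \<partial>S) / s ^ 3)"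
    using s by (intro mult_left_mono diff_mono divide_right_mono sq fourth mult_nonneg_nonneg m c0) auto
  also have "\<dots> = (\<integral>x. ?m * ?c * ((x 0 - t)\<^sup>2 / s - (x 0 - t) ^ 4 / s ^ 3) \<partial>S)"
    using It by simp
  also have "\<dots> \<le> (\<integral>x. kernel (x 0) * (cov (x 0) - cov t) \<partial>S)"
  proof (rule integral_mono_AE)
    show "integrable S (\<lambda>x. kernel (x 0) * (cov (x 0) - cov t))"
      using ic ik by (simp add: right_diff_distrib)
    show "AE x in S. ?m * ?c * ((x 0 - t)\<^sup>2 / s - (x 0 - t) ^ 4 / s ^ 3) \<le> kernel (x 0) * (cov (x 0) - cov t)"
      using AE_coordinate_le by eventually_elim (rule point)
  qed (use It in auto)
  also have "\<dots> = triangle"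
    using ic ik by (simp add: right_diff_distrib triangle_def integral_kernel)
  finally show ?thesis by simp
qed

text \<open>A Taylor estimate through \<open>exp (k * z)\<close>. The linear term is kept exact
  because it integrates to zero when \<open>z\<close> is a multiple of \<open>cov\<close>; only the
  quadratic remainder is estimated.\<close>

lemma power_expansion_le:
  fixes z :: real
  assumes "\<bar>z\<bar> \<le> 1"
  shows "(1 + z) ^ k \<le> 1 + real k * z + (real k * z)\<^sup>2 * exp \<bar>real k * z\<bar>"
proof -
  define w where "w = real k * z"
  have "(1 + z) ^ k \<le> exp z ^ k" using assms by (intro power_mono) auto
  also have "\<dots> = exp w" by (simp add: w_def exp_of_nat_mult)
  also have "\<dots> \<le> 1 + w + w\<^sup>2 * exp \<bar>w\<bar>"
  proof -
    obtain v where v: "\<bar>v\<bar> \<le> \<bar>w\<bar>" "exp w = (\<Sum>m<2. w ^ m / fact m) + exp v / fact 2 * w ^ 2"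
      using Maclaurin_exp_le[of w 2] by auto
    have "exp v / 2 * w\<^sup>2 \<le> exp \<bar>w\<bar> * w\<^sup>2"
    proof (rule mult_right_mono)
      have "exp v \<le> exp \<bar>w\<bar>" using v by auto
      then show "exp v / 2 \<le> exp \<bar>w\<bar>" using exp_gt_zero[of v] by linarith
    qed simp
    then show ?thesis using v(2) by (simp add: numeral_2_eq_2 mult.commute)
  qed
  finally show ?thesis by (simp add: w_def)
qed

text \<open>The linear term integrates to zero. In the remainder
  \<open>\<bar>cov (x 0)\<bar>\<close> is at most \<open>w / (2 * sqrt d)\<close> for
  \<open>w = sqrt d * \<bar>x 0\<bar> + 1\<close>. The hypothesis on \<open>k\<close> bounds the
  exponent by \<open>w / 2\<close>, the square costs another factor \<open>exp (w / 2)\<close>, and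
  the mean of \<open>exp w\<close> is bounded independently of \<open>d\<close>.\<close>

lemma integral_cov_power_le:
  assumes b: "0 \<le> b" "b \<le> 1" and k: "real k * b \<le> sqrt (real d)"
  shows "(\<integral>x. (1 + b * cov (x 0)) ^ k \<partial>S) \<le> 1 + 4 * exp 2 * (real k * b)\<^sup>2 / real d"
proof -
  let ?q = "sqrt (real d)"
  have q: "0 < ?q" "?q\<^sup>2 = real d" using d by auto
  have cov1: "AE x in S. \<bar>b * cov (x 0)\<bar> \<le> 1"
    using abs_cov_le_1 by eventually_elim (use b in \<open>auto simp: abs_mult intro!: mult_le_one\<close>)
  have "AE x in S. (1 + b * cov (x 0)) ^ k \<le>
      1 + real k * b * cov (x 0) + 2 * (real k * b)\<^sup>2 * exp 1 / real d * exp (?q * \<bar>x 0\<bar>)"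
    using cov1 AE_coordinate_le
  proof eventually_elim
    case (elim x)
    define w where "w = ?q * \<bar>x 0\<bar> + 1"
    have w0: "0 \<le> w" by (simp add: w_def)
    have cw: "\<bar>cov (x 0)\<bar> \<le> w / (2 * ?q)"
      using abs_cov_le[OF elim(2)] q by (simp add: w_def field_simps)
    have "\<bar>real k * (b * cov (x 0))\<bar> = real k * b * \<bar>cov (x 0)\<bar>" using b by (simp add: abs_mult)
    also have "\<dots> \<le> ?q * (w / (2 * ?q))" using k cw by (intro mult_mono) auto
    also have "\<dots> = w / 2" using q by simp
    finally have e: "exp \<bar>real k * (b * cov (x 0))\<bar> \<le> exp (w / 2)" by simp
    have "(cov (x 0))\<^sup>2 \<le> (w / (2 * ?q))\<^sup>2" using cw by (metis abs_ge_zero power2_abs power_mono)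
    also have "\<dots> = w\<^sup>2 / 4 / real d" using q(2) by (simp add: power_divide power_mult_distrib)
    also have "\<dots> \<le> 2 * exp (w / 2) / real d"
    proof (rule divide_right_mono)
      have "(w/2)\<^sup>2 / 2 \<le> exp (w/2)" using exp_lower_Taylor_quadratic[of "w/2"] w0 by simp
      then show "w\<^sup>2 / 4 \<le> 2 * exp (w/2)" by (simp add: power_divide)
    qed simp
    finally have c2: "(cov (x 0))\<^sup>2 \<le> 2 * exp (w / 2) / real d" .
    have "(1 + b * cov (x 0)) ^ k \<le> 1 + real k * (b * cov (x 0)) +
        (real k * (b * cov (x 0)))\<^sup>2 * exp \<bar>real k * (b * cov (x 0))\<bar>"
      by (rule power_expansion_le[OF elim(1)])
    also have "(real k * (b * cov (x 0)))\<^sup>2 = (real k * b)\<^sup>2 * (cov (x 0))\<^sup>2"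
      by (simp add: power_mult_distrib mult.assoc)
    also have "(real k * b)\<^sup>2 * (cov (x 0))\<^sup>2 * exp \<bar>real k * (b * cov (x 0))\<bar> \<le>
        (real k * b)\<^sup>2 * (2 * exp (w / 2) / real d) * exp (w / 2)"
      using c2 e by (intro mult_mono) auto
    also have "\<dots> = 2 * (real k * b)\<^sup>2 * exp 1 / real d * exp (?q * \<bar>x 0\<bar>)"
    proof -
      have "exp (w/2) * exp (w/2) = exp 1 * exp (?q * \<bar>x 0\<bar>)"
        by (simp add: w_def add.commute flip: exp_add)
      then show ?thesis by (simp add: field_simps)
    qed
    finally show ?case by (simp add: mult.assoc)
  qed
  moreover have "integrable S (\<lambda>x. (1 + b * cov (x 0)) ^ k)"
  proof (rule S.integrable_const_bound[of _ "2 ^ k"])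
    show "AE x in S. norm ((1 + b * cov (x 0)) ^ k) \<le> 2 ^ k"
      using cov1
    proof eventually_elim
      case (elim x)
      then have "\<bar>1 + b * cov (x 0)\<bar> ^ k \<le> 2 ^ k" by (intro power_mono) auto
      then show ?case by (simp add: power_abs)
    qed
  qed measurable
  moreover have icov: "integrable S (\<lambda>x. cov (x 0))"
    using abs_cov_le_1 by (intro S.integrable_const_bound[of _ 1]) auto
  moreover have iexp: "integrable S (\<lambda>x. exp (?q * \<bar>x 0\<bar>))"
    using d by (intro integral_exp_coordinate_le(1)) auto
  ultimately have "(\<integral>x. (1 + b * cov (x 0)) ^ k \<partial>S) \<le>
      (\<integral>x. 1 + real k * b * cov (x 0) + 2 * (real k * b)\<^sup>2 * exp 1 / real d * exp (?q * \<bar>x 0\<bar>) \<partial>S)"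
    by (intro integral_mono_AE) auto
  also have "\<dots> = 1 + 2 * (real k * b)\<^sup>2 * exp 1 / real d * (\<integral>x. exp (?q * \<bar>x 0\<bar>) \<partial>S)"
    using icov iexp by (simp add: S.prob_space integral_cov)
  also have "\<dots> \<le> 1 + 2 * (real k * b)\<^sup>2 * exp 1 / real d * (2 * exp 1)"
  proof (intro add_left_mono mult_left_mono)
    have "(\<integral>x. exp (?q * \<bar>x 0\<bar>) \<partial>S) \<le> 2 * exp (?q\<^sup>2 / (2 * real d))"
      using d by (intro integral_exp_coordinate_le(2)) auto
    also have "?q\<^sup>2 / (2 * real d) = 1 / 2" using d q by simp
    also have "2 * exp (1 / 2) \<le> 2 * exp (1::real)" by simp
    finally show "(\<integral>x. exp (?q * \<bar>x 0\<bar>) \<partial>S) \<le> 2 * exp 1" .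
  qed auto
  also have "\<dots> = 1 + 4 * exp 2 * (real k * b)\<^sup>2 / real d"
    using exp_add[of 1 "1::real"] by simp
  finally show ?thesis .
qed

end

lemma spherical_cap_threshold: "3 \<le> d \<Longrightarrow> 0 < p \<Longrightarrow> p < 1 \<Longrightarrow> spherical_cap d p (threshold p d)"
  by unfold_locales (auto intro: threshold_prob)

lemma triangle_lower_bound:
  assumes p: "0 < p" "p < 1"
  obtains c N where "0 < c" "3 \<le> N"
    "\<And>d. N \<le> d \<Longrightarrow> c / sqrt (real d) \<le> spherical_cap.triangle d p (threshold p d)"
proof -
  define m where "m = min p (1 - p)"
  have m: "0 < m" using p by (simp add: m_def)
  \<comment> \<open>The threshold satisfies \<open>t\<^sup>2 \<le> C / d\<close>, so a coordinate
    with square above \<open>4 * C / d\<close> exceeds \<open>2 * \<bar>t\<bar>\<close> in absolute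
    value.\<close>
  define C where "C = 1 / m"
  have C: "0 < C" using m by (simp add: C_def)
  obtain c N where c: "0 < c" and N: "\<And>d. N \<le> d \<Longrightarrow>
      c \<le> measure (uniform_sphere d) {x \<in> space (uniform_sphere d). (4 * C) / real d < (x 0)\<^sup>2}"
    using coordinate_tail[of "4 * C"] C by auto
  \<comment> \<open>The truncation level will be \<open>s = A / sqrt d\<close>, with main term
    \<open>1 / (A * sqrt d)\<close>. This value of \<open>A\<close> makes the bound for the
    fourth-moment correction exactly half of it.\<close>
  define A where "A = sqrt (16 * (3 + C\<^sup>2))"
  have A2: "A\<^sup>2 = 16 * (3 + C\<^sup>2)" and A: "0 < A" using C by (auto simp: A_def add_pos_nonneg)
  \<comment> \<open>Large enough for the truncation level and the threshold to be at most
    1/4.\<close>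
  define M where "M = max (max 3 N) (nat \<lceil>max (16 * A\<^sup>2) (16 * C)\<rceil>)"
  show ?thesis
  proof (rule that[of "m * c / (4 * pi * A)" M])
    show "0 < m * c / (4 * pi * A)" using m c A by simp
    show "3 \<le> M" by (simp add: M_def)
    fix d assume "M \<le> d"
    then have d3: "3 \<le> d" and dN: "N \<le> d" and "max (16 * A\<^sup>2) (16 * C) \<le> real d"
      by (auto simp: M_def nat_ceiling_le_eq)
    then have dA: "16 * A\<^sup>2 \<le> real d" and dC: "16 * C \<le> real d" by auto
    define t where "t = threshold p d"
    interpret spherical_cap d p t unfolding t_def by (rule spherical_cap_threshold[OF d3 p])
    have d0: "0 < real d" using d by simp
    have t2: "t\<^sup>2 \<le> C / real d"
      using threshold_square_le by (simp add: C_def m_def)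
    have "C / real d \<le> (1 / 4)\<^sup>2" using dC d0 by (simp add: field_simps power2_eq_square)
    then have "\<bar>t\<bar>\<^sup>2 \<le> (1 / 4)\<^sup>2" using t2 by simp
    then have t4: "\<bar>t\<bar> \<le> 1 / 4" by (rule power2_le_imp_le) simp
    have "c \<le> measure S {x \<in> space S. (4 * C) / real d < (x 0)\<^sup>2}" using N dN by simp
    also have "\<dots> \<le> measure S {x \<in> space S. 2 * \<bar>t\<bar> < \<bar>x 0\<bar>}"
    proof (rule S.finite_measure_mono)
      show "{x \<in> space S. (4 * C) / real d < (x 0)\<^sup>2} \<subseteq> {x \<in> space S. 2 * \<bar>t\<bar> < \<bar>x 0\<bar>}"
      proof safe
        fix x :: "nat \<Rightarrow> real" assume "(4 * C) / real d < (x 0)\<^sup>2"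
        then have "(2 * \<bar>t\<bar>)\<^sup>2 < \<bar>x 0\<bar>\<^sup>2" using t2 by (simp add: power_mult_distrib)
        then show "2 * \<bar>t\<bar> < \<bar>x 0\<bar>" by (rule power2_less_imp_less) simp
      qed
    qed measurable
    finally have tail: "c \<le> measure S {x \<in> space S. 2 * \<bar>t\<bar> < \<bar>x 0\<bar>}" .
    let ?q = "sqrt (real d)"
    have q: "0 < ?q" "?q\<^sup>2 = real d" using d0 by auto
    have "(4 * A)\<^sup>2 \<le> ?q\<^sup>2" using dA q by (simp add: power_mult_distrib)
    then have "4 * A \<le> ?q" by (rule power2_le_imp_le) simp
    then have s: "A / ?q \<le> 1 / 4" using q by (simp add: field_simps)
    have low: "m * c / (2 * pi) * ((1 / real d) / (A / ?q) - 8 * (3 / (real d)\<^sup>2 + t ^ 4) / (A / ?q) ^ 3) \<le> triangle"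
      unfolding m_def by (rule triangle_ge_aux[OF tail]) (use c A q s t4 in auto)
    have "t ^ 4 = (t\<^sup>2)\<^sup>2" by simp
    also have "\<dots> \<le> (C / real d)\<^sup>2" using t2 by (intro power_mono) auto
    finally have "3 / (real d)\<^sup>2 + t ^ 4 \<le> (3 + C\<^sup>2) / (real d)\<^sup>2"
      by (simp add: power_divide add_divide_distrib)
    then have "8 * (3 / (real d)\<^sup>2 + t ^ 4) / (A / ?q) ^ 3 \<le> 8 * ((3 + C\<^sup>2) / (real d)\<^sup>2) / (A / ?q) ^ 3"
      using A q by (intro divide_right_mono mult_left_mono) auto
    also have "8 * ((3 + C\<^sup>2) / (real d)\<^sup>2) = A\<^sup>2 / 2 / (?q\<^sup>2)\<^sup>2" using A2 q by (simp add: add_divide_distrib)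
    also have "A\<^sup>2 / 2 / (?q\<^sup>2)\<^sup>2 / (A / ?q) ^ 3 = 1 / (2 * A * ?q)"
    proof -
      have "x\<^sup>2 / 2 / (y\<^sup>2)\<^sup>2 / (x / y) ^ 3 = 1 / (2 * x * y)" if "0 < x" "0 < y" for x y :: real
        using that by (simp add: field_simps power2_eq_square power3_eq_cube)
      then show ?thesis using A q(1) by blast
    qed
    finally have "1 / (2 * A * ?q) \<le> (1 / real d) / (A / ?q) - 8 * (3 / (real d)\<^sup>2 + t ^ 4) / (A / ?q) ^ 3"
    proof -
      assume *: "8 * (3 / (real d)\<^sup>2 + t ^ 4) / (A / ?q) ^ 3 \<le> 1 / (2 * A * ?q)"
      have "(1 / real d) / (A / ?q) = 1 / (A * ?q)"
      proof -
        have "(1 / y\<^sup>2) / (x / y) = 1 / (x * y)" if "0 < x" "0 < y" for x y :: real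
          using that by (simp add: field_simps power2_eq_square)
        from this[OF A q(1)] show ?thesis by (simp only: q(2))
      qed
      also have "\<dots> = 1 / (2 * A * ?q) + 1 / (2 * A * ?q)" by simp
      finally show ?thesis using * by linarith
    qed
    then have "m * c / (2 * pi) * (1 / (2 * A * ?q)) \<le> triangle"
      using m c by (intro order_trans[OF mult_left_mono low]) auto
    then show "m * c / (4 * pi * A) / sqrt (real d) \<le> spherical_cap.triangle d p (threshold p d)"
      by (simp add: t_def mult.assoc)
  qed
qed

section \<open>Products of kernels\<close>

context spherical_cap
begin

abbreviation "points I \<equiv> \<Pi>\<^sub>M i\<in>I. S"

sublocale points: product_prob_space "\<lambda>_::nat. S" UNIV ..

lemma prob_space_points: "prob_space (points I)"
  by (rule prob_space_PiM) (rule prob_space_uniform_sphere)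

lemma component_measurable: "i \<in> I \<Longrightarrow> (\<lambda>x. x i) \<in> measurable (points I) S"
  by (rule measurable_component_singleton)

lemma update_measurable:
  assumes "a \<in> I"
  shows "(\<lambda>z. (fst z)(a := snd z)) \<in> measurable (points I \<Otimes>\<^sub>M S) (points I)"
  using measurable_add_dim[of a I "\<lambda>_. S"] assms by (simp add: insert_absorb case_prod_beta')

text \<open>Replacing one coordinate by a fresh independent point does not change the mean. The
  index set stays \<open>I\<close>, so vertices can be integrated out one after another on the same
  space.\<close>

lemma integral_resample:
  fixes F :: "(nat \<Rightarrow> nat \<Rightarrow> real) \<Rightarrow> real"
  assumes I: "finite I" "a \<in> I" and F: "F \<in> borel_measurable (points I)" "\<And>x. \<bar>F x\<bar> \<le> B"
  shows "(\<integral>x. F x \<partial>points I) = (\<integral>x. (\<integral>y. F (x(a := y)) \<partial>S) \<partial>points I)"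
proof -
  interpret P: prob_space "points I" by (rule prob_space_points)
  have J: "finite (I - {a})" "a \<notin> I - {a}" "insert a (I - {a}) = I" using I by auto
  have [measurable]: "(\<lambda>z. F ((fst z)(a := snd z))) \<in> borel_measurable (points I \<Otimes>\<^sub>M S)"
    by (rule measurable_compose[OF update_measurable[OF I(2)] F(1)])
  have Gm: "(\<lambda>x. \<integral>y. F (x(a := y)) \<partial>S) \<in> borel_measurable (points I)" by measurable
  have "\<bar>\<integral>y. F (x(a := y)) \<partial>S\<bar> \<le> B" for x
  proof -
    have "0 \<le> B" using F(2)[of undefined] by linarith
    then show ?thesis
    proof (cases "integrable S (\<lambda>y. F (x(a := y)))")
      case True
      have "\<bar>\<integral>y. F (x(a := y)) \<partial>S\<bar> \<le> (\<integral>y. \<bar>F (x(a := y))\<bar> \<partial>S)" by (rule integral_abs_bound)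
      also have "\<dots> \<le> (\<integral>y. B \<partial>S)" using True F(2) by (intro integral_mono) auto
      finally show ?thesis by (simp add: S.prob_space)
    qed (simp add: not_integrable_integral_eq)
  qed
  then have G: "integrable (points I) (\<lambda>x. \<integral>y. F (x(a := y)) \<partial>S)"
    using Gm by (intro P.integrable_const_bound[of _ B]) auto
  have Fi: "integrable (points I) F"
    using F by (intro P.integrable_const_bound[of _ B]) auto
  have "(\<integral>x. F x \<partial>points I) = (\<integral>x. (\<integral>y. F (x(a := y)) \<partial>S) \<partial>points (I - {a}))"
    using points.product_integral_insert[OF J(1,2), of F] Fi J(3) by simp
  moreover have "(\<integral>x. (\<integral>y. F (x(a := y)) \<partial>S) \<partial>points I) =
      (\<integral>x. (\<integral>z. (\<integral>y. F (x(a := z, a := y)) \<partial>S) \<partial>S) \<partial>points (I - {a}))"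
    using points.product_integral_insert[OF J(1,2), of "\<lambda>x. \<integral>y. F (x(a := y)) \<partial>S"] G J(3) by simp
  ultimately show ?thesis by (simp add: S.prob_space)
qed

text \<open>Removes the vertex \<open>a\<close> from a product in which only the factor
  \<open>H\<close> involves it. The partial integral is required to equal \<open>h\<close> almost
  everywhere, since formulas such as \<open>integral_kern_ccov\<close> are stated at unit
  vectors.\<close>

lemma integrate_out:
  fixes G H h :: "(nat \<Rightarrow> nat \<Rightarrow> real) \<Rightarrow> real"
  assumes I: "finite I" "a \<in> I"
    and G: "G \<in> borel_measurable (points I)" "\<And>x. \<bar>G x\<bar> \<le> B" "\<And>x y. G (x(a := y)) = G x"
    and H: "H \<in> borel_measurable (points I)" "\<And>x. \<bar>H x\<bar> \<le> C"
    and h: "h \<in> borel_measurable (points I)" "AE x in points I. (\<integral>y. H (x(a := y)) \<partial>S) = h x"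
  shows "(\<integral>x. G x * H x \<partial>points I) = (\<integral>x. G x * h x \<partial>points I)"
proof -
  have "0 \<le> B" using G(2)[of undefined] by linarith
  then have "(\<integral>x. G x * H x \<partial>points I) = (\<integral>x. (\<integral>y. G (x(a := y)) * H (x(a := y)) \<partial>S) \<partial>points I)"
    using G H I by (intro integral_resample[of _ _ _ "B * C"]) (auto simp: abs_mult intro!: mult_mono)
  also have "\<dots> = (\<integral>x. G x * (\<integral>y. H (x(a := y)) \<partial>S) \<partial>points I)"
    by (simp add: G(3))
  also have "\<dots> = (\<integral>x. G x * h x \<partial>points I)"
  proof (rule integral_cong_AE)
    have [measurable]: "(\<lambda>z. H ((fst z)(a := snd z))) \<in> borel_measurable (points I \<Otimes>\<^sub>M S)"
      by (rule measurable_compose[OF update_measurable[OF I(2)] H(1)])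
    show "(\<lambda>x. G x * (\<integral>y. H (x(a := y)) \<partial>S)) \<in> borel_measurable (points I)"
      using G(1) by measurable
    show "(\<lambda>x. G x * h x) \<in> borel_measurable (points I)" using G(1) h(1) by measurable
    show "AE x in points I. G x * (\<integral>y. H (x(a := y)) \<partial>S) = G x * h x"
      using h(2) by eventually_elim simp
  qed
  finally show ?thesis .
qed

definition kern :: "(nat \<Rightarrow> nat \<Rightarrow> real) \<Rightarrow> nat \<Rightarrow> nat \<Rightarrow> real" where
  "kern x i j = kernel (dot d (x i) (x j))"

definition ccov :: "(nat \<Rightarrow> nat \<Rightarrow> real) \<Rightarrow> nat \<Rightarrow> nat \<Rightarrow> real" where
  "ccov x i j = cap_cov (x i) (x j)"

lemma kern_commute: "kern x i j = kern x j i"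
  by (simp add: kern_def dot_commute)

lemma abs_kern_le: "\<bar>kern x i j\<bar> \<le> 1"
  by (simp add: kern_def abs_kernel_le)

lemma abs_ccov_le: "\<bar>ccov x i j\<bar> \<le> 1"
  by (simp add: ccov_def abs_cap_cov_le)

lemma dot_component_measurable:
  assumes "i \<in> I" "j \<in> I"
  shows "(\<lambda>x. dot d (x i) (x j)) \<in> borel_measurable (points I)"
proof -
  have "(\<lambda>x. x i) \<in> measurable (points I) (borel_space d)" "(\<lambda>x. x j) \<in> measurable (points I) (borel_space d)"
    using component_measurable assms by (simp_all cong: measurable_cong_sets)
  then show ?thesis by (rule borel_measurable_dot)
qed

lemma kern_measurable: "i \<in> I \<Longrightarrow> j \<in> I \<Longrightarrow> (\<lambda>x. kern x i j) \<in> borel_measurable (points I)"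
  unfolding kern_def by (rule measurable_compose[OF dot_component_measurable kernel_measurable])

lemma ccov_measurable: "i \<in> I \<Longrightarrow> j \<in> I \<Longrightarrow> (\<lambda>x. ccov x i j) \<in> borel_measurable (points I)"
  unfolding ccov_def by (intro cap_cov_measurable component_measurable)

lemma AE_points_unit: "i \<in> I \<Longrightarrow> AE x in points I. enorm d (x i) = 1"
  using AE_PiM_component[of I "\<lambda>_. S" i "\<lambda>y. enorm d y = 1"] prob_space_uniform_sphere AE_unit by simp

lemma integral_kern_kern:
  assumes "a \<noteq> c" "b \<noteq> c"
  shows "(\<integral>y. kern (x(c := y)) a c * kern (x(c := y)) b c \<partial>S) = ccov x a b"
  using assms by (simp add: kern_def ccov_def cap_cov_def dot_commute)

lemma integral_kern_ccov:
  assumes "a \<noteq> b" "enorm d (x a) = 1"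
  shows "(\<integral>y. kern (x(b := y)) a b * ccov (x(b := y)) a b \<partial>S) = triangle"
proof -
  have "(\<integral>y. kern (x(b := y)) a b * ccov (x(b := y)) a b \<partial>S) = (\<integral>y. kernel (dot d y (x a)) * cov (dot d y (x a)) \<partial>S)"
  proof (rule integral_cong_AE)
    show "AE y in S. kern (x(b := y)) a b * ccov (x(b := y)) a b = kernel (dot d y (x a)) * cov (dot d y (x a))"
      using AE_unit
    proof eventually_elim
      case (elim y)
      then show ?case using assms by (simp add: kern_def ccov_def cap_cov_eq dot_commute)
    qed
    have cm: "(\<lambda>y. cap_cov (x a) y) \<in> borel_measurable S"
    proof -
      have "(\<lambda>y. cap_cov (x a) y) = (\<lambda>y. \<integral>z. kernel (dot d z (x a)) * kernel (dot d z y) \<partial>S)"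
        by (simp add: cap_cov_def[abs_def])
      also have "\<dots> \<in> borel_measurable S"
      proof (rule S.borel_measurable_lebesgue_integral)
        have "(\<lambda>w. dot d (snd w) (x a)) \<in> borel_measurable (S \<Otimes>\<^sub>M S)"
          by (rule measurable_compose[OF measurable_snd dot_const_measurable(1)])
        moreover have "(\<lambda>w. dot d (snd w) (fst w)) \<in> borel_measurable (S \<Otimes>\<^sub>M S)" by measurable
        ultimately show "(\<lambda>(y, z). kernel (dot d z (x a)) * kernel (dot d z y)) \<in> borel_measurable (S \<Otimes>\<^sub>M S)"
          unfolding case_prod_beta' by (intro borel_measurable_times measurable_compose[OF _ kernel_measurable])
      qed
      finally show ?thesis .
    qed
    show "(\<lambda>y. kern (x(b := y)) a b * ccov (x(b := y)) a b) \<in> borel_measurable S"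
      using assms(1) unfolding kern_def ccov_def
      by (simp, intro borel_measurable_times cm measurable_compose[OF dot_const_measurable(2) kernel_measurable])
  qed measurable
  also have "\<dots> = triangle"
    unfolding triangle_def by (rule integral_dot_measurable[OF assms(2)]) measurable
  finally show ?thesis .
qed

lemma integral_ccov_squared:
  assumes "a \<noteq> b" "finite I" "a \<in> I" "b \<in> I"
  shows "(\<integral>x. (ccov x a b)\<^sup>2 \<partial>points I) \<le> 1 / real d"
proof -
  interpret P: prob_space "points I" by (rule prob_space_points)
  have "(\<integral>x. 1 * (ccov x a b)\<^sup>2 \<partial>points I) = (\<integral>x. 1 * (\<integral>z. (cov (z 0))\<^sup>2 \<partial>S) \<partial>points I)"
  proof (rule integrate_out[of I b _ 1 _ 1])
    show "AE x in points I. (\<integral>y. (ccov (x(b := y)) a b)\<^sup>2 \<partial>S) = (\<integral>z. (cov (z 0))\<^sup>2 \<partial>S)"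
      using AE_points_unit[OF assms(3)]
    proof eventually_elim
      case (elim x)
      have "(\<integral>y. (ccov (x(b := y)) a b)\<^sup>2 \<partial>S) = (\<integral>y. (cap_cov y (x a))\<^sup>2 \<partial>S)"
        using assms(1) by (simp add: ccov_def cap_cov_def mult.commute)
      also have "\<dots> = (\<integral>y. (cov (dot d y (x a)))\<^sup>2 \<partial>S)"
      proof (rule integral_cong_AE)
        show "AE y in S. (cap_cov y (x a))\<^sup>2 = (cov (dot d y (x a)))\<^sup>2"
          using AE_cov_dot[OF elim] by eventually_elim simp
        have "(\<lambda>w. dot d (snd w) (x a)) \<in> borel_measurable (S \<Otimes>\<^sub>M S)"
          by (rule measurable_compose[OF measurable_snd dot_const_measurable(1)])
        moreover have "(\<lambda>w. dot d (snd w) (fst w)) \<in> borel_measurable (S \<Otimes>\<^sub>M S)" by measurable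
        ultimately have "(\<lambda>(y, z). kernel (dot d z y) * kernel (dot d z (x a))) \<in> borel_measurable (S \<Otimes>\<^sub>M S)"
          unfolding case_prod_beta' by (intro borel_measurable_times measurable_compose[OF _ kernel_measurable])
        then have "(\<lambda>y. cap_cov y (x a)) \<in> borel_measurable S"
          unfolding cap_cov_def by (rule S.borel_measurable_lebesgue_integral)
        then show "(\<lambda>y. (cap_cov y (x a))\<^sup>2) \<in> borel_measurable S" by measurable
      qed measurable
      also have "\<dots> = (\<integral>z. (cov (z 0))\<^sup>2 \<partial>S)"
        by (rule integral_dot_measurable[OF elim, of "\<lambda>u. (cov u)\<^sup>2"]) measurable
      finally show ?case .
    qed
  qed (use assms ccov_measurable[of a I b] abs_ccov_le in \<open>auto simp: abs_square_le_1\<close>)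
  also have "\<dots> \<le> 1 / real d" using integral_cov_squared_le by (simp add: P.prob_space)
  finally show ?thesis by simp
qed

lemmas bounded_product_simps = abs_mult mult_le_one abs_kern_le abs_ccov_le

lemma integral_two_triangles:
  assumes I: "finite I" "{a, b, c, a', b', c'} \<subseteq> I" and dist: "distinct [b, c, b', c']"
    and a: "a \<notin> {b, c, b', c'}" "a' \<notin> {b, c, b', c'}"
  shows "(\<integral>x. (kern x a b * kern x a c * kern x b c) * (kern x a' b' * kern x a' c' * kern x b' c') \<partial>points I) = triangle\<^sup>2"
proof -
  interpret P: prob_space "points I" by (rule prob_space_points)
  have in_I: "a \<in> I" "b \<in> I" "c \<in> I" "a' \<in> I" "b' \<in> I" "c' \<in> I" using I by auto
  note meas = kern_measurable ccov_measurable borel_measurable_times borel_measurable_const in_I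
  have "(\<integral>x. (kern x a b * kern x a c * kern x b c) * (kern x a' b' * kern x a' c' * kern x b' c') \<partial>points I) =
    (\<integral>x. (kern x a b * (kern x a' b' * kern x a' c' * kern x b' c')) * (kern x a c * kern x b c) \<partial>points I)"
    by (simp add: mult_ac)
  also have "\<dots> = (\<integral>x. (kern x a b * (kern x a' b' * kern x a' c' * kern x b' c')) * ccov x a b \<partial>points I)"
    by (rule integrate_out[of I c _ 1 _ 1]; (intro meas | use I dist a in \<open>auto simp: bounded_product_simps integral_kern_kern\<close>))
      (use dist a in \<open>auto simp: kern_def\<close>)
  also have "\<dots> = (\<integral>x. (kern x a b * ccov x a b * kern x a' b') * (kern x a' c' * kern x b' c') \<partial>points I)"
    by (simp add: mult_ac)
  also have "\<dots> = (\<integral>x. (kern x a b * ccov x a b * kern x a' b') * ccov x a' b' \<partial>points I)"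
    by (rule integrate_out[of I c' _ 1 _ 1]; (intro meas | use I dist a in \<open>auto simp: bounded_product_simps integral_kern_kern\<close>))
      (use dist a in \<open>auto simp: kern_def ccov_def\<close>)
  also have "\<dots> = (\<integral>x. (kern x a' b' * ccov x a' b') * (kern x a b * ccov x a b) \<partial>points I)"
    by (simp add: mult_ac)
  also have "\<dots> = (\<integral>x. (kern x a' b' * ccov x a' b') * triangle \<partial>points I)"
  proof -
    have ae: "AE x in points I. (\<integral>y. kern (x(b := y)) a b * ccov (x(b := y)) a b \<partial>S) = triangle"
      using AE_points_unit[OF in_I(1)] by eventually_elim (use a in \<open>auto intro: integral_kern_ccov\<close>)
    show ?thesis
      by (rule integrate_out[of I b _ 1 _ 1, OF _ _ _ _ _ _ _ _ ae];
          (intro meas | use I dist a in \<open>auto simp: bounded_product_simps\<close>))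
        (use dist a in \<open>auto simp: kern_def ccov_def\<close>)?
  qed
  also have "\<dots> = (\<integral>x. triangle * (kern x a' b' * ccov x a' b') \<partial>points I)"
    by (simp add: mult_ac)
  also have "\<dots> = (\<integral>x. triangle * triangle \<partial>points I)"
  proof -
    have ae: "AE x in points I. (\<integral>y. kern (x(b' := y)) a' b' * ccov (x(b' := y)) a' b' \<partial>S) = triangle"
      using AE_points_unit[OF in_I(4)] by eventually_elim (use a in \<open>auto intro: integral_kern_ccov\<close>)
    show ?thesis
      by (rule integrate_out[of I b' _ "\<bar>triangle\<bar>" _ 1, OF _ _ _ _ _ _ _ _ ae];
          (intro meas | use I dist a in \<open>auto simp: bounded_product_simps\<close>))
        (use dist a in \<open>auto simp: kern_def ccov_def\<close>)?
  qed
  also have "\<dots> = triangle\<^sup>2" by (simp add: P.prob_space power2_eq_square)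
  finally show ?thesis .
qed

lemma integral_one_triangle:
  assumes I: "finite I" "{a, b, c} \<subseteq> I" and dist: "distinct [a, b, c]"
  shows "(\<integral>x. kern x a b * kern x a c * kern x b c \<partial>points I) = triangle"
proof -
  interpret P: prob_space "points I" by (rule prob_space_points)
  have in_I: "a \<in> I" "b \<in> I" "c \<in> I" using I by auto
  note meas = kern_measurable ccov_measurable borel_measurable_times borel_measurable_const in_I
  have "(\<integral>x. kern x a b * kern x a c * kern x b c \<partial>points I) =
    (\<integral>x. kern x a b * (kern x a c * kern x b c) \<partial>points I)"
    by (simp add: mult_ac)
  also have "\<dots> = (\<integral>x. kern x a b * ccov x a b \<partial>points I)"
    by (rule integrate_out[of I c _ 1 _ 1]; (intro meas | use I dist in \<open>auto simp: bounded_product_simps integral_kern_kern\<close>))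
      (use dist in \<open>auto simp: kern_def\<close>)
  also have "\<dots> = (\<integral>x. 1 * (kern x a b * ccov x a b) \<partial>points I)" by simp
  also have "\<dots> = (\<integral>x. 1 * triangle \<partial>points I)"
  proof -
    have ae: "AE x in points I. (\<integral>y. kern (x(b := y)) a b * ccov (x(b := y)) a b \<partial>S) = triangle"
      using AE_points_unit[OF in_I(1)] by eventually_elim (use dist in \<open>auto intro: integral_kern_ccov\<close>)
    show ?thesis
      by (rule integrate_out[of I b _ 1 _ 1, OF _ _ _ _ _ _ _ _ ae];
          (intro meas | use I dist dist in \<open>auto simp: bounded_product_simps\<close>))
        (use dist dist in \<open>auto simp: kern_def ccov_def\<close>)?
  qed
  finally show ?thesis by (simp add: P.prob_space)
qed

text \<open>Each of the free vertices \<open>c\<close> and \<open>c'\<close> leaves a factor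
  \<open>ccov x a b\<close>, and the second moment of the covariance remains. The affine factor
  stands for the second moment of the centred common edge given the points.\<close>

lemma integral_shared_edge:
  assumes I: "finite I" "{a, b, c, c'} \<subseteq> I" and dist: "distinct [a, b, c, c']"
    and v: "\<And>x. \<bar>r + s * kern x a b\<bar> \<le> 1"
  shows "(\<integral>x. (r + s * kern x a b) * ((kern x a c * kern x b c) * (kern x a c' * kern x b c')) \<partial>points I) \<le> 1 / real d"
proof -
  interpret P: prob_space "points I" by (rule prob_space_points)
  have in_I: "a \<in> I" "b \<in> I" "c \<in> I" "c' \<in> I" using I by auto
  note meas = kern_measurable ccov_measurable borel_measurable_times borel_measurable_add borel_measurable_const in_I
  let ?v = "\<lambda>x. r + s * kern x a b"
  have "(\<integral>x. ?v x * ((kern x a c * kern x b c) * (kern x a c' * kern x b c')) \<partial>points I) =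
    (\<integral>x. (?v x * (kern x a c' * kern x b c')) * (kern x a c * kern x b c) \<partial>points I)"
    by (simp add: mult_ac)
  also have "\<dots> = (\<integral>x. (?v x * (kern x a c' * kern x b c')) * ccov x a b \<partial>points I)"
    by (rule integrate_out[of I c _ 1 _ 1]; (intro meas | use I dist v in \<open>auto simp: bounded_product_simps integral_kern_kern\<close>))
      (use dist in \<open>auto simp: kern_def\<close>)
  also have "\<dots> = (\<integral>x. (?v x * ccov x a b) * (kern x a c' * kern x b c') \<partial>points I)"
    by (simp add: mult_ac)
  also have "\<dots> = (\<integral>x. (?v x * ccov x a b) * ccov x a b \<partial>points I)"
    by (rule integrate_out[of I c' _ 1 _ 1]; (intro meas | use I dist v in \<open>auto simp: bounded_product_simps integral_kern_kern\<close>))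
      (use dist in \<open>auto simp: kern_def ccov_def\<close>)
  also have "\<dots> \<le> (\<integral>x. (ccov x a b)\<^sup>2 \<partial>points I)"
  proof (rule integral_mono)
    have "\<bar>(?v x * ccov x a b) * ccov x a b\<bar> \<le> 1" for x
      using v[of x] by (auto simp: bounded_product_simps)
    then show "integrable (points I) (\<lambda>x. (?v x * ccov x a b) * ccov x a b)"
      by (intro P.integrable_const_bound[of _ 1] meas) auto
    show "integrable (points I) (\<lambda>x. (ccov x a b)\<^sup>2)"
    proof (rule P.integrable_const_bound[of _ 1])
      show "AE x in points I. norm ((ccov x a b)\<^sup>2) \<le> 1" by (simp add: abs_square_le_1 abs_ccov_le)
    qed (unfold power2_eq_square, intro meas)
    show "(?v x * ccov x a b) * ccov x a b \<le> (ccov x a b)\<^sup>2" for x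
    proof -
      have "?v x * (ccov x a b)\<^sup>2 \<le> 1 * (ccov x a b)\<^sup>2"
        using v[of x] by (intro mult_right_mono) auto
      then show ?thesis by (simp add: power2_eq_square mult.assoc)
    qed
  qed
  also have "\<dots> \<le> 1 / real d" using I dist by (intro integral_ccov_squared) auto
  finally show ?thesis .
qed

end

section \<open>Independent edges\<close>

definition edge_weight :: "'e set \<Rightarrow> ('e \<Rightarrow> real) \<Rightarrow> 'e set \<Rightarrow> real" where
  "edge_weight V w X = (\<Prod>e\<in>X. w e) * (\<Prod>e\<in>V - X. 1 - w e)"

lemma prod_if_member:
  assumes "finite V" "X \<subseteq> V"
  shows "(\<Prod>e\<in>V. if e \<in> X then f e else g e) = (\<Prod>e\<in>X. f e) * (\<Prod>e\<in>V - X. g e)"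
proof -
  have "V \<inter> {e. e \<in> X} = X" "V \<inter> - {e. e \<in> X} = V - X" using assms(2) by auto
  then show ?thesis using assms(1) by (simp add: prod.If_cases)
qed

text \<open>Independence of the edges as an algebraic identity: expanding the product over
  \<open>V\<close> amounts to choosing for each edge whether it is present.\<close>

lemma sum_edge_weight_prod:
  assumes "finite V"
  shows "(\<Sum>X\<in>Pow V. edge_weight V w X * (\<Prod>e\<in>V. if e \<in> X then f e else g e)) =
    (\<Prod>e\<in>V. w e * f e + (1 - w e) * g e)"
  unfolding prod_add[OF assms]
  by (intro sum.cong refl)
    (auto simp: edge_weight_def prod_if_member[OF assms] prod.distrib mult_ac)

lemma sum_edge_weight: "finite V \<Longrightarrow> (\<Sum>X\<in>Pow V. edge_weight V w X) = 1"
  using sum_edge_weight_prod[of V w "\<lambda>_. 1" "\<lambda>_. 1"] by simp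

lemma edge_weight_nonneg:
  assumes "X \<subseteq> V" "\<And>e. e \<in> V \<Longrightarrow> 0 \<le> w e \<and> w e \<le> 1"
  shows "0 \<le> edge_weight V w X"
  using assms unfolding edge_weight_def by (intro mult_nonneg_nonneg prod_nonneg) auto

lemma edge_weight_le_1:
  assumes "finite V" "X \<subseteq> V" "\<And>e. e \<in> V \<Longrightarrow> 0 \<le> w e \<and> w e \<le> 1"
  shows "edge_weight V w X \<le> 1"
proof -
  have "edge_weight V w X \<le> (\<Sum>X\<in>Pow V. edge_weight V w X)"
    using assms by (intro member_le_sum) (auto intro: edge_weight_nonneg)
  then show ?thesis using sum_edge_weight[OF assms(1)] by simp
qed

lemma edge_weight_insert_disjoint:
  assumes "finite V" "finite W" "V \<inter> W = {}" "X \<subseteq> V" "Y \<subseteq> W"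
  shows "edge_weight (V \<union> W) w (X \<union> Y) = edge_weight V w X * edge_weight W w Y"
proof -
  have "(V \<union> W) - (X \<union> Y) = (V - X) \<union> (W - Y)" using assms by auto
  moreover have "X \<inter> Y = {}" "(V - X) \<inter> (W - Y) = {}" using assms by auto
  moreover have "finite X" "finite Y" using finite_subset[OF assms(4,1)] finite_subset[OF assms(5,2)] by auto
  ultimately show ?thesis
    using assms by (simp add: edge_weight_def prod.union_disjoint mult_ac)
qed

text \<open>The mean factorises over the edges. An edge in just one of the sets contributes
  \<open>w e - p\<close>; a common edge contributes
  \<open>w e * (1 - p)\<^sup>2 + (1 - w e) * p\<^sup>2\<close>, written as a deviation from
  \<open>p * (1 - p)\<close>.\<close>

lemma sum_edge_weight_centred:
  fixes p :: real
  assumes V: "finite V" "E \<subseteq> V" "F \<subseteq> V"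
  shows "(\<Sum>X\<in>Pow V. edge_weight V w X * ((\<Prod>e\<in>E. of_bool (e \<in> X) - p) * (\<Prod>e\<in>F. of_bool (e \<in> X) - p))) =
    (\<Prod>e\<in>E \<inter> F. p * (1 - p) + (1 - 2 * p) * (w e - p)) * ((\<Prod>e\<in>E - F. w e - p) * (\<Prod>e\<in>F - E. w e - p))"
proof -
  \<comment> \<open>The value \<open>c\<close> raised to the number of sets among \<open>E\<close>
    and \<open>F\<close> that contain \<open>e\<close>.\<close>
  let ?m = "\<lambda>c e. (if e \<in> E then c else 1) * (if e \<in> F then c else 1)"
  have pr: "(\<Prod>e\<in>G. h e) = (\<Prod>e\<in>V. if e \<in> G then h e else 1)" if "G \<subseteq> V" for G and h :: "'a \<Rightarrow> real"
    using prod_if_member[OF V(1) that, of h "\<lambda>_. 1"] by simp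
  have "(\<Sum>X\<in>Pow V. edge_weight V w X * ((\<Prod>e\<in>E. of_bool (e \<in> X) - p) * (\<Prod>e\<in>F. of_bool (e \<in> X) - p))) =
    (\<Sum>X\<in>Pow V. edge_weight V w X * (\<Prod>e\<in>V. if e \<in> X then ?m (1 - p) e else ?m (- p) e))"
    unfolding pr[OF V(2)] pr[OF V(3)] prod.distrib[symmetric]
    by (intro sum.cong refl arg_cong2[where f = "(*)"] prod.cong) auto
  also have "\<dots> = (\<Prod>e\<in>V. w e * ?m (1 - p) e + (1 - w e) * ?m (- p) e)"
    by (rule sum_edge_weight_prod[OF V(1)])
  also have "\<dots> = (\<Prod>e\<in>V. (if e \<in> E \<inter> F then p * (1 - p) + (1 - 2 * p) * (w e - p) else 1) *
      ((if e \<in> E - F then w e - p else 1) * (if e \<in> F - E then w e - p else 1)))"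
    by (intro prod.cong refl) (auto simp: algebra_simps)
  also have "\<dots> = (\<Prod>e\<in>E \<inter> F. p * (1 - p) + (1 - 2 * p) * (w e - p)) * ((\<Prod>e\<in>E - F. w e - p) * (\<Prod>e\<in>F - E. w e - p))"
    using V by (subst (1 2 3) pr) (auto simp: prod.distrib)
  finally show ?thesis .
qed

lemma finite_vertex_pairs: "finite (vertex_pairs n)"
  by (rule finite_subset[of _ "{1..n} \<times> {1..n}"]) (auto simp: vertex_pairs_def)

definition edge_graph :: "(nat \<times> nat) set \<Rightarrow> nat set set" where
  "edge_graph X = {{i, j} | i j. (i, j) \<in> X}"

text \<open>The order \<open>i < j\<close> in a vertex pair is recovered from the unordered edge, so
  subsets of \<open>vertex_pairs n\<close> can replace graphs.\<close>

lemma inj_on_edge_graph: "inj_on edge_graph (Pow (vertex_pairs n))"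
proof (rule inj_on_inverseI)
  fix X assume X: "X \<in> Pow (vertex_pairs n)"
  show "{(i, j) \<in> vertex_pairs n. {i, j} \<in> edge_graph X} = X"
  proof safe
    fix i j assume ij: "(i, j) \<in> vertex_pairs n" "{i, j} \<in> edge_graph X"
    then obtain k l where kl: "{i, j} = {k, l}" "(k, l) \<in> X" by (auto simp: edge_graph_def)
    then have "k < l" "i < j" using X ij by (auto simp: vertex_pairs_def)
    then have "i = k" "j = l" using kl(1) by (auto simp: doubleton_eq_iff)
    then show "(i, j) \<in> X" using kl by simp
  qed (use X in \<open>auto simp: edge_graph_def\<close>)
qed

lemma measure_independent_edges:
  assumes w: "\<And>e. e \<in> vertex_pairs n \<Longrightarrow> 0 \<le> w e \<and> w e \<le> 1"
  shows "measure (independent_edges n (\<lambda>i j. w (i, j))) A =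
    (\<Sum>X\<in>Pow (vertex_pairs n). edge_weight (vertex_pairs n) w X * of_bool (edge_graph X \<in> A))"
proof -
  let ?V = "vertex_pairs n"
  let ?Q = "Pi_pmf ?V False (\<lambda>(i, j). bernoulli_pmf (w (i, j)))"
  let ?h = "\<lambda>\<omega>. {{i, j} | i j. (i, j) \<in> ?V \<and> \<omega> (i, j)}"
  let ?c = "\<lambda>X e. e \<in> X"
  have fin: "finite ?V" by (rule finite_vertex_pairs)
  have inj: "inj_on ?c (Pow ?V)" by (auto simp: inj_on_def fun_eq_iff)
  have pmf: "pmf ?Q (?c X) = edge_weight ?V w X" if X: "X \<in> Pow ?V" for X
  proof -
    have "pmf ?Q (?c X) = (\<Prod>e\<in>?V. pmf (case e of (i, j) \<Rightarrow> bernoulli_pmf (w (i, j))) (e \<in> X))"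
      using X by (intro pmf_Pi' fin) auto
    also have "\<dots> = (\<Prod>e\<in>?V. if e \<in> X then w e else 1 - w e)"
    proof (intro prod.cong refl)
      fix e assume "e \<in> ?V"
      then show "pmf (case e of (i, j) \<Rightarrow> bernoulli_pmf (w (i, j))) (e \<in> X) = (if e \<in> X then w e else 1 - w e)"
        using w[of e] by (cases e) auto
    qed
    also have "\<dots> = edge_weight ?V w X"
      using X by (simp add: prod_if_member[OF fin] edge_weight_def)
    finally show ?thesis .
  qed
  have h: "?h (?c X) = edge_graph X" if "X \<in> Pow ?V" for X
    using that by (auto simp: edge_graph_def)
  have "measure (independent_edges n (\<lambda>i j. w (i, j))) A = measure ?Q (?h -` A)"
    by (simp add: independent_edges_def measure_map_pmf)
  also have "\<dots> = (\<integral>\<omega>. of_bool (?h \<omega> \<in> A) \<partial>?Q)"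
    by (subst integral_of_bool) (auto simp: vimage_def)
  also have "\<dots> = (\<Sum>\<omega>\<in>?c ` Pow ?V. of_bool (?h \<omega> \<in> A) * pmf ?Q \<omega>)"
  proof (rule integral_measure_pmf_real)
    show "finite (?c ` Pow ?V)" using fin by simp
    fix \<omega> assume "\<omega> \<in> set_pmf ?Q"
    \<comment> \<open>Outside the vertex pairs the coins take the default value
      \<open>False\<close>, so each outcome is the membership predicate of a set of vertex
      pairs.\<close>
    then have "\<forall>e. e \<notin> ?V \<longrightarrow> \<not> \<omega> e" using set_Pi_pmf_subset[OF fin, of False] by auto
    then have "\<omega> = ?c {e. \<omega> e}" "{e. \<omega> e} \<in> Pow ?V" by auto
    then show "\<omega> \<in> ?c ` Pow ?V" by blast
  qed
  also have "\<dots> = (\<Sum>X\<in>Pow ?V. of_bool (?h (?c X) \<in> A) * pmf ?Q (?c X))"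
    by (simp add: sum.reindex[OF inj])
  also have "\<dots> = (\<Sum>X\<in>Pow ?V. edge_weight ?V w X * of_bool (edge_graph X \<in> A))"
    by (intro sum.cong refl) (simp only: pmf h mult.commute)
  finally show ?thesis .
qed

lemma measure_erdos_renyi:
  assumes "0 \<le> p" "p \<le> 1"
  shows "measure (erdos_renyi n p) A =
    (\<Sum>X\<in>Pow (vertex_pairs n). edge_weight (vertex_pairs n) (\<lambda>_. p) X * of_bool (edge_graph X \<in> A))"
  using measure_independent_edges[of n "\<lambda>_. p" A] assms by (simp add: erdos_renyi_def)

section \<open>The noisy graph as a mixture of independent edges\<close>

context spherical_cap
begin

definition edge_prob :: "real \<Rightarrow> (nat \<Rightarrow> nat \<Rightarrow> real) \<Rightarrow> nat \<times> nat \<Rightarrow> real" where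
  "edge_prob q x e = p + q * kern x (fst e) (snd e)"

text \<open>The law of the noisy graph, carried over to subsets of \<open>vertex_pairs n\<close>.
  For \<open>q = 0\<close> it is the Erdos--Renyi law, so that moment bounds for these weights cover
  both graphs.\<close>

definition graph_weight :: "nat \<Rightarrow> real \<Rightarrow> (nat \<times> nat) set \<Rightarrow> real" where
  "graph_weight n q X = (\<integral>x. edge_weight (vertex_pairs n) (edge_prob q x) X \<partial>points {1..n})"

lemma noisy_kernel_bounds:
  assumes "0 \<le> q" "q \<le> 1"
  shows "0 \<le> p + q * kernel u" "p + q * kernel u \<le> 1"
proof -
  have "p * q \<le> p" "0 \<le> p * q" "0 \<le> (1 - p) * (1 - q)"
    using assms p by (auto intro: mult_left_le)
  then show "0 \<le> p + q * kernel u" "p + q * kernel u \<le> 1"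
    using assms by (auto simp: kernel_def half_line_def algebra_simps)
qed

lemma edge_prob_bounds: "0 \<le> q \<Longrightarrow> q \<le> 1 \<Longrightarrow> 0 \<le> edge_prob q x e \<and> edge_prob q x e \<le> 1"
  using noisy_kernel_bounds by (simp add: edge_prob_def kern_def)

lemma edge_prob_measurable:
  assumes "e \<in> I \<times> I" shows "(\<lambda>x. edge_prob q x e) \<in> borel_measurable (points I)"
  using assms unfolding edge_prob_def
  by (intro borel_measurable_add borel_measurable_times borel_measurable_const kern_measurable) auto

lemma edge_weight_measurable:
  assumes "X \<subseteq> V" "V \<subseteq> I \<times> I"
  shows "(\<lambda>x. edge_weight V (edge_prob q x) X) \<in> borel_measurable (points I)"
  using assms unfolding edge_weight_def
  by (intro borel_measurable_times borel_measurable_prod borel_measurable_diff borel_measurable_const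
      edge_prob_measurable) auto

lemma vertex_pairs_subset: "vertex_pairs n \<subseteq> {1..n} \<times> {1..n}"
  by (auto simp: vertex_pairs_def)

lemma abs_edge_weight_le:
  assumes "finite V" "X \<subseteq> V" "0 \<le> q" "q \<le> 1"
  shows "\<bar>edge_weight V (edge_prob q x) X\<bar> \<le> 1"
  using edge_weight_nonneg[OF assms(2)] edge_weight_le_1[OF assms(1,2)] edge_prob_bounds[OF assms(3,4)]
  by (simp add: abs_le_iff)

lemma integrable_edge_weight:
  assumes "X \<subseteq> vertex_pairs n" "0 \<le> q" "q \<le> 1"
  shows "integrable (points {1..n}) (\<lambda>x. edge_weight (vertex_pairs n) (edge_prob q x) X)"
proof -
  interpret P: prob_space "points {1..n}" by (rule prob_space_points)
  show ?thesis
    using assms abs_edge_weight_le[OF finite_vertex_pairs assms]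
    by (intro P.integrable_const_bound[of _ 1] edge_weight_measurable vertex_pairs_subset) auto
qed

lemma graph_weight_nonneg: "X \<subseteq> vertex_pairs n \<Longrightarrow> 0 \<le> q \<Longrightarrow> q \<le> 1 \<Longrightarrow> 0 \<le> graph_weight n q X"
  unfolding graph_weight_def
  by (intro Bochner_Integration.integral_nonneg edge_weight_nonneg) (auto simp: edge_prob_bounds)

lemma sum_graph_weight:
  assumes q: "0 \<le> q" "q \<le> 1"
  shows "(\<Sum>X\<in>Pow (vertex_pairs n). graph_weight n q X * f X) =
    (\<integral>x. (\<Sum>X\<in>Pow (vertex_pairs n). edge_weight (vertex_pairs n) (edge_prob q x) X * f X) \<partial>points {1..n})"
  unfolding graph_weight_def using integrable_edge_weight[OF _ q]
  by (subst Bochner_Integration.integral_sum) auto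

lemma sum_graph_weight_1:
  assumes q: "0 \<le> q" "q \<le> 1"
  shows "(\<Sum>X\<in>Pow (vertex_pairs n). graph_weight n q X) = 1"
proof -
  interpret P: prob_space "points {1..n}" by (rule prob_space_points)
  show ?thesis
    using sum_graph_weight[OF q, of n "\<lambda>_. 1"] sum_edge_weight[OF finite_vertex_pairs] P.prob_space
    by simp
qed

lemma graph_weight_0: "graph_weight n 0 X = edge_weight (vertex_pairs n) (\<lambda>_. p) X"
proof -
  interpret P: prob_space "points {1..n}" by (rule prob_space_points)
  show ?thesis using P.prob_space by (simp add: graph_weight_def edge_prob_def[abs_def])
qed

lemma measure_kernel_edges:
  assumes q: "0 \<le> q" "q \<le> 1"
  shows "measure (independent_edges n (\<lambda>i j. p + q * kern x i j)) B =
    (\<Sum>X\<in>Pow (vertex_pairs n). edge_weight (vertex_pairs n) (edge_prob q x) X * of_bool (edge_graph X \<in> B))"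
  using measure_independent_edges[of n "edge_prob q x" B] edge_prob_bounds[OF q] by (simp add: edge_prob_def)

lemma noisy_kernel_measurable:
  assumes q: "0 \<le> q" "q \<le> 1"
  shows "(\<lambda>x. measure_pmf (independent_edges n (\<lambda>i j. p + q * kern x i j))) \<in>
    measurable (points {1..n}) (subprob_algebra (count_space UNIV))"
proof (rule measurable_subprob_algebra)
  let ?K = "\<lambda>x. measure_pmf (independent_edges n (\<lambda>i j. p + q * kern x i j))"
  show "subprob_space (?K x)" for x by (rule prob_space_imp_subprob_space) (rule measure_pmf.prob_space_axioms)
  fix B
  have "(\<lambda>x. measure (?K x) B) \<in> borel_measurable (points {1..n})"
    unfolding measure_kernel_edges[OF q] using vertex_pairs_subset[of n]
    by (intro borel_measurable_sum borel_measurable_times borel_measurable_const edge_weight_measurable) auto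
  then show "(\<lambda>x. emeasure (?K x) B) \<in> borel_measurable (points {1..n})"
    unfolding measure_pmf.emeasure_eq_measure by measurable
qed simp

lemma connection_eq:
  assumes "t = threshold p d"
  shows "connection p d q (dot d (x i) (x j)) = p + q * kern x i j"
  by (simp add: connection_def kern_def kernel_def half_line_def assms[symmetric] algebra_simps)

lemma measure_noisy_geometric_graph:
  assumes t: "t = threshold p d" and q: "0 \<le> q" "q \<le> 1"
  shows "measure (noisy_geometric_graph n p d q) A =
    (\<Sum>X\<in>Pow (vertex_pairs n). graph_weight n q X * of_bool (edge_graph X \<in> A))"
proof -
  interpret P: prob_space "points {1..n}" by (rule prob_space_points)
  have "measure (noisy_geometric_graph n p d q) A =
      (\<integral>x. measure (independent_edges n (\<lambda>i j. p + q * kern x i j)) A \<partial>points {1..n})"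
    unfolding noisy_geometric_graph_def connection_eq[OF t]
    by (rule P.measure_bind[OF noisy_kernel_measurable[OF q]]) simp
  then show ?thesis
    by (simp only: measure_kernel_edges[OF q] sum_graph_weight[OF q])
qed

end

lemma sets_erdos_renyi: "sets (erdos_renyi n p) = UNIV"
  by (simp add: erdos_renyi_def)

section \<open>Signed triangles\<close>

text \<open>With one block of vertices per position, two triangles can have common vertices only in
  equal positions, which keeps the case analysis of overlaps short. The order of the blocks makes
  every edge a pair with increasing entries.\<close>

definition triples :: "nat \<Rightarrow> (nat \<times> nat \<times> nat) set" where
  "triples m = {1..m} \<times> {m+1..2*m} \<times> {2*m+1..3*m}"

definition triangle_edges :: "nat \<times> nat \<times> nat \<Rightarrow> (nat \<times> nat) set" where
  "triangle_edges s = (case s of (i, j, k) \<Rightarrow> {(i, j), (i, k), (j, k)})"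

definition signed_triangles :: "nat \<Rightarrow> real \<Rightarrow> (nat \<times> nat) set \<Rightarrow> real" where
  "signed_triangles m p X = (\<Sum>s\<in>triples m. \<Prod>e\<in>triangle_edges s. of_bool (e \<in> X) - p)"

text \<open>A sum of terms instead of a case distinction, so that it can be summed over all pairs:
  \<open>A\<close> for every pair of triangles, \<open>B\<close> for each common edge, 1 for equal
  triangles.\<close>

definition overlap_bound :: "real \<Rightarrow> real \<Rightarrow> nat \<times> nat \<times> nat \<Rightarrow> nat \<times> nat \<times> nat \<Rightarrow> real" where
  "overlap_bound A B s s' = (case s of (i, j, k) \<Rightarrow> case s' of (i', j', k') \<Rightarrow>
     A + B * (of_bool (i = i') * of_bool (j = j') + of_bool (i = i') * of_bool (k = k') +
       of_bool (j = j') * of_bool (k = k')) + of_bool (i = i') * of_bool (j = j') * of_bool (k = k'))"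

lemma card_triples: "card (triples m) = m ^ 3"
  by (simp add: triples_def card_cartesian_product power3_eq_cube)

lemma sum_overlap_bound:
  "(\<Sum>s\<in>triples m. \<Sum>s'\<in>triples m. overlap_bound A B s s') = A * real m ^ 6 + 3 * B * real m ^ 4 + real m ^ 3"
proof -
  have *: "(\<Sum>s\<in>triples m. f s) = (\<Sum>i\<in>{1..m}. \<Sum>j\<in>{m+1..2*m}. \<Sum>k\<in>{2*m+1..3*m}. f (i, j, k))" for f :: "_ \<Rightarrow> real"
    by (simp add: triples_def sum.cartesian_product)
  have ind: "(\<Sum>i'\<in>U. of_bool (i = i') * c) = of_bool (i \<in> U) * c"
    "(\<Sum>i'\<in>U. of_bool (i = i')) = (of_bool (i \<in> U) :: real)" if "finite U" for i :: nat and U and c :: real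
    using that by (auto simp: of_bool_def if_distrib[of "\<lambda>z. z * c"] cong: if_cong)
  show ?thesis
    unfolding * overlap_bound_def
    by (simp add: sum.distrib ind distrib_left flip: sum_distrib_left sum_distrib_right)
      (simp add: power3_eq_cube power4_eq_xxxx power_numeral_reduce algebra_simps)
qed

context spherical_cap
begin

lemma edge_prob_minus: "edge_prob q x e - p = q * kern x (fst e) (snd e)"
  by (simp add: edge_prob_def)

text \<open>The expression is the second moment of a centred edge, an average of
  \<open>(1 - p)\<^sup>2\<close> and \<open>p\<^sup>2\<close>.\<close>

lemma edge_variance_bound:
  assumes "0 \<le> q" "q \<le> 1"
  shows "\<bar>p * (1 - p) + (1 - 2 * p) * q * kern x i j\<bar> \<le> 1"
proof -
  define w where "w = p + q * kern x i j"
  have w: "0 \<le> w" "w \<le> 1" using noisy_kernel_bounds[OF assms] by (auto simp: w_def kern_def)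
  have e: "p * (1 - p) + (1 - 2 * p) * q * kern x i j = w * (1 - p)\<^sup>2 + (1 - w) * p\<^sup>2"
    by (simp add: w_def power2_eq_square algebra_simps)
  have "w * (1 - p)\<^sup>2 + (1 - w) * p\<^sup>2 \<le> w * 1 + (1 - w) * 1"
    using w p by (intro add_mono mult_left_mono) (auto intro: power_le_one)
  moreover have "0 \<le> w * (1 - p)\<^sup>2 + (1 - w) * p\<^sup>2" using w by simp
  ultimately show ?thesis unfolding e by simp
qed

lemma triples_vertices:
  assumes "(i, j, k) \<in> triples m" "3 * m \<le> n"
  shows "i \<in> {1..n}" "j \<in> {1..n}" "k \<in> {1..n}" "i < j" "j < k" "i \<le> m" "m < j" "j \<le> 2 * m" "2 * m < k"
  using assms by (auto simp: triples_def)

lemma triangle_edges_subset: "s \<in> triples m \<Longrightarrow> 3 * m \<le> n \<Longrightarrow> triangle_edges s \<subseteq> vertex_pairs n"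
  by (cases s) (auto simp: triangle_edges_def triples_def vertex_pairs_def)

text \<open>Two triangles have a common edge exactly when they agree in at least two positions. A
  common edge contributes its bounded second moment, any other edge a factor \<open>q\<close>: there
  are four of these if one edge is shared and six if none is.\<close>

lemma triangle_pair_bound:
  assumes q: "0 \<le> q" "q \<le> 1" and s: "s \<in> triples m" "s' \<in> triples m" and m: "3 * m \<le> n"
  shows "(\<integral>x. (\<Sum>X\<in>Pow (vertex_pairs n). edge_weight (vertex_pairs n) (edge_prob q x) X *
      ((\<Prod>e\<in>triangle_edges s. of_bool (e \<in> X) - p) * (\<Prod>e\<in>triangle_edges s'. of_bool (e \<in> X) - p))) \<partial>points {1..n})
    \<le> overlap_bound (q ^ 6 * triangle\<^sup>2) (q ^ 4 / real d) s s'"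
proof -
  interpret P: prob_space "points {1..n}" by (rule prob_space_points)
  obtain i j k i' j' k' where ss: "s = (i, j, k)" "s' = (i', j', k')" by (cases s, cases s')
  note v = triples_vertices[OF s(1)[unfolded ss] m] triples_vertices[OF s(2)[unfolded ss] m]
  have ne: "i \<noteq> j" "i \<noteq> k" "j \<noteq> k" "i' \<noteq> j'" "i' \<noteq> k'" "j' \<noteq> k'" "i \<noteq> j'" "i \<noteq> k'" "j \<noteq> k'"
    "i' \<noteq> j" "i' \<noteq> k" "j' \<noteq> k" using v by auto
  note ne = ne ne[symmetric]
  have inI: "{i, j, k, i', j', k'} \<subseteq> {1..n}" using v by auto
  let ?E = "triangle_edges s" and ?F = "triangle_edges s'"
  let ?v = "\<lambda>x e. p * (1 - p) + (1 - 2 * p) * q * kern x (fst e) (snd e)"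
  let ?D = "\<lambda>x e. q * kern x (fst e) (snd e)"
  let ?T = "\<lambda>x. (\<Prod>e\<in>?E \<inter> ?F. ?v x e) * ((\<Prod>e\<in>?E - ?F. ?D x e) * (\<Prod>e\<in>?F - ?E. ?D x e))"
  have eq: "(\<Sum>X\<in>Pow (vertex_pairs n). edge_weight (vertex_pairs n) (edge_prob q x) X *
      ((\<Prod>e\<in>?E. of_bool (e \<in> X) - p) * (\<Prod>e\<in>?F. of_bool (e \<in> X) - p))) = ?T x" for x
    using sum_edge_weight_centred[OF finite_vertex_pairs triangle_edges_subset[OF s(1) m] triangle_edges_subset[OF s(2) m]]
    by (simp only: edge_prob_minus mult.assoc)
  have A: "0 \<le> q ^ 6 * triangle\<^sup>2" and B: "0 \<le> q ^ 4 / real d" using q by auto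
  have E: "?E = {(i, j), (i, k), (j, k)}" "?F = {(i', j'), (i', k'), (j', k')}"
    by (auto simp: triangle_edges_def ss)
  let ?r = "p * (1 - p)" and ?c = "(1 - 2 * p) * q"
  have shared: "(\<integral>x. q ^ 4 * ((?r + ?c * kern x a b) * ((kern x a c * kern x b c) * (kern x a c' * kern x b c'))) \<partial>points {1..n})
      \<le> q ^ 4 / real d" if "{a, b, c, c'} \<subseteq> {1..n}" "distinct [a, b, c, c']" for a b c c'
  proof -
    have "(\<integral>x. (?r + ?c * kern x a b) * ((kern x a c * kern x b c) * (kern x a c' * kern x b c')) \<partial>points {1..n}) \<le> 1 / real d"
      by (rule integral_shared_edge[OF finite_atLeastAtMost that edge_variance_bound[OF q]])
    from mult_left_mono[OF this, of "q ^ 4"] q show ?thesis by simp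
  qed
  have disjoint: "(\<integral>x. q ^ 6 * ((kern x a b * kern x a c * kern x b c) * (kern x a' b' * kern x a' c' * kern x b' c')) \<partial>points {1..n})
      = q ^ 6 * triangle\<^sup>2" if "{a, b, c, a', b', c'} \<subseteq> {1..n}" "distinct [b, c, b', c']" "a \<notin> {b, c, b', c'}" "a' \<notin> {b, c, b', c'}"
      for a b c a' b' c'
    using integral_two_triangles[OF finite_atLeastAtMost that] by simp
  have disj: "?T x = q ^ 6 * ((kern x i j * kern x i k * kern x j k) * (kern x i' j' * kern x i' k' * kern x j' k'))"
    if "?E \<inter> ?F = {}" for x
  proof -
    have "?E - ?F = ?E" "?F - ?E = ?F" using that by auto
    then show ?thesis using ne unfolding that by (simp add: E power_numeral_reduce)
  qed
  have goal: "(\<integral>x. ?T x \<partial>points {1..n}) \<le> overlap_bound (q ^ 6 * triangle\<^sup>2) (q ^ 4 / real d) s s'"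
  proof -
    \<comment> \<open>The last three cases overlap. Each names two positions in which the triangles
      differ; the vertex in the third position may or may not be common and takes the role of
      \<open>a\<close> in \<open>disjoint\<close>.\<close>
    consider (all) "i = i'" "j = j'" "k = k'" | (ij) "i = i'" "j = j'" "k \<noteq> k'" | (ik) "i = i'" "j \<noteq> j'" "k = k'"
      | (jk) "i \<noteq> i'" "j = j'" "k = k'" | (i) "j \<noteq> j'" "k \<noteq> k'" | (j) "i \<noteq> i'" "k \<noteq> k'" | (k) "i \<noteq> i'" "j \<noteq> j'"
      by blast
    then show ?thesis
    proof cases
      case all
      have "\<bar>\<Prod>e\<in>?E. ?v x e\<bar> \<le> 1" for x
        unfolding abs_prod by (intro prod_le_1) (auto intro: edge_variance_bound[OF q])
      then have le: "?T x \<le> 1" for x using all by (simp add: ss abs_le_iff)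
      have "(\<integral>x. ?T x \<partial>points {1..n}) \<le> 1"
      \<comment> \<open>A function that is not integrable has integral 0 by convention, so the bound
        holds in either case.\<close>
      proof (cases "integrable (points {1..n}) ?T")
        case True
        then have "(\<integral>x. ?T x \<partial>points {1..n}) \<le> (\<integral>x. 1 \<partial>points {1..n})"
          by (rule integral_mono[OF _ P.integrable_const le])
        then show ?thesis using P.prob_space by simp
      qed (simp add: not_integrable_integral_eq)
      moreover have "1 \<le> overlap_bound (q ^ 6 * triangle\<^sup>2) (q ^ 4 / real d) s s'"
        using A B all by (simp add: overlap_bound_def ss)
      ultimately show ?thesis by simp
    next
      case ij
      have sets: "?E \<inter> ?F = {(i, j)}" "?E - ?F = {(i, k), (j, k)}" "?F - ?E = {(i, k'), (j, k')}"
        unfolding E ij(1)[symmetric] ij(2)[symmetric]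
        using ij(3) ij(3)[symmetric] ne by (simp_all add: insert_Diff_if)
      have "?T x = q ^ 4 * ((?r + ?c * kern x i j) * ((kern x i k * kern x j k) * (kern x i k' * kern x j k')))" for x
        unfolding sets using ne by (simp add: power_numeral_reduce mult_ac)
      moreover have "{i, j, k, k'} \<subseteq> {1..n}" "distinct [i, j, k, k']"
        using inI ij(3) ne by auto
      moreover note shared[OF this]
      ultimately have "(\<integral>x. ?T x \<partial>points {1..n}) \<le> q ^ 4 / real d"
        by (simp only:)
      also have "\<dots> \<le> overlap_bound (q ^ 6 * triangle\<^sup>2) (q ^ 4 / real d) s s'"
        using A ij by (simp add: overlap_bound_def ss)
      finally show ?thesis .
    next
      case ik
      have sets: "?E \<inter> ?F = {(i, k)}" "?E - ?F = {(i, j), (j, k)}" "?F - ?E = {(i, j'), (j', k)}"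
        unfolding E ik(1)[symmetric] ik(3)[symmetric]
        using ik(2) ik(2)[symmetric] ne by (simp_all add: insert_Diff_if)
      have "?T x = q ^ 4 * ((?r + ?c * kern x i k) * ((kern x i j * kern x k j) * (kern x i j' * kern x k j')))" for x
        unfolding sets using ne by (simp add: power_numeral_reduce mult_ac kern_commute[of _ k j] kern_commute[of _ k j'])
      moreover have "{i, k, j, j'} \<subseteq> {1..n}" "distinct [i, k, j, j']"
        using inI ik(2) ne by auto
      moreover note shared[OF this]
      ultimately have "(\<integral>x. ?T x \<partial>points {1..n}) \<le> q ^ 4 / real d"
        by (simp only:)
      also have "\<dots> \<le> overlap_bound (q ^ 6 * triangle\<^sup>2) (q ^ 4 / real d) s s'"
        using A ik by (simp add: overlap_bound_def ss)
      finally show ?thesis .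
    next
      case jk
      have sets: "?E \<inter> ?F = {(j, k)}" "?E - ?F = {(i, j), (i, k)}" "?F - ?E = {(i', j), (i', k)}"
        unfolding E jk(2)[symmetric] jk(3)[symmetric]
        using jk(1) jk(1)[symmetric] ne by (simp_all add: insert_Diff_if)
      have "?T x = q ^ 4 * ((?r + ?c * kern x j k) * ((kern x j i * kern x k i) * (kern x j i' * kern x k i')))" for x
        unfolding sets using ne by (simp add: power_numeral_reduce kern_commute[of _ k i] kern_commute[of _ k i'] kern_commute[of _ j i] kern_commute[of _ j i']) (simp add: mult_ac)?
      moreover have "{j, k, i, i'} \<subseteq> {1..n}" "distinct [j, k, i, i']"
        using inI jk(1) ne by auto
      moreover note shared[OF this]
      ultimately have "(\<integral>x. ?T x \<partial>points {1..n}) \<le> q ^ 4 / real d"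
        by (simp only:)
      also have "\<dots> \<le> overlap_bound (q ^ 6 * triangle\<^sup>2) (q ^ 4 / real d) s s'"
        using A jk by (simp add: overlap_bound_def ss)
      finally show ?thesis .
    next
      case i
      then have e: "?E \<inter> ?F = {}" using ne unfolding E by auto
      have "?T x = q ^ 6 * ((kern x i j * kern x i k * kern x j k) * (kern x i' j' * kern x i' k' * kern x j' k'))" for x
        by (rule disj[OF e])
      moreover have "{i, j, k, i', j', k'} \<subseteq> {1..n}" "distinct [j, k, j', k']"
          "i \<notin> {j, k, j', k'}" "i' \<notin> {j, k, j', k'}"
        using inI i ne by auto
      moreover note disjoint[OF this]
      ultimately have "(\<integral>x. ?T x \<partial>points {1..n}) = q ^ 6 * triangle\<^sup>2"
        by (simp only:)
      also have "\<dots> \<le> overlap_bound (q ^ 6 * triangle\<^sup>2) (q ^ 4 / real d) s s'"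
        using B by (simp add: overlap_bound_def ss)
      finally show ?thesis .
    next
      case j
      then have e: "?E \<inter> ?F = {}" using ne unfolding E by auto
      have "?T x = q ^ 6 * ((kern x j i * kern x j k * kern x i k) * (kern x j' i' * kern x j' k' * kern x i' k'))" for x
        unfolding disj[OF e] by (simp only: kern_commute[of x j i] kern_commute[of x j' i'] mult_ac)
      moreover have "{j, i, k, j', i', k'} \<subseteq> {1..n}" "distinct [i, k, i', k']"
          "j \<notin> {i, k, i', k'}" "j' \<notin> {i, k, i', k'}"
        using inI j ne by auto
      moreover note disjoint[OF this]
      ultimately have "(\<integral>x. ?T x \<partial>points {1..n}) = q ^ 6 * triangle\<^sup>2"
        by (simp only:)
      also have "\<dots> \<le> overlap_bound (q ^ 6 * triangle\<^sup>2) (q ^ 4 / real d) s s'"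
        using B by (simp add: overlap_bound_def ss)
      finally show ?thesis .
    next
      case k
      then have e: "?E \<inter> ?F = {}" using ne unfolding E by auto
      have "?T x = q ^ 6 * ((kern x k i * kern x k j * kern x i j) * (kern x k' i' * kern x k' j' * kern x i' j'))" for x
        unfolding disj[OF e] by (simp only: kern_commute[of x k i] kern_commute[of x k' i'] kern_commute[of x k j] kern_commute[of x k' j'] mult_ac)
      moreover have "{k, i, j, k', i', j'} \<subseteq> {1..n}" "distinct [i, j, i', j']"
          "k \<notin> {i, j, i', j'}" "k' \<notin> {i, j, i', j'}"
        using inI k ne by auto
      moreover note disjoint[OF this]
      ultimately have "(\<integral>x. ?T x \<partial>points {1..n}) = q ^ 6 * triangle\<^sup>2"
        by (simp only:)
      also have "\<dots> \<le> overlap_bound (q ^ 6 * triangle\<^sup>2) (q ^ 4 / real d) s s'"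
        using B by (simp add: overlap_bound_def ss)
      finally show ?thesis .
    qed
  qed
  show ?thesis unfolding eq by (rule goal)
qed

lemma second_moment_signed_triangles:
  assumes q: "0 \<le> q" "q \<le> 1" and m: "3 * m \<le> n"
  shows "(\<Sum>X\<in>Pow (vertex_pairs n). graph_weight n q X * (signed_triangles m p X)\<^sup>2) \<le>
    q ^ 6 * triangle\<^sup>2 * real m ^ 6 + 3 * (q ^ 4 / real d) * real m ^ 4 + real m ^ 3"
proof -
  let ?a = "\<lambda>s X. \<Prod>e\<in>triangle_edges s. of_bool (e \<in> X) - p"
  have "(\<Sum>X\<in>Pow (vertex_pairs n). graph_weight n q X * (signed_triangles m p X)\<^sup>2) =
      (\<Sum>X\<in>Pow (vertex_pairs n). \<Sum>s\<in>triples m. \<Sum>s'\<in>triples m. graph_weight n q X * (?a s X * ?a s' X))"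
    unfolding signed_triangles_def power2_eq_square sum_product by (simp only: sum_distrib_left)
  also have "\<dots> = (\<Sum>s\<in>triples m. \<Sum>s'\<in>triples m. \<Sum>X\<in>Pow (vertex_pairs n). graph_weight n q X * (?a s X * ?a s' X))"
    by (subst sum.swap, rule sum.cong[OF refl], rule sum.swap)
  also have "\<dots> \<le> (\<Sum>s\<in>triples m. \<Sum>s'\<in>triples m. overlap_bound (q ^ 6 * triangle\<^sup>2) (q ^ 4 / real d) s s')"
    unfolding sum_graph_weight[OF q] by (intro sum_mono triangle_pair_bound[OF q _ _ m])
  finally show ?thesis by (simp only: sum_overlap_bound)
qed

lemma first_moment_signed_triangles:
  assumes q: "0 \<le> q" "q \<le> 1" and m: "3 * m \<le> n"
  shows "(\<Sum>X\<in>Pow (vertex_pairs n). graph_weight n q X * signed_triangles m p X) = q ^ 3 * triangle * real m ^ 3"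
proof -
  let ?a = "\<lambda>s X. \<Prod>e\<in>triangle_edges s. of_bool (e \<in> X) - p"
  have one: "(\<Sum>X\<in>Pow (vertex_pairs n). graph_weight n q X * ?a s X) = q ^ 3 * triangle" if s: "s \<in> triples m" for s
  proof -
    obtain i j k where ss: "s = (i, j, k)" by (cases s)
    note v = triples_vertices[OF s[unfolded ss] m]
    have ne: "i \<noteq> j" "i \<noteq> k" "j \<noteq> k" using v by auto
    have "(\<Sum>X\<in>Pow (vertex_pairs n). edge_weight (vertex_pairs n) (edge_prob q x) X * ?a s X) =
        q ^ 3 * (kern x i j * kern x i k * kern x j k)" for x
      using sum_edge_weight_centred[OF finite_vertex_pairs triangle_edges_subset[OF s m], of "{}" "edge_prob q x" p] ne
      by (simp add: edge_prob_minus triangle_edges_def ss power3_eq_cube mult_ac)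
    then have "(\<Sum>X\<in>Pow (vertex_pairs n). graph_weight n q X * ?a s X) =
        (\<integral>x. q ^ 3 * (kern x i j * kern x i k * kern x j k) \<partial>points {1..n})"
      unfolding sum_graph_weight[OF q] by (simp only:)
    also have "\<dots> = q ^ 3 * triangle"
      using integral_one_triangle[of "{1..n}" i j k] v ne by simp
    finally show ?thesis .
  qed
  have "(\<Sum>X\<in>Pow (vertex_pairs n). graph_weight n q X * signed_triangles m p X) =
      (\<Sum>X\<in>Pow (vertex_pairs n). \<Sum>s\<in>triples m. graph_weight n q X * ?a s X)"
    by (simp add: signed_triangles_def sum_distrib_left)
  also have "\<dots> = (\<Sum>s\<in>triples m. \<Sum>X\<in>Pow (vertex_pairs n). graph_weight n q X * ?a s X)"
    by (rule sum.swap)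
  also have "\<dots> = (\<Sum>s\<in>triples m. q ^ 3 * triangle)"
    by (rule sum.cong[OF refl one])
  finally show ?thesis by (simp add: card_triples mult_ac)
qed

end

section \<open>Separating the two laws by the signed triangle count\<close>

lemma finite_Chebyshev:
  fixes \<nu> T :: "'a \<Rightarrow> real"
  assumes "finite U" "\<And>X. X \<in> U \<Longrightarrow> 0 \<le> \<nu> X" "0 < a"
    and P: "\<And>X. X \<in> U \<Longrightarrow> P X \<Longrightarrow> a \<le> \<bar>T X - \<mu>\<bar>"
  shows "(\<Sum>X\<in>U. \<nu> X * of_bool (P X)) \<le> (\<Sum>X\<in>U. \<nu> X * (T X - \<mu>)\<^sup>2) / a\<^sup>2"
proof -
  have "(\<Sum>X\<in>U. \<nu> X * of_bool (P X)) \<le> (\<Sum>X\<in>U. \<nu> X * (T X - \<mu>)\<^sup>2 / a\<^sup>2)"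
  proof (rule sum_mono)
    fix X assume X: "X \<in> U"
    show "\<nu> X * of_bool (P X) \<le> \<nu> X * (T X - \<mu>)\<^sup>2 / a\<^sup>2"
    proof (cases "P X")
      case True
      then have "a\<^sup>2 \<le> \<bar>T X - \<mu>\<bar>\<^sup>2" using P[OF X] assms(3) by (intro power_mono) auto
      then have "1 \<le> (T X - \<mu>)\<^sup>2 / a\<^sup>2" using assms(3) by simp
      then have "\<nu> X * 1 \<le> \<nu> X * ((T X - \<mu>)\<^sup>2 / a\<^sup>2)" using assms(2)[OF X] by (rule mult_left_mono)
      then show ?thesis using True by simp
    qed (use assms(2)[OF X] in simp)
  qed
  then show ?thesis by (simp add: sum_divide_distrib)
qed

lemma total_variation_bounds:
  assumes "prob_space P" "prob_space Q" "A \<in> sets P"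
  shows "\<bar>measure P A - measure Q A\<bar> \<le> total_variation P Q" "total_variation P Q \<le> 1"
proof -
  interpret P: prob_space P by fact
  interpret Q: prob_space Q by fact
  have le: "\<bar>measure P B - measure Q B\<bar> \<le> 1" for B
    using P.prob_le_1[of B] Q.prob_le_1[of B] measure_nonneg[of P B] measure_nonneg[of Q B]
    by linarith
  then have "bdd_above ((\<lambda>B. \<bar>measure P B - measure Q B\<bar>) ` sets P)" by (intro bdd_aboveI2)
  then show "\<bar>measure P A - measure Q A\<bar> \<le> total_variation P Q"
    unfolding total_variation_def using assms(3) by (rule cSUP_upper2) simp
  show "total_variation P Q \<le> 1"
    unfolding total_variation_def using le assms(3) by (intro cSUP_least) auto
qed

lemma prob_space_erdos_renyi: "prob_space (erdos_renyi n p)"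
  unfolding erdos_renyi_def by (rule measure_pmf.prob_space_axioms)

context spherical_cap
begin

lemma prob_space_noisy_geometric_graph:
  assumes t: "t = threshold p d" and q: "0 \<le> q" "q \<le> 1"
  shows "prob_space (noisy_geometric_graph n p d q)"
proof -
  interpret P: prob_space "points {1..n}" by (rule prob_space_points)
  show ?thesis unfolding noisy_geometric_graph_def connection_eq[OF t]
    by (rule P.prob_space_bind[OF _ noisy_kernel_measurable[OF q]])
      (intro AE_I2 measure_pmf.prob_space_axioms)
qed

text \<open>The test is whether the signed count reaches half of its mean \<open>\<mu>\<close> in
  the geometric graph. The leading term of the second moment is exactly \<open>\<mu>\<^sup>2\<close>
  and cancels in the variance. Chebyshev's inequality at distance \<open>\<mu> / 2\<close> brings a
  factor 4 under either law, whence 12 = 4 * 3 and 8 = 4 + 4.\<close>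

lemma total_variation_lower_bound:
  assumes t: "t = threshold p d" and q: "0 < q" "q \<le> 1" and m: "3 * m \<le> n" "0 < m" and tri: "0 < triangle"
  shows "1 - (12 * (q ^ 4 / real d) * real m ^ 4 + 8 * real m ^ 3) / (q ^ 3 * triangle * real m ^ 3)\<^sup>2
    \<le> total_variation (erdos_renyi n p) (noisy_geometric_graph n p d q)"
proof -
  let ?V = "vertex_pairs n" and ?T = "signed_triangles m p" and ?NG = "noisy_geometric_graph n p d q"
  have q': "0 \<le> q" using q by simp
  define \<mu> where "\<mu> = q ^ 3 * triangle * real m ^ 3"
  have \<mu>: "0 < \<mu>" using q m tri by (simp add: \<mu>_def)
  have fin: "finite (Pow ?V)" using finite_vertex_pairs by simp
  define A where "A = edge_graph ` {X \<in> Pow ?V. \<mu> / 2 \<le> ?T X}"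
  have A: "edge_graph X \<in> A \<longleftrightarrow> \<mu> / 2 \<le> ?T X" if "X \<in> Pow ?V" for X
    using that inj_on_edge_graph[of n] unfolding A_def by (auto dest: inj_onD)
  have "measure (erdos_renyi n p) A = (\<Sum>X\<in>Pow ?V. graph_weight n 0 X * of_bool (\<mu> / 2 \<le> ?T X))"
    using p A unfolding measure_erdos_renyi[OF less_imp_le[OF p(1)] less_imp_le[OF p(2)]] graph_weight_0 by (intro sum.cong refl) simp
  also have "\<dots> \<le> (\<Sum>X\<in>Pow ?V. graph_weight n 0 X * (?T X - 0)\<^sup>2) / (\<mu> / 2)\<^sup>2"
    using \<mu> by (intro finite_Chebyshev fin graph_weight_nonneg) auto
  also have "(\<Sum>X\<in>Pow ?V. graph_weight n 0 X * (?T X - 0)\<^sup>2) \<le> real m ^ 3"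
    using second_moment_signed_triangles[of 0 m n] m by simp
  finally have er: "measure (erdos_renyi n p) A \<le> 4 * real m ^ 3 / \<mu>\<^sup>2"
    using \<mu> by (simp add: divide_right_mono power_divide mult.commute)
  have "(\<Sum>X\<in>Pow ?V. graph_weight n q X * (?T X - \<mu>)\<^sup>2) =
      (\<Sum>X\<in>Pow ?V. graph_weight n q X * (?T X)\<^sup>2 - 2 * \<mu> * (graph_weight n q X * ?T X) + \<mu>\<^sup>2 * graph_weight n q X)"
    by (intro sum.cong refl) (simp add: power2_eq_square algebra_simps)
  also have "\<dots> = (\<Sum>X\<in>Pow ?V. graph_weight n q X * (?T X)\<^sup>2) -
      2 * \<mu> * (\<Sum>X\<in>Pow ?V. graph_weight n q X * ?T X) + \<mu>\<^sup>2 * (\<Sum>X\<in>Pow ?V. graph_weight n q X)"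
    by (simp only: sum.distrib sum_subtractf sum_distrib_left)
  also have "\<dots> = (\<Sum>X\<in>Pow ?V. graph_weight n q X * (?T X)\<^sup>2) - \<mu>\<^sup>2"
    unfolding first_moment_signed_triangles[OF q' q(2) m(1)] sum_graph_weight_1[OF q' q(2)] \<mu>_def[symmetric]
    by (simp add: power2_eq_square)
  also have "\<dots> \<le> 3 * (q ^ 4 / real d) * real m ^ 4 + real m ^ 3"
    using second_moment_signed_triangles[OF q' q(2) m(1)]
    by (simp add: \<mu>_def power_mult_distrib flip: power_mult)
  finally have var: "(\<Sum>X\<in>Pow ?V. graph_weight n q X * (?T X - \<mu>)\<^sup>2) \<le> 3 * (q ^ 4 / real d) * real m ^ 4 + real m ^ 3" .
  have "(\<Sum>X\<in>Pow ?V. graph_weight n q X * of_bool (\<not> \<mu> / 2 \<le> ?T X)) \<le>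
      (\<Sum>X\<in>Pow ?V. graph_weight n q X * (?T X - \<mu>)\<^sup>2) / (\<mu> / 2)\<^sup>2"
    using \<mu> by (intro finite_Chebyshev fin graph_weight_nonneg q' q) auto
  also have "\<dots> \<le> (3 * (q ^ 4 / real d) * real m ^ 4 + real m ^ 3) / (\<mu> / 2)\<^sup>2"
    by (rule divide_right_mono[OF var]) simp
  also have "\<dots> = 4 * (3 * (q ^ 4 / real d) * real m ^ 4 + real m ^ 3) / \<mu>\<^sup>2"
    by (simp add: power_divide mult.commute)
  finally have tail: "(\<Sum>X\<in>Pow ?V. graph_weight n q X * of_bool (\<not> \<mu> / 2 \<le> ?T X)) \<le>
      4 * (3 * (q ^ 4 / real d) * real m ^ 4 + real m ^ 3) / \<mu>\<^sup>2" .
  have "measure ?NG A = (\<Sum>X\<in>Pow ?V. graph_weight n q X - graph_weight n q X * of_bool (\<not> \<mu> / 2 \<le> ?T X))"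
    unfolding measure_noisy_geometric_graph[OF t q' q(2)] using A by (intro sum.cong refl) simp
  also have "\<dots> = 1 - (\<Sum>X\<in>Pow ?V. graph_weight n q X * of_bool (\<not> \<mu> / 2 \<le> ?T X))"
    by (simp only: sum_subtractf sum_graph_weight_1[OF q' q(2)])
  finally have "1 - 4 * (3 * (q ^ 4 / real d) * real m ^ 4 + real m ^ 3) / \<mu>\<^sup>2 \<le> measure ?NG A"
    using tail by simp
  then have "1 - 4 * (3 * (q ^ 4 / real d) * real m ^ 4 + real m ^ 3) / \<mu>\<^sup>2 - 4 * real m ^ 3 / \<mu>\<^sup>2
      \<le> \<bar>measure (erdos_renyi n p) A - measure ?NG A\<bar>"
    using er by linarith
  also have "\<dots> \<le> total_variation (erdos_renyi n p) ?NG"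
    by (intro total_variation_bounds prob_space_erdos_renyi prob_space_noisy_geometric_graph[OF t q' q(2)])
      (simp add: sets_erdos_renyi)
  finally show ?thesis
    unfolding \<mu>_def[symmetric] by (simp add: add_divide_distrib algebra_simps)
qed

end

section \<open>The chain rule for the relative entropy\<close>

lemma sum_Pow_Un:
  assumes "finite V" "finite W" "V \<inter> W = {}"
  shows "(\<Sum>Z\<in>Pow (V \<union> W). f Z) = (\<Sum>X\<in>Pow V. \<Sum>Y\<in>Pow W. f (X \<union> Y))"
proof -
  have "bij_betw (\<lambda>(X, Y). X \<union> Y) (Pow V \<times> Pow W) (Pow (V \<union> W))"
  proof (rule bij_betw_byWitness[where f' = "\<lambda>Z. (Z \<inter> V, Z \<inter> W)"])
    show "\<forall>a\<in>Pow V \<times> Pow W. ((case a of (X, Y) \<Rightarrow> X \<union> Y) \<inter> V, (case a of (X, Y) \<Rightarrow> X \<union> Y) \<inter> W) = a"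
      using assms(3) by auto
    show "\<forall>Z\<in>Pow (V \<union> W). (case (Z \<inter> V, Z \<inter> W) of (X, Y) \<Rightarrow> X \<union> Y) = Z" by auto
  qed auto
  from sum.reindex_bij_betw[OF this, of f, symmetric] show ?thesis
    by (simp add: sum.cartesian_product case_prod_beta')
qed

text \<open>One step of the chain rule with the old graph fixed: \<open>g\<close> and
  \<open>Q\<close> are its weights under the two laws, \<open>h Y\<close> and
  \<open>Q * Q' Y\<close> those of its extension by the new edges \<open>Y\<close>. The logarithm of
  the conditional ratio is estimated by \<open>ln_le_minus_one\<close>, which replaces conditional
  entropy by chi-square. The bound on \<open>(h Y)\<^sup>2\<close> avoids a division by
  \<open>g\<close>, which may be zero.\<close>

lemma sum_entropy_le:
  fixes h c Q' :: "'a \<Rightarrow> real"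
  assumes "finite U" "\<And>Y. Y \<in> U \<Longrightarrow> 0 \<le> h Y" "\<And>Y. Y \<in> U \<Longrightarrow> 0 < Q' Y" "0 < Q"
    and g: "(\<Sum>Y\<in>U. h Y) = g" and c: "\<And>Y. Y \<in> U \<Longrightarrow> (h Y)\<^sup>2 \<le> g * c Y" "\<And>Y. Y \<in> U \<Longrightarrow> 0 \<le> c Y"
  shows "(\<Sum>Y\<in>U. h Y * ln (h Y / (Q * Q' Y))) \<le> g * ln (g / Q) + (\<Sum>Y\<in>U. c Y / Q' Y) - g"
proof (cases "g = 0")
  case True
  then have "h Y = 0" if "Y \<in> U" for Y using that g assms(1,2) by (simp add: sum_nonneg_eq_0_iff)
  moreover have "0 \<le> (\<Sum>Y\<in>U. c Y / Q' Y)"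
    using c(2) assms(3) by (intro sum_nonneg divide_nonneg_pos) auto
  ultimately show ?thesis using True by simp
next
  case False
  then have g0: "0 < g" using g assms(2) sum_nonneg[of U h] by auto
  have "h Y * ln (h Y / (Q * Q' Y)) \<le> h Y * ln (g / Q) + c Y / Q' Y - h Y" if Y: "Y \<in> U" for Y
  proof (cases "h Y = 0")
    case True
    then show ?thesis using c(2)[OF Y] assms(3)[OF Y] by simp
  next
    case False
    then have h: "0 < h Y" using assms(2)[OF Y] by simp
    have Q': "0 < Q' Y" by (rule assms(3)[OF Y])
    have "h Y / (Q * Q' Y) = (g / Q) * (h Y / (g * Q' Y))" using g0 by simp
    then have "ln (h Y / (Q * Q' Y)) = ln (g / Q) + ln (h Y / (g * Q' Y))"
      using g0 h Q' assms(4) by (simp only: ln_mult_pos divide_pos_pos mult_pos_pos)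
    also have "\<dots> \<le> ln (g / Q) + (h Y / (g * Q' Y) - 1)"
      using g0 h Q' by (intro add_left_mono ln_le_minus_one) simp
    finally have "h Y * ln (h Y / (Q * Q' Y)) \<le> h Y * (ln (g / Q) + (h Y / (g * Q' Y) - 1))"
      using h by (intro mult_left_mono) auto
    also have "\<dots> = h Y * ln (g / Q) + (h Y)\<^sup>2 / g / Q' Y - h Y"
      by (simp add: algebra_simps power2_eq_square)
    also have "(h Y)\<^sup>2 / g / Q' Y \<le> c Y / Q' Y"
      using c(1)[OF Y] g0 Q' by (intro divide_right_mono) (auto simp: field_simps)
    finally show ?thesis by simp
  qed
  then have "(\<Sum>Y\<in>U. h Y * ln (h Y / (Q * Q' Y))) \<le> (\<Sum>Y\<in>U. h Y * ln (g / Q) + c Y / Q' Y - h Y)"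
    by (rule sum_mono)
  also have "\<dots> = g * ln (g / Q) + (\<Sum>Y\<in>U. c Y / Q' Y) - g"
    by (simp add: sum.distrib sum_subtractf g flip: sum_distrib_right)
  finally show ?thesis .
qed

definition star :: "nat \<Rightarrow> (nat \<times> nat) set" where
  "star k = (\<lambda>i. (i, Suc k)) ` {1..k}"

lemma vertex_pairs_Suc: "vertex_pairs (Suc k) = vertex_pairs k \<union> star k" "vertex_pairs k \<inter> star k = {}"
  by (auto simp: vertex_pairs_def star_def less_Suc_eq_le le_Suc_eq)

lemma finite_star: "finite (star k)"
  by (simp add: star_def)

lemma edge_weight_constant_pos:
  "finite V \<Longrightarrow> X \<subseteq> V \<Longrightarrow> 0 < p \<Longrightarrow> p < 1 \<Longrightarrow> 0 < edge_weight V (\<lambda>_. p :: real) X"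
  unfolding edge_weight_def by (intro mult_pos_pos prod_pos) auto

lemma edge_weight_cong: "(\<And>e. e \<in> V \<Longrightarrow> w e = w' e) \<Longrightarrow> X \<subseteq> V \<Longrightarrow> edge_weight V w X = edge_weight V w' X"
  unfolding edge_weight_def by (intro arg_cong2[where f = "(*)"] prod.cong) auto

text \<open>The chi-square pairing of two product measures relative to a third factorises over the
  edges; one edge contributes
  \<open>w e * w' e / p + (1 - w e) * (1 - w' e) / (1 - p)\<close>.\<close>

lemma sum_edge_weight_ratio:
  fixes p :: real
  assumes V: "finite V" and p: "0 < p" "p < 1"
  shows "(\<Sum>X\<in>Pow V. edge_weight V w X * edge_weight V w' X / edge_weight V (\<lambda>_. p) X) =
    (\<Prod>e\<in>V. 1 + (w e - p) * (w' e - p) / (p * (1 - p)))"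
proof -
  have "(\<Prod>e\<in>V. 1 + (w e - p) * (w' e - p) / (p * (1 - p))) =
      (\<Prod>e\<in>V. w e * w' e / p + (1 - w e) * (1 - w' e) / (1 - p))"
    using p by (intro prod.cong refl) (simp add: field_simps)
  also have "\<dots> = (\<Sum>X\<in>Pow V. edge_weight V w X * edge_weight V w' X / edge_weight V (\<lambda>_. p) X)"
    unfolding prod_add[OF V] edge_weight_def
    by (intro sum.cong refl) (simp add: prod_dividef prod.distrib)
  finally show ?thesis ..
qed

section \<open>Adding one vertex\<close>

context spherical_cap
begin

definition star_weight :: "nat \<Rightarrow> real \<Rightarrow> (nat \<Rightarrow> nat \<Rightarrow> real) \<Rightarrow> (nat \<Rightarrow> real) \<Rightarrow> (nat \<times> nat) set \<Rightarrow> real" where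
  "star_weight k q x y Y = edge_weight (star k) (\<lambda>e. p + q * kernel (dot d (x (fst e)) y)) Y"

text \<open>The law of the edges at the new vertex given the old points. The new point is averaged
  out, which makes these edges dependent.\<close>

definition neighbour_prob :: "nat \<Rightarrow> real \<Rightarrow> (nat \<Rightarrow> nat \<Rightarrow> real) \<Rightarrow> (nat \<times> nat) set \<Rightarrow> real" where
  "neighbour_prob k q x Y = (\<integral>y. star_weight k q x y Y \<partial>S)"

definition relative_entropy :: "nat \<Rightarrow> real \<Rightarrow> real" where
  "relative_entropy k q = (\<Sum>X\<in>Pow (vertex_pairs k). graph_weight k q X *
     ln (graph_weight k q X / edge_weight (vertex_pairs k) (\<lambda>_. p) X))"

lemma star_weight_bounds:
  assumes "0 \<le> q" "q \<le> 1" "Y \<subseteq> star k"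
  shows "0 \<le> star_weight k q x y Y" "star_weight k q x y Y \<le> 1"
  unfolding star_weight_def using assms noisy_kernel_bounds[OF assms(1,2)]
  by (auto intro!: edge_weight_nonneg edge_weight_le_1 finite_star)

lemma star_weight_measurable:
  assumes Y: "Y \<subseteq> star k" and f: "f \<in> measurable M (points {1..k})" and g: "g \<in> measurable M S"
  shows "(\<lambda>z. star_weight k q (f z) (g z) Y) \<in> borel_measurable M"
proof -
  have "(\<lambda>z. p + q * kernel (dot d (f z (fst e)) (g z))) \<in> borel_measurable M" if "e \<in> star k" for e
  proof -
    have "fst e \<in> {1..k}" using that by (auto simp: star_def)
    then have "(\<lambda>z. f z (fst e)) \<in> measurable M (borel_space d)"
      using measurable_compose[OF f component_measurable] by (simp cong: measurable_cong_sets)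
    moreover have "g \<in> measurable M (borel_space d)" using g by (simp cong: measurable_cong_sets)
    ultimately show ?thesis
      by (intro borel_measurable_add borel_measurable_times borel_measurable_const
          measurable_compose[OF borel_measurable_dot kernel_measurable])
  qed
  then show ?thesis
    unfolding star_weight_def edge_weight_def using Y
    by (intro borel_measurable_times borel_measurable_prod borel_measurable_diff borel_measurable_const) auto
qed

lemma star_weight_measurable_const:
  assumes Y: "Y \<subseteq> star k"
  shows "(\<lambda>y. star_weight k q x y Y) \<in> borel_measurable S"
  unfolding star_weight_def edge_weight_def
  by (intro borel_measurable_times borel_measurable_prod borel_measurable_diff borel_measurable_const
      borel_measurable_add measurable_compose[OF dot_const_measurable(2) kernel_measurable])

lemma integrable_star_weight:
  assumes "0 \<le> q" "q \<le> 1" "Y \<subseteq> star k"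
  shows "integrable S (\<lambda>y. star_weight k q x y Y)"
  using star_weight_bounds[OF assms]
  by (intro S.integrable_const_bound[of _ 1] star_weight_measurable_const assms) auto

lemma neighbour_prob_bounds:
  assumes "0 \<le> q" "q \<le> 1" "Y \<subseteq> star k"
  shows "0 \<le> neighbour_prob k q x Y" "neighbour_prob k q x Y \<le> 1"
proof -
  show "0 \<le> neighbour_prob k q x Y"
    unfolding neighbour_prob_def by (intro Bochner_Integration.integral_nonneg star_weight_bounds assms)
  have "neighbour_prob k q x Y \<le> (\<integral>y. 1 \<partial>S)"
    unfolding neighbour_prob_def
    by (intro integral_mono integrable_star_weight star_weight_bounds assms) auto
  then show "neighbour_prob k q x Y \<le> 1" by (simp add: S.prob_space)
qed

lemma neighbour_prob_measurable:
  assumes "Y \<subseteq> star k"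
  shows "(\<lambda>x. neighbour_prob k q x Y) \<in> borel_measurable (points {1..k})"
  unfolding neighbour_prob_def
  by (intro S.borel_measurable_lebesgue_integral) (simp add: case_prod_beta' star_weight_measurable assms)

lemma sum_neighbour_prob:
  assumes q: "0 \<le> q" "q \<le> 1"
  shows "(\<Sum>Y\<in>Pow (star k). neighbour_prob k q x Y) = 1"
proof -
  have "(\<Sum>Y\<in>Pow (star k). neighbour_prob k q x Y) = (\<integral>y. (\<Sum>Y\<in>Pow (star k). star_weight k q x y Y) \<partial>S)"
    unfolding neighbour_prob_def using integrable_star_weight[OF q]
    by (subst Bochner_Integration.integral_sum) auto
  also have "\<dots> = 1" by (simp add: star_weight_def sum_edge_weight finite_star S.prob_space)
  finally show ?thesis .
qed

lemma graph_weight_Suc: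
  assumes q: "0 \<le> q" "q \<le> 1" and X: "X \<subseteq> vertex_pairs k" and Y: "Y \<subseteq> star k"
  shows "graph_weight (Suc k) q (X \<union> Y) =
    (\<integral>x. edge_weight (vertex_pairs k) (edge_prob q x) X * neighbour_prob k q x Y \<partial>points {1..k})"
proof -
  have XY: "X \<union> Y \<subseteq> vertex_pairs (Suc k)" using X Y vertex_pairs_Suc(1) by auto
  have I: "insert (Suc k) {1..k} = {1..Suc k}" by auto
  have split: "edge_weight (vertex_pairs (Suc k)) (edge_prob q (x(Suc k := y))) (X \<union> Y) =
      edge_weight (vertex_pairs k) (edge_prob q x) X * star_weight k q x y Y" for x y
  proof -
    have "edge_weight (vertex_pairs k) (edge_prob q (x(Suc k := y))) X = edge_weight (vertex_pairs k) (edge_prob q x) X"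
      using X by (intro edge_weight_cong) (auto simp: vertex_pairs_def edge_prob_def kern_def)
    moreover have "edge_weight (star k) (edge_prob q (x(Suc k := y))) Y = star_weight k q x y Y"
      unfolding star_weight_def
      using Y by (intro edge_weight_cong) (auto simp: star_def edge_prob_def kern_def)
    ultimately show ?thesis
      unfolding vertex_pairs_Suc(1)
      by (subst edge_weight_insert_disjoint[OF finite_vertex_pairs finite_star vertex_pairs_Suc(2) X Y]) simp
  qed
  have "graph_weight (Suc k) q (X \<union> Y) =
      (\<integral>x. (\<integral>y. edge_weight (vertex_pairs (Suc k)) (edge_prob q (x(Suc k := y))) (X \<union> Y) \<partial>S) \<partial>points {1..k})"
    unfolding graph_weight_def
    using points.product_integral_insert[of "{1..k}" "Suc k" "\<lambda>x. edge_weight (vertex_pairs (Suc k)) (edge_prob q x) (X \<union> Y)"]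
      integrable_edge_weight[OF XY q] unfolding I by simp
  also have "\<dots> = (\<integral>x. edge_weight (vertex_pairs k) (edge_prob q x) X * neighbour_prob k q x Y \<partial>points {1..k})"
    unfolding split neighbour_prob_def by simp
  finally show ?thesis .
qed

text \<open>One plus the mean chi-square divergence of the new neighbourhood from independent edges,
  given the old points.\<close>

definition chi_square :: "nat \<Rightarrow> real \<Rightarrow> real" where
  "chi_square k q = (\<integral>x. (\<Sum>Y\<in>Pow (star k). (neighbour_prob k q x Y)\<^sup>2 / edge_weight (star k) (\<lambda>_. p) Y) \<partial>points {1..k})"

text \<open>Given the old graph, the new neighbourhood follows a mixture of its laws given the old
  points. Cauchy--Schwarz, weighted by the probability of the old graph, moves the square inside
  this mixture. The probabilities of the old graphs then sum to one, and the old graph disappears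
  from the bound.\<close>

lemma relative_entropy_Suc:
  assumes q: "0 \<le> q" "q \<le> 1"
  shows "relative_entropy (Suc k) q \<le> relative_entropy k q + chi_square k q - 1"
proof -
  interpret P: prob_space "points {1..k}" by (rule prob_space_points)
  let ?V = "vertex_pairs k" and ?W = "star k"
  let ?w = "\<lambda>x X. edge_weight ?V (edge_prob q x) X" and ?R = "neighbour_prob k q"
  let ?Q = "edge_weight ?V (\<lambda>_. p)" and ?Q' = "edge_weight ?W (\<lambda>_. p)"
  define c where "c X Y = (\<integral>x. ?w x X * (?R x Y)\<^sup>2 \<partial>points {1..k})" for X Y
  have w: "0 \<le> ?w x X" "?w x X \<le> 1" if "X \<subseteq> ?V" for x X
    using that edge_prob_bounds[OF q] by (auto intro!: edge_weight_nonneg edge_weight_le_1 finite_vertex_pairs)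
  have wm: "(\<lambda>x. ?w x X) \<in> borel_measurable (points {1..k})" if "X \<subseteq> ?V" for X
    using that vertex_pairs_subset by (rule edge_weight_measurable)
  have Rm: "(\<lambda>x. ?R x Y) \<in> borel_measurable (points {1..k})" if "Y \<subseteq> ?W" for Y
    using that by (rule neighbour_prob_measurable)
  have int: "integrable (points {1..k}) (\<lambda>x. ?w x X * (?R x Y) ^ j)" if "X \<subseteq> ?V" "Y \<subseteq> ?W" for X Y j
  proof (rule P.integrable_const_bound[of _ 1])
    have "\<bar>?w x X * (?R x Y) ^ j\<bar> \<le> 1" for x
      using w[OF that(1), of x] neighbour_prob_bounds[OF q that(2), of x]
      by (auto simp: abs_mult intro!: mult_le_one power_le_one)
    then show "AE x in points {1..k}. norm (?w x X * (?R x Y) ^ j) \<le> 1" by simp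
  qed (intro borel_measurable_times borel_measurable_power wm Rm that)
  have gw: "graph_weight (Suc k) q (X \<union> Y) = (\<integral>x. ?w x X * ?R x Y \<partial>points {1..k})" if "X \<subseteq> ?V" "Y \<subseteq> ?W" for X Y
    by (rule graph_weight_Suc[OF q that])
  have CS: "(graph_weight (Suc k) q (X \<union> Y))\<^sup>2 \<le> graph_weight k q X * c X Y" if XY: "X \<subseteq> ?V" "Y \<subseteq> ?W" for X Y
  proof -
    let ?s = "\<lambda>x. sqrt (?w x X)"
    have s2: "?s x * ?s x = ?w x X" for x using w[OF XY(1), of x] by simp
    have eq: "?s x * (?s x * ?R x Y) = ?w x X * ?R x Y" "(?s x)\<^sup>2 = ?w x X" "(?s x * ?R x Y)\<^sup>2 = ?w x X * (?R x Y)\<^sup>2" for x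
    proof -
      have "a * (a * r) = w * r" "a\<^sup>2 = w" "(a * r)\<^sup>2 = w * r\<^sup>2" if "a * a = w" for a r w :: real
        using that by (auto simp: power2_eq_square)
      from this[OF s2[of x]] show "?s x * (?s x * ?R x Y) = ?w x X * ?R x Y" "(?s x)\<^sup>2 = ?w x X"
        "(?s x * ?R x Y)\<^sup>2 = ?w x X * (?R x Y)\<^sup>2" by blast+
    qed
    have "(\<integral>x. ?s x * (?s x * ?R x Y) \<partial>points {1..k})\<^sup>2 \<le> (\<integral>x. (?s x)\<^sup>2 \<partial>points {1..k}) * (\<integral>x. (?s x * ?R x Y)\<^sup>2 \<partial>points {1..k})"
      using int[OF XY, of 0] int[OF XY, of 1] int[OF XY, of 2]
      by (intro P.Cauchy_Schwarz_bounded) (simp_all only: eq power_0 power_one_right mult_1_right)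
    then show ?thesis unfolding eq gw[OF XY] by (simp add: graph_weight_def c_def)
  qed
  have fin: "finite (Pow ?W)" using finite_star by simp
  have step: "(\<Sum>Y\<in>Pow ?W. graph_weight (Suc k) q (X \<union> Y) * ln (graph_weight (Suc k) q (X \<union> Y) / (?Q X * ?Q' Y)))
      \<le> graph_weight k q X * ln (graph_weight k q X / ?Q X) + (\<Sum>Y\<in>Pow ?W. c X Y / ?Q' Y) - graph_weight k q X"
    if X: "X \<subseteq> ?V" for X
  proof (rule sum_entropy_le[OF fin])
    show "0 < ?Q X" by (rule edge_weight_constant_pos[OF finite_vertex_pairs X p])
    show "(\<Sum>Y\<in>Pow ?W. graph_weight (Suc k) q (X \<union> Y)) = graph_weight k q X"
    proof -
      have "(\<Sum>Y\<in>Pow ?W. graph_weight (Suc k) q (X \<union> Y)) = (\<Sum>Y\<in>Pow ?W. \<integral>x. ?w x X * ?R x Y \<partial>points {1..k})"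
        using gw[OF X] by (intro sum.cong) auto
      also have "\<dots> = (\<integral>x. (\<Sum>Y\<in>Pow ?W. ?w x X * ?R x Y) \<partial>points {1..k})"
        using int[OF X, of _ 1] by (subst Bochner_Integration.integral_sum) auto
      also have "\<dots> = graph_weight k q X"
        unfolding sum_distrib_left[symmetric] sum_neighbour_prob[OF q] by (simp add: graph_weight_def)
      finally show ?thesis .
    qed
    fix Y assume Y: "Y \<in> Pow ?W"
    show "0 \<le> graph_weight (Suc k) q (X \<union> Y)"
      using X Y q by (intro graph_weight_nonneg) (auto simp: vertex_pairs_Suc(1))
    show "0 < ?Q' Y" using Y by (intro edge_weight_constant_pos finite_star p) auto
    show "(graph_weight (Suc k) q (X \<union> Y))\<^sup>2 \<le> graph_weight k q X * c X Y" using X Y by (intro CS) auto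
    show "0 \<le> c X Y" unfolding c_def using w[OF X] by (intro Bochner_Integration.integral_nonneg) simp
  qed
  have "relative_entropy (Suc k) q = (\<Sum>X\<in>Pow ?V. \<Sum>Y\<in>Pow ?W. graph_weight (Suc k) q (X \<union> Y) *
      ln (graph_weight (Suc k) q (X \<union> Y) / edge_weight (?V \<union> ?W) (\<lambda>_. p) (X \<union> Y)))"
    unfolding relative_entropy_def vertex_pairs_Suc(1)
    by (rule sum_Pow_Un[OF finite_vertex_pairs finite_star vertex_pairs_Suc(2)])
  also have "\<dots> = (\<Sum>X\<in>Pow ?V. \<Sum>Y\<in>Pow ?W. graph_weight (Suc k) q (X \<union> Y) *
      ln (graph_weight (Suc k) q (X \<union> Y) / (?Q X * ?Q' Y)))"
    by (intro sum.cong refl) (simp add: edge_weight_insert_disjoint[OF finite_vertex_pairs finite_star vertex_pairs_Suc(2)])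
  also have "\<dots> \<le> (\<Sum>X\<in>Pow ?V. graph_weight k q X * ln (graph_weight k q X / ?Q X) + (\<Sum>Y\<in>Pow ?W. c X Y / ?Q' Y) - graph_weight k q X)"
    by (rule sum_mono) (use step in auto)
  also have "\<dots> = relative_entropy k q + (\<Sum>X\<in>Pow ?V. \<Sum>Y\<in>Pow ?W. c X Y / ?Q' Y) - 1"
    by (simp add: sum.distrib sum_subtractf relative_entropy_def sum_graph_weight_1[OF q])
  also have "(\<Sum>X\<in>Pow ?V. \<Sum>Y\<in>Pow ?W. c X Y / ?Q' Y) = chi_square k q"
  proof -
    have "(\<Sum>X\<in>Pow ?V. \<Sum>Y\<in>Pow ?W. c X Y / ?Q' Y) =
        (\<Sum>X\<in>Pow ?V. \<Sum>Y\<in>Pow ?W. \<integral>x. ?w x X * (?R x Y)\<^sup>2 / ?Q' Y \<partial>points {1..k})"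
      unfolding c_def by simp
    also have "\<dots> = (\<integral>x. (\<Sum>X\<in>Pow ?V. \<Sum>Y\<in>Pow ?W. ?w x X * (?R x Y)\<^sup>2 / ?Q' Y) \<partial>points {1..k})"
    proof -
      have i2: "integrable (points {1..k}) (\<lambda>x. ?w x X * (?R x Y)\<^sup>2 / ?Q' Y)" if "X \<in> Pow ?V" "Y \<in> Pow ?W" for X Y
        using int[of X Y 2] that by auto
      have "(\<integral>x. (\<Sum>X\<in>Pow ?V. \<Sum>Y\<in>Pow ?W. ?w x X * (?R x Y)\<^sup>2 / ?Q' Y) \<partial>points {1..k}) =
          (\<Sum>X\<in>Pow ?V. \<integral>x. (\<Sum>Y\<in>Pow ?W. ?w x X * (?R x Y)\<^sup>2 / ?Q' Y) \<partial>points {1..k})"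
        by (intro Bochner_Integration.integral_sum Bochner_Integration.integrable_sum i2)
      also have "\<dots> = (\<Sum>X\<in>Pow ?V. \<Sum>Y\<in>Pow ?W. \<integral>x. ?w x X * (?R x Y)\<^sup>2 / ?Q' Y \<partial>points {1..k})"
        by (intro sum.cong refl Bochner_Integration.integral_sum i2)
      finally show ?thesis ..
    qed
    also have "\<dots> = (\<integral>x. (\<Sum>X\<in>Pow ?V. ?w x X) * (\<Sum>Y\<in>Pow ?W. (?R x Y)\<^sup>2 / ?Q' Y) \<partial>points {1..k})"
      by (simp only: sum_product times_divide_eq_right)
    also have "\<dots> = chi_square k q"
      by (simp add: sum_edge_weight[OF finite_vertex_pairs] chi_square_def)
    finally show ?thesis .
  qed
  finally show ?thesis .
qed

text \<open>The square of \<open>neighbour_prob\<close> is a mean over two independent copies of the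
  new point. For fixed copies the sum over neighbourhoods factorises over the old vertices, and
  independence of the old points turns the mean of the product into a power. By invariance one of
  the copies may be held at any unit vector.\<close>

lemma chi_square_eq:
  assumes q: "0 \<le> q" "q \<le> 1"
  shows "chi_square k q = (\<integral>x. (1 + q\<^sup>2 / (p * (1 - p)) * cov (x 0)) ^ k \<partial>S)"
proof -
  interpret P: prob_space "points {1..k}" by (rule prob_space_points)
  interpret PS: pair_prob_space "points {1..k}" "S \<Otimes>\<^sub>M S" ..
  define b where "b = q\<^sup>2 / (p * (1 - p))"
  have b: "0 \<le> b" using p by (simp add: b_def)
  let ?W = "star k" and ?R = "neighbour_prob k q" and ?Q' = "edge_weight (star k) (\<lambda>_. p)"
  let ?F = "\<lambda>x z. \<Prod>i\<in>{1..k}. 1 + b * (kernel (dot d (x i) (fst z)) * kernel (dot d (x i) (snd z)))"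
  have pair: "integrable (S \<Otimes>\<^sub>M S) (\<lambda>z. star_weight k q x (fst z) Y * star_weight k q x (snd z) Y)" if "Y \<subseteq> ?W" for x Y
  proof (rule SS.integrable_const_bound[of _ 1])
    show "AE z in S \<Otimes>\<^sub>M S. norm (star_weight k q x (fst z) Y * star_weight k q x (snd z) Y) \<le> 1"
      using star_weight_bounds[OF q that] by (auto simp: abs_mult intro!: mult_le_one)
    show "(\<lambda>z. star_weight k q x (fst z) Y * star_weight k q x (snd z) Y) \<in> borel_measurable (S \<Otimes>\<^sub>M S)"
      using star_weight_measurable_const[OF that]
      by (intro borel_measurable_times measurable_compose[OF measurable_fst] measurable_compose[OF measurable_snd])
  qed
  have square: "(?R x Y)\<^sup>2 = (\<integral>z. star_weight k q x (fst z) Y * star_weight k q x (snd z) Y \<partial>(S \<Otimes>\<^sub>M S))" if "Y \<subseteq> ?W" for x Y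
    using SS.integral_fst'[OF pair[OF that], of x]
    by (simp add: neighbour_prob_def power2_eq_square)
  have sum: "(\<Sum>Y\<in>Pow ?W. (?R x Y)\<^sup>2 / ?Q' Y) = (\<integral>z. ?F x z \<partial>(S \<Otimes>\<^sub>M S))" for x
  proof -
    have "(\<Sum>Y\<in>Pow ?W. (?R x Y)\<^sup>2 / ?Q' Y) =
        (\<Sum>Y\<in>Pow ?W. \<integral>z. star_weight k q x (fst z) Y * star_weight k q x (snd z) Y / ?Q' Y \<partial>(S \<Otimes>\<^sub>M S))"
      using square by (intro sum.cong) auto
    also have "\<dots> = (\<integral>z. (\<Sum>Y\<in>Pow ?W. star_weight k q x (fst z) Y * star_weight k q x (snd z) Y / ?Q' Y) \<partial>(S \<Otimes>\<^sub>M S))"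
      using pair by (subst Bochner_Integration.integral_sum) auto
    also have "\<dots> = (\<integral>z. ?F x z \<partial>(S \<Otimes>\<^sub>M S))"
    proof (rule Bochner_Integration.integral_cong[OF refl])
      fix z
      have "(\<Sum>Y\<in>Pow ?W. star_weight k q x (fst z) Y * star_weight k q x (snd z) Y / ?Q' Y) =
          (\<Prod>e\<in>?W. 1 + q * kernel (dot d (x (fst e)) (fst z)) * (q * kernel (dot d (x (fst e)) (snd z))) / (p * (1 - p)))"
        unfolding star_weight_def sum_edge_weight_ratio[OF finite_star p] by simp
      also have "\<dots> = ?F x z"
        unfolding star_def by (subst prod.reindex) (auto simp: inj_on_def b_def power2_eq_square mult_ac)
      finally show "(\<Sum>Y\<in>Pow ?W. star_weight k q x (fst z) Y * star_weight k q x (snd z) Y / ?Q' Y) = ?F x z" .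
    qed
    finally show ?thesis .
  qed
  have factor: "\<bar>1 + b * (kernel u * kernel v)\<bar> \<le> 1 + b" for u v
  proof -
    have "\<bar>b * (kernel u * kernel v)\<bar> \<le> b * 1"
      unfolding abs_mult using b by (intro mult_mono mult_le_one abs_kernel_le) auto
    then show ?thesis by linarith
  qed
  have Fb: "\<bar>?F x z\<bar> \<le> (1 + b) ^ k" for x z
  proof -
    have "\<bar>?F x z\<bar> \<le> (\<Prod>i\<in>{1..k}. 1 + b)" unfolding abs_prod by (intro prod_mono conjI abs_ge_zero factor)
    then show ?thesis by simp
  qed
  have Fm: "(\<lambda>w. ?F (fst w) (snd w)) \<in> borel_measurable (points {1..k} \<Otimes>\<^sub>M (S \<Otimes>\<^sub>M S))"
  proof -
    let ?M = "points {1..k} \<Otimes>\<^sub>M (S \<Otimes>\<^sub>M S)"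
    have "(\<lambda>w. fst w i) \<in> measurable ?M S" if "i \<in> {1..k}" for i
      by (rule measurable_compose[OF measurable_fst component_measurable[OF that]])
    then have m1: "(\<lambda>w. fst w i) \<in> measurable ?M (borel_space d)" if "i \<in> {1..k}" for i
      using that by (simp cong: measurable_cong_sets)
    have "(\<lambda>w. fst (snd w)) \<in> measurable ?M S"
      by (rule measurable_compose[OF measurable_snd measurable_fst])
    then have m2: "(\<lambda>w. fst (snd w)) \<in> measurable ?M (borel_space d)"
      by (simp cong: measurable_cong_sets)
    have "(\<lambda>w. snd (snd w)) \<in> measurable ?M S"
      by (rule measurable_compose[OF measurable_snd measurable_snd])
    then have m3: "(\<lambda>w. snd (snd w)) \<in> measurable ?M (borel_space d)"
      by (simp cong: measurable_cong_sets)
    show ?thesis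
      by (intro borel_measurable_prod borel_measurable_add borel_measurable_times borel_measurable_const
          measurable_compose[OF borel_measurable_dot kernel_measurable] m1 m2 m3)
  qed
  have Fint: "integrable (points {1..k} \<Otimes>\<^sub>M (S \<Otimes>\<^sub>M S)) (case_prod ?F)"
    using Fb Fm unfolding case_prod_beta' by (intro PS.integrable_const_bound[of _ "(1 + b) ^ k"]) auto
  have inner: "(\<integral>x. ?F x z \<partial>points {1..k}) = (1 + b * cap_cov (fst z) (snd z)) ^ k" for z
  proof -
    let ?f = "\<lambda>y. 1 + b * (kernel (dot d y (fst z)) * kernel (dot d y (snd z)))"
    have int: "integrable S (\<lambda>y. kernel (dot d y (fst z)) * kernel (dot d y (snd z)))"
    proof (rule S.integrable_const_bound[of _ 1])
      show "AE y in S. norm (kernel (dot d y (fst z)) * kernel (dot d y (snd z))) \<le> 1"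
        by (simp add: abs_mult abs_kernel_le mult_le_one)
    qed (intro borel_measurable_times measurable_compose[OF dot_const_measurable(1) kernel_measurable])
    then have f: "integrable S ?f" by auto
    have "(\<integral>x. ?F x z \<partial>points {1..k}) = (\<Prod>i\<in>{1..k}. \<integral>y. ?f y \<partial>S)"
      using points.product_integral_prod[of "{1..k}" "\<lambda>_. ?f"] f by simp
    also have "(\<integral>y. ?f y \<partial>S) = 1 + b * cap_cov (fst z) (snd z)"
      using int by (simp add: cap_cov_def S.prob_space)
    finally show ?thesis by simp
  qed
  have cint: "integrable (S \<Otimes>\<^sub>M S) (\<lambda>z. (1 + b * cap_cov (snd z) (fst z)) ^ k)"
  proof (rule SS.integrable_const_bound[of _ "(1 + b) ^ k"])
    have "\<bar>1 + b * cap_cov y y'\<bar> \<le> 1 + b" for y y'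
    proof -
      have "\<bar>b * cap_cov y y'\<bar> \<le> b * 1" unfolding abs_mult using b by (intro mult_mono abs_cap_cov_le) auto
      then show ?thesis by linarith
    qed
    then show "AE z in S \<Otimes>\<^sub>M S. norm ((1 + b * cap_cov (snd z) (fst z)) ^ k) \<le> (1 + b) ^ k"
      by (auto simp: power_abs intro!: power_mono)
  qed (intro borel_measurable_power borel_measurable_add borel_measurable_times borel_measurable_const
      cap_cov_measurable measurable_fst measurable_snd)
  have "chi_square k q = (\<integral>x. \<integral>z. ?F x z \<partial>(S \<Otimes>\<^sub>M S) \<partial>points {1..k})"
    unfolding chi_square_def sum ..
  also have "\<dots> = (\<integral>z. \<integral>x. ?F x z \<partial>points {1..k} \<partial>(S \<Otimes>\<^sub>M S))"
    by (rule PS.Fubini_integral[OF Fint, symmetric])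
  also have "\<dots> = (\<integral>z. (1 + b * cap_cov (snd z) (fst z)) ^ k \<partial>(S \<Otimes>\<^sub>M S))"
    unfolding inner by (simp add: cap_cov_def mult.commute)
  also have "\<dots> = (\<integral>y. \<integral>x. (1 + b * cap_cov x y) ^ k \<partial>S \<partial>S)"
    using SS.integral_fst'[OF cint] by simp
  also have "\<dots> = (\<integral>y. (\<integral>x. (1 + b * cov (x 0)) ^ k \<partial>S) \<partial>S)"
  proof (rule integral_cong_AE)
    show "AE y in S. (\<integral>x. (1 + b * cap_cov x y) ^ k \<partial>S) = (\<integral>x. (1 + b * cov (x 0)) ^ k \<partial>S)"
      using AE_unit AE_space
    proof eventually_elim
      case (elim y)
      have "(\<integral>x. (1 + b * cap_cov x y) ^ k \<partial>S) = (\<integral>x. (1 + b * cov (dot d x y)) ^ k \<partial>S)"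
      proof (rule integral_cong_AE)
        show "AE x in S. (1 + b * cap_cov x y) ^ k = (1 + b * cov (dot d x y)) ^ k"
          using AE_cov_dot[OF elim(1)] by eventually_elim simp
        show "(\<lambda>x. (1 + b * cap_cov x y) ^ k) \<in> borel_measurable S"
          using elim(2) by (intro borel_measurable_power borel_measurable_add borel_measurable_times
              borel_measurable_const cap_cov_measurable measurable_const) auto
        show "(\<lambda>x. (1 + b * cov (dot d x y)) ^ k) \<in> borel_measurable S"
          by (intro borel_measurable_power borel_measurable_add borel_measurable_times
              borel_measurable_const measurable_compose[OF dot_const_measurable(1) cov_measurable])
      qed
      also have "\<dots> = (\<integral>x. (1 + b * cov (x 0)) ^ k \<partial>S)"
        by (rule integral_dot_measurable[OF elim(1), of "\<lambda>u. (1 + b * cov u) ^ k"]) measurable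
      finally show ?case .
    qed
    have "(\<lambda>z. (1 + b * cap_cov (snd z) (fst z)) ^ k) \<in> borel_measurable (S \<Otimes>\<^sub>M S)" using cint by auto
    then have "(\<lambda>(y, x). (1 + b * cap_cov x y) ^ k) \<in> borel_measurable (S \<Otimes>\<^sub>M S)" by (simp add: case_prod_beta')
    then show "(\<lambda>y. \<integral>x. (1 + b * cap_cov x y) ^ k \<partial>S) \<in> borel_measurable S"
      by (rule S.borel_measurable_lebesgue_integral)
  qed simp
  also have "\<dots> = (\<integral>x. (1 + b * cov (x 0)) ^ k \<partial>S)" by (simp add: S.prob_space)
  finally show ?thesis by (simp add: b_def)
qed

text \<open>Each of the \<open>n\<close> increments is bounded by the value with \<open>n\<close> in
  place of \<open>k\<close>.\<close>

lemma relative_entropy_le: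
  assumes q: "0 \<le> q" "q \<le> 1" and b: "q\<^sup>2 / (p * (1 - p)) \<le> 1" and n: "real n * (q\<^sup>2 / (p * (1 - p))) \<le> sqrt (real d)"
  shows "relative_entropy n q \<le> real n * (4 * exp 2 * (real n * (q\<^sup>2 / (p * (1 - p))))\<^sup>2 / real d)"
proof -
  define b where "b = q\<^sup>2 / (p * (1 - p))"
  have b0: "0 \<le> b" using p by (simp add: b_def)
  let ?C = "4 * exp 2 * (real n * b)\<^sup>2 / real d"
  have "relative_entropy k q \<le> real k * ?C" if "k \<le> n" for k
    using that
  proof (induction k)
    case 0
    have "vertex_pairs 0 = {}" by (auto simp: vertex_pairs_def)
    moreover have "graph_weight 0 q {} = 1"
      using sum_graph_weight_1[OF q, of 0] calculation by simp
    ultimately show ?case by (simp add: relative_entropy_def edge_weight_def)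
  next
    case (Suc k)
    have kb: "real k * b \<le> real n * b" using Suc b0 by (intro mult_right_mono) auto
    have "chi_square k q \<le> 1 + 4 * exp 2 * (real k * b)\<^sup>2 / real d"
      unfolding chi_square_eq[OF q] b_def[symmetric]
      using b0 b n kb by (intro integral_cov_power_le) (auto simp: b_def)
    also have "\<dots> \<le> 1 + ?C"
      using kb b0 by (intro add_left_mono divide_right_mono mult_left_mono power_mono) auto
    finally have "relative_entropy (Suc k) q \<le> real k * ?C + ?C"
      using relative_entropy_Suc[OF q, of k] Suc by linarith
    also have "\<dots> = real (Suc k) * ?C" by (simp only: of_nat_Suc distrib_right mult_1)
    finally show ?case .
  qed
  then show ?thesis by (simp add: b_def)
qed

end

section \<open>Total variation\<close>

text \<open>A form of Pinsker's inequality, by way of the Hellinger distance.\<close>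
lemma sum_abs_diff_le_entropy:
  fixes f g :: "'a \<Rightarrow> real"
  assumes "finite U" and f: "\<And>X. X \<in> U \<Longrightarrow> 0 \<le> f X" "(\<Sum>X\<in>U. f X) = 1"
    and g: "\<And>X. X \<in> U \<Longrightarrow> 0 < g X" "(\<Sum>X\<in>U. g X) = 1"
  shows "(\<Sum>X\<in>U. \<bar>g X - f X\<bar>) \<le> 2 * sqrt (\<Sum>X\<in>U. f X * ln (f X / g X))"
proof -
  let ?D = "\<lambda>X. \<bar>sqrt (f X) - sqrt (g X)\<bar>" and ?E = "\<lambda>X. sqrt (f X) + sqrt (g X)"
  \<comment> \<open>The terms \<open>- f X + g X\<close> cancel in the sum because both masses are
    one; with them the inequality holds pointwise, by \<open>ln z \<le> z - 1\<close> at the ratio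
    \<open>b / a\<close> of the square roots.\<close>
  have hellinger: "(?D X)\<^sup>2 \<le> f X * ln (f X / g X) - f X + g X" if X: "X \<in> U" for X
  proof (cases "f X = 0")
    case True
    then show ?thesis using g(1)[OF X] by simp
  next
    case False
    define a b where "a = sqrt (f X)" and "b = sqrt (g X)"
    have ab: "0 < a" "0 < b" using False f(1)[OF X] g(1)[OF X] by (auto simp: a_def b_def)
    have sq: "f X = a\<^sup>2" "g X = b\<^sup>2" using f(1)[OF X] g(1)[OF X] by (auto simp: a_def b_def)
    have "ln (b / a) \<le> b / a - 1" using ab by (intro ln_le_minus_one) simp
    then have "1 - b / a \<le> ln (a / b)" using ab by (simp add: ln_div)
    then have "2 * a\<^sup>2 * (1 - b / a) \<le> 2 * a\<^sup>2 * ln (a / b)" by (intro mult_left_mono) auto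
    also have "2 * ln (a / b) = ln (a\<^sup>2 / b\<^sup>2)"
      using ab ln_realpow[of "a / b" 2] by (simp add: power_divide)
    then have "2 * a\<^sup>2 * ln (a / b) = a\<^sup>2 * ln (a\<^sup>2 / b\<^sup>2)" by (metis mult.assoc mult.left_commute)
    finally have "(a - b)\<^sup>2 \<le> a\<^sup>2 * ln (a\<^sup>2 / b\<^sup>2) - a\<^sup>2 + b\<^sup>2"
      using ab by (simp add: power2_eq_square algebra_simps)
    then show ?thesis unfolding sq using ab by simp
  qed
  have "(\<Sum>X\<in>U. (?D X)\<^sup>2) \<le> (\<Sum>X\<in>U. f X * ln (f X / g X) - f X + g X)"
    by (rule sum_mono[OF hellinger])
  also have "\<dots> = (\<Sum>X\<in>U. f X * ln (f X / g X))"
    by (simp add: sum.distrib sum_subtractf f g)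
  finally have H: "(\<Sum>X\<in>U. (?D X)\<^sup>2) \<le> (\<Sum>X\<in>U. f X * ln (f X / g X))" .
  have "(\<Sum>X\<in>U. (?E X)\<^sup>2) \<le> (\<Sum>X\<in>U. 2 * (f X + g X))"
  proof (rule sum_mono)
    fix X assume X: "X \<in> U"
    have "(a + b)\<^sup>2 \<le> 2 * (a\<^sup>2 + b\<^sup>2)" for a b :: real
      using zero_le_power2[of "a - b"] by (simp add: power2_eq_square algebra_simps)
    from this[of "sqrt (f X)" "sqrt (g X)"] show "(?E X)\<^sup>2 \<le> 2 * (f X + g X)"
      using f(1)[OF X] g(1)[OF X] by simp
  qed
  also have "\<dots> = 4" by (simp add: sum.distrib f g flip: sum_distrib_left)
  finally have E: "(\<Sum>X\<in>U. (?E X)\<^sup>2) \<le> 4" .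
  \<comment> \<open>Writing each difference as a product of difference and sum of square roots
    prepares for Cauchy--Schwarz; the bound 4 for the squared sums gives the constant 2.\<close>
  have "(\<Sum>X\<in>U. \<bar>g X - f X\<bar>) = (\<Sum>X\<in>U. \<bar>?D X\<bar> * \<bar>?E X\<bar>)"
  proof (rule sum.cong[OF refl])
    fix X assume X: "X \<in> U"
    have "(sqrt (f X) - sqrt (g X)) * ?E X = f X - g X"
      using f(1)[OF X] g(1)[OF X] by (simp add: algebra_simps)
    then show "\<bar>g X - f X\<bar> = \<bar>?D X\<bar> * \<bar>?E X\<bar>" by (simp add: abs_minus_commute flip: abs_mult)
  qed
  also have "\<dots> \<le> sqrt (\<Sum>X\<in>U. (?D X)\<^sup>2) * sqrt (\<Sum>X\<in>U. (?E X)\<^sup>2)"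
    using L2_set_mult_ineq[of ?D ?E U] by (simp add: L2_set_def)
  also have "\<dots> \<le> sqrt (\<Sum>X\<in>U. f X * ln (f X / g X)) * sqrt 4"
    using H E order_trans[OF sum_nonneg H] by (intro mult_mono real_sqrt_le_mono) (auto intro: sum_nonneg)
  finally show ?thesis by (simp add: mult.commute)
qed

context spherical_cap
begin

lemma total_variation_upper_bound:
  assumes t: "t = threshold p d" and q: "0 \<le> q" "q \<le> 1"
  shows "total_variation (erdos_renyi n p) (noisy_geometric_graph n p d q) \<le> 2 * sqrt (relative_entropy n q)"
proof -
  let ?V = "vertex_pairs n" and ?Q = "edge_weight (vertex_pairs n) (\<lambda>_. p)"
  have "\<bar>measure (erdos_renyi n p) A - measure (noisy_geometric_graph n p d q) A\<bar> \<le> 2 * sqrt (relative_entropy n q)" for A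
  proof -
    have "measure (erdos_renyi n p) A - measure (noisy_geometric_graph n p d q) A =
        (\<Sum>X\<in>Pow ?V. (?Q X - graph_weight n q X) * of_bool (edge_graph X \<in> A))"
      unfolding measure_noisy_geometric_graph[OF t q] measure_erdos_renyi[OF less_imp_le[OF p(1)] less_imp_le[OF p(2)]]
      by (simp add: left_diff_distrib sum_subtractf)
    also have "\<bar>\<dots>\<bar> \<le> (\<Sum>X\<in>Pow ?V. \<bar>(?Q X - graph_weight n q X) * of_bool (edge_graph X \<in> A)\<bar>)"
      by (rule sum_abs)
    also have "\<dots> \<le> (\<Sum>X\<in>Pow ?V. \<bar>?Q X - graph_weight n q X\<bar>)"
      by (rule sum_mono) (simp add: abs_mult)
    also have "\<dots> \<le> 2 * sqrt (relative_entropy n q)"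
      unfolding relative_entropy_def
    proof (rule sum_abs_diff_le_entropy)
      show "(\<Sum>X\<in>Pow ?V. graph_weight n q X) = 1" by (rule sum_graph_weight_1[OF q])
      show "(\<Sum>X\<in>Pow ?V. ?Q X) = 1" by (rule sum_edge_weight[OF finite_vertex_pairs])
    qed (auto intro: graph_weight_nonneg q edge_weight_constant_pos finite_vertex_pairs p)
    finally show ?thesis .
  qed
  then show ?thesis
    unfolding total_variation_def by (intro cSUP_least) (auto simp: sets_erdos_renyi)
qed

end

lemma total_variation_le:
  assumes d: "3 \<le> d" and p: "0 < p" "p < 1" and q: "0 \<le> q" "q \<le> 1"
    and small: "q\<^sup>2 / (p * (1 - p)) \<le> 1" "real n * (q\<^sup>2 / (p * (1 - p))) \<le> sqrt (real d)"
  shows "total_variation (erdos_renyi n p) (noisy_geometric_graph n p d q) \<le>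
    2 * sqrt (real n * (4 * exp 2 * (real n * (q\<^sup>2 / (p * (1 - p))))\<^sup>2 / real d))"
proof -
  interpret spherical_cap d p "threshold p d" by (rule spherical_cap_threshold[OF d p])
  show ?thesis
    by (rule order_trans[OF total_variation_upper_bound[OF refl q]])
      (intro mult_left_mono real_sqrt_le_mono relative_entropy_le q small, simp)
qed

lemma total_variation_nonneg: "3 \<le> d \<Longrightarrow> 0 < p \<Longrightarrow> p < 1 \<Longrightarrow> 0 \<le> q \<Longrightarrow> q \<le> 1 \<Longrightarrow>
    0 \<le> total_variation (erdos_renyi n p) (noisy_geometric_graph n p d q)"
  and total_variation_le_1: "3 \<le> d \<Longrightarrow> 0 < p \<Longrightarrow> p < 1 \<Longrightarrow> 0 \<le> q \<Longrightarrow> q \<le> 1 \<Longrightarrow>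
    total_variation (erdos_renyi n p) (noisy_geometric_graph n p d q) \<le> 1"
proof -
  assume a: "3 \<le> d" "0 < p" "p < 1" "0 \<le> q" "q \<le> 1"
  interpret spherical_cap d p "threshold p d" by (rule spherical_cap_threshold[OF a(1-3)])
  note b = total_variation_bounds[OF prob_space_erdos_renyi prob_space_noisy_geometric_graph[OF refl a(4,5)], of "{}" n p n]
  show "0 \<le> total_variation (erdos_renyi n p) (noisy_geometric_graph n p d q)"
    "total_variation (erdos_renyi n p) (noisy_geometric_graph n p d q) \<le> 1"
    using b by auto
qed

text \<open>The constants do not depend on the dimension. The first error term comes from pairs of
  triangles with one common edge, the second from pairs of equal triangles.\<close>

lemma total_variation_ge:
  assumes p: "0 < p" "p < 1"
  obtains c N where "0 < c" "3 \<le> N" "\<And>n m d q. N \<le> d \<Longrightarrow> 0 < q \<Longrightarrow> q \<le> 1 \<Longrightarrow> 3 * m \<le> n \<Longrightarrow> 0 < m \<Longrightarrow>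
    1 - c * (12 / (q * real m)\<^sup>2 + 8 * real d / (q ^ 6 * real m ^ 3))
      \<le> total_variation (erdos_renyi n p) (noisy_geometric_graph n p d q)"
proof -
  obtain c N where c: "0 < c" "3 \<le> N"
    and tri: "\<And>d. N \<le> d \<Longrightarrow> c / sqrt (real d) \<le> spherical_cap.triangle d p (threshold p d)"
    using triangle_lower_bound[OF p] by blast
  show ?thesis
  proof (rule that[of "1 / c\<^sup>2" N])
    show "0 < 1 / c\<^sup>2" "3 \<le> N" using c by auto
    fix n m d :: nat and q :: real
    assume a: "N \<le> d" "0 < q" "q \<le> 1" "3 * m \<le> n" "0 < m"
    then have d3: "3 \<le> d" using c by simp
    define T where "T = spherical_cap.triangle d p (threshold p d)"
    interpret spherical_cap d p "threshold p d" by (rule spherical_cap_threshold[OF d3 p])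
    have d0: "0 < real d" using d3 by simp
    have T: "c / sqrt (real d) \<le> T" unfolding T_def using a by (intro tri)
    have T0: "0 < T" using c d0 by (intro less_le_trans[OF _ T]) simp
    let ?den = "(q ^ 3 * T * real m ^ 3)\<^sup>2" and ?num = "12 * (q ^ 4 / real d) * real m ^ 4 + 8 * real m ^ 3"
    have "(c / sqrt (real d))\<^sup>2 \<le> T\<^sup>2" using T c d0 by (intro power_mono) auto
    then have "c\<^sup>2 / real d \<le> T\<^sup>2" using d0 by (simp add: power_divide)
    then have "q ^ 6 * real m ^ 6 * (c\<^sup>2 / real d) \<le> q ^ 6 * real m ^ 6 * T\<^sup>2"
      using a by (intro mult_left_mono) auto
    also have "\<dots> = ?den" by (simp add: power_mult_distrib flip: power_mult)
    finally have "?num / ?den \<le> ?num / (q ^ 6 * real m ^ 6 * (c\<^sup>2 / real d))"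
      using a c d0 T0 by (intro divide_left_mono) auto
    also have "\<dots> = 1 / c\<^sup>2 * (12 / (q * real m)\<^sup>2 + 8 * real d / (q ^ 6 * real m ^ 3))"
    proof -
      have "(12 * (x ^ 4 / z) * y ^ 4 + 8 * y ^ 3) / (x ^ 6 * y ^ 6 * (w / z)) =
          1 / w * (12 / (x * y)\<^sup>2 + 8 * z / (x ^ 6 * y ^ 3))" if "x \<noteq> 0" "y \<noteq> 0" "z \<noteq> 0" "w \<noteq> 0" for x y z w :: real
        using that by (simp add: divide_simps) (simp add: power_numeral_reduce algebra_simps)
      then show ?thesis using a c d0 by simp
    qed
    finally have "1 - 1 / c\<^sup>2 * (12 / (q * real m)\<^sup>2 + 8 * real d / (q ^ 6 * real m ^ 3)) \<le> 1 - ?num / ?den" by simp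
    also have "\<dots> \<le> total_variation (erdos_renyi n p) (noisy_geometric_graph n p d q)"
      using total_variation_lower_bound[OF refl a(2-5)] T0 by (simp add: T_def)
    finally show "1 - 1 / c\<^sup>2 * (12 / (q * real m)\<^sup>2 + 8 * real d / (q ^ 6 * real m ^ 3))
      \<le> total_variation (erdos_renyi n p) (noisy_geometric_graph n p d q)" .
  qed
qed

section \<open>Power laws\<close>

lemma powr_at_top:
  assumes "0 < a" shows "filterlim (\<lambda>n::nat. real n powr a) at_top sequentially"
proof -
  have "filterlim (\<lambda>n. exp (a * ln (real n))) at_top sequentially"
    by (rule filterlim_compose[OF exp_at_top])
      (intro filterlim_tendsto_pos_mult_at_top[OF tendsto_const assms]
        filterlim_compose[OF ln_at_top filterlim_real_sequentially])
  moreover have "\<forall>\<^sub>F n in sequentially. exp (a * ln (real n)) = real n powr a"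
    using eventually_gt_at_top[of "0::nat"] by eventually_elim (simp add: powr_def)
  ultimately show ?thesis by (rule filterlim_mono_eventually[OF _ order_refl order_refl])
qed

lemma powr_tendsto_0: "a < 0 \<Longrightarrow> (\<lambda>n::nat. real n powr a) \<longlonglongrightarrow> 0"
  by (rule tendsto_neg_powr[OF _ filterlim_real_sequentially])

lemma eventually_dimension_ge:
  assumes "0 < \<alpha>" shows "\<forall>\<^sub>F n in sequentially. N \<le> nat \<lfloor>real n powr \<alpha>\<rfloor>"
proof -
  have "\<forall>\<^sub>F n::nat in sequentially. real N \<le> real n powr \<alpha>"
    using powr_at_top[OF assms] by (simp add: filterlim_at_top)
  then show ?thesis by eventually_elim (simp add: le_nat_iff le_floor_iff)
qed

lemma dimension_le: "real (nat \<lfloor>real n powr \<alpha>\<rfloor>) \<le> real n powr \<alpha>"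
  using of_int_floor_le[of "real n powr \<alpha>"] by simp

lemma eventually_dimension_half:
  assumes "0 < \<alpha>" shows "\<forall>\<^sub>F n in sequentially. real n powr \<alpha> / 2 \<le> real (nat \<lfloor>real n powr \<alpha>\<rfloor>)"
proof -
  have "\<forall>\<^sub>F n::nat in sequentially. 2 \<le> real n powr \<alpha>"
    using powr_at_top[OF assms] by (simp add: filterlim_at_top)
  then show ?thesis
  proof eventually_elim
    case (elim n)
    then have "real (nat \<lfloor>real n powr \<alpha>\<rfloor>) = of_int \<lfloor>real n powr \<alpha>\<rfloor>" by simp
    then show ?case using elim floor_correct[of "real n powr \<alpha>"] by linarith
  qed
qed

lemma noise_bounds: "0 < \<beta> \<Longrightarrow> 0 < n \<Longrightarrow> 0 < real n powr (- \<beta>) \<and> real n powr (- \<beta>) \<le> 1"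
  using powr_mono[of "- \<beta>" 0 "real n"] by simp

lemma total_variation_tendsto_0:
  fixes p \<alpha> \<beta> :: real
  assumes p: "0 < p" "p < 1" and \<alpha>: "0 < \<alpha>" and \<beta>: "0 < \<beta>" and exponent: "3 < \<alpha> + 4 * \<beta>"
  shows "(\<lambda>n::nat. total_variation (erdos_renyi n p)
    (noisy_geometric_graph n p (nat \<lfloor>real n powr \<alpha>\<rfloor>) (real n powr (- \<beta>)))) \<longlonglongrightarrow> 0"
proof -
  define r where "r = 1 / (p * (1 - p))"
  have r: "0 < r" using p by (simp add: r_def)
  let ?d = "\<lambda>n. nat \<lfloor>real n powr \<alpha>\<rfloor>" and ?q = "\<lambda>n. real n powr (- \<beta>)"
  \<comment> \<open>An upper bound for \<open>n * (n * b)\<^sup>2 / d\<close> with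
    \<open>b = r * n powr (- 2 * \<beta>)\<close>; the factor 2 pays for rounding the dimension
    down.\<close>
  let ?e = "\<lambda>n. 2 * r\<^sup>2 * real n powr (3 - 4 * \<beta> - \<alpha>)"
  have e0: "?e \<longlonglongrightarrow> 0"
    using tendsto_mult_right_zero[OF powr_tendsto_0[of "3 - 4 * \<beta> - \<alpha>"], of "2 * r\<^sup>2"] exponent by simp
  have b0: "(\<lambda>n. r * real n powr (- 2 * \<beta>)) \<longlonglongrightarrow> 0"
    using tendsto_mult_right_zero[OF powr_tendsto_0[of "- 2 * \<beta>"], of r] \<beta> by simp
  have ev: "\<forall>\<^sub>F n in sequentially. 3 \<le> ?d n \<and> real n powr \<alpha> / 2 \<le> real (?d n) \<and> 0 < n \<and> ?e n < 1 \<and> r * real n powr (- 2 * \<beta>) < 1"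
    using eventually_dimension_ge[OF \<alpha>, of 3] eventually_dimension_half[OF \<alpha>] eventually_gt_at_top[of "0::nat"]
      order_tendstoD(2)[OF e0 zero_less_one] order_tendstoD(2)[OF b0 zero_less_one] by eventually_elim simp
  have bounds: "\<forall>\<^sub>F n in sequentially. 0 \<le> total_variation (erdos_renyi n p) (noisy_geometric_graph n p (?d n) (?q n)) \<and>
      total_variation (erdos_renyi n p) (noisy_geometric_graph n p (?d n) (?q n)) \<le> 2 * sqrt (4 * exp 2 * ?e n)"
    using ev
  proof eventually_elim
    case (elim n)
    then have d: "3 \<le> ?d n" and dn: "real n powr \<alpha> / 2 \<le> real (?d n)" and n: "0 < n" and e: "?e n < 1"
      and b: "r * real n powr (- 2 * \<beta>) < 1" by auto
    have "0 < ?d n" using d by linarith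
    then have d0: "0 < real (?d n)" by (simp only: of_nat_0_less_iff)
    have q: "0 \<le> ?q n" "?q n \<le> 1" using noise_bounds[OF \<beta> n] by auto
    have b_eq: "(?q n)\<^sup>2 / (p * (1 - p)) = r * real n powr (- 2 * \<beta>)"
      using n by (simp add: r_def power2_eq_square flip: powr_add)
    have "real n * (real n * (r * real n powr (- 2 * \<beta>)))\<^sup>2 / real (?d n) \<le>
        real n * (real n * (r * real n powr (- 2 * \<beta>)))\<^sup>2 / (real n powr \<alpha> / 2)"
    proof (rule divide_left_mono[OF dn])
      show "0 < real (?d n) * (real n powr \<alpha> / 2)" using n d0 by (intro mult_pos_pos) auto
    qed simp
    also have "\<dots> = 2 * r\<^sup>2 * (real n powr 3 * (real n powr (- 2 * \<beta>))\<^sup>2 / real n powr \<alpha>)"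
      using n by (simp add: power2_eq_square power3_eq_cube powr_numeral field_simps)
    also have "real n powr 3 * (real n powr (- 2 * \<beta>))\<^sup>2 / real n powr \<alpha> = real n powr (3 - 4 * \<beta> - \<alpha>)"
    proof -
      have "(real n powr (- 2 * \<beta>))\<^sup>2 = real n powr (- 4 * \<beta>)"
        by (simp add: power2_eq_square flip: powr_add)
      then show ?thesis using n by (simp add: powr_diff powr_add powr_minus field_simps)
    qed
    finally have main: "real n * (real n * (r * real n powr (- 2 * \<beta>)))\<^sup>2 / real (?d n) \<le> ?e n" .
    \<comment> \<open>The smallness of the final bound already contains the requirement
      \<open>n * b \<le> sqrt d\<close>, which is weaker by a factor \<open>n\<close> after
      squaring.\<close>
    have "(real n * (r * real n powr (- 2 * \<beta>)))\<^sup>2 / real (?d n) \<le> real n * (real n * (r * real n powr (- 2 * \<beta>)))\<^sup>2 / real (?d n)"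
      using n by (intro divide_right_mono mult_le_cancel_right1[THEN iffD2]) auto
    also have "\<dots> \<le> 1" using main e by simp
    finally have "(real n * (r * real n powr (- 2 * \<beta>)))\<^sup>2 \<le> real (?d n)"
      using d0 by (simp only: divide_le_eq_1_pos)
    then have small: "real n * (r * real n powr (- 2 * \<beta>)) \<le> sqrt (real (?d n))" by (rule real_le_rsqrt)
    have "total_variation (erdos_renyi n p) (noisy_geometric_graph n p (?d n) (?q n)) \<le>
        2 * sqrt (real n * (4 * exp 2 * (real n * (r * real n powr (- 2 * \<beta>)))\<^sup>2 / real (?d n)))"
      using total_variation_le[OF d p q, of n] b small unfolding b_eq by simp
    also have "\<dots> \<le> 2 * sqrt (4 * exp 2 * ?e n)"
      using mult_left_mono[OF main, of "4 * exp 2"] by (simp add: mult_ac)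
    finally show ?case by (rule conjI[OF total_variation_nonneg[OF d p q]])
  qed
  have "(\<lambda>n. 2 * sqrt (4 * exp 2 * ?e n)) \<longlonglongrightarrow> 2 * sqrt (4 * exp 2 * 0)"
    by (intro tendsto_intros e0)
  then have lim: "(\<lambda>n. 2 * sqrt (4 * exp 2 * ?e n)) \<longlonglongrightarrow> 0" by simp
  have "\<forall>\<^sub>F n in sequentially. 0 \<le> total_variation (erdos_renyi n p) (noisy_geometric_graph n p (?d n) (?q n))"
    using bounds by eventually_elim (rule conjunct1)
  moreover have "\<forall>\<^sub>F n in sequentially. total_variation (erdos_renyi n p) (noisy_geometric_graph n p (?d n) (?q n)) \<le> 2 * sqrt (4 * exp 2 * ?e n)"
    using bounds by eventually_elim (rule conjunct2)
  ultimately show ?thesis by (rule tendsto_sandwich[OF _ _ tendsto_const lim])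
qed

lemma total_variation_tendsto_1:
  fixes p \<alpha> \<beta> :: real
  assumes p: "0 < p" "p < 1" and \<alpha>: "0 < \<alpha>" and \<beta>: "0 < \<beta>" and exponent: "\<alpha> + 6 * \<beta> < 3"
  shows "(\<lambda>n::nat. total_variation (erdos_renyi n p)
    (noisy_geometric_graph n p (nat \<lfloor>real n powr \<alpha>\<rfloor>) (real n powr (- \<beta>)))) \<longlonglongrightarrow> 1"
proof -
  obtain c N where c: "0 < c" "3 \<le> N" and ge: "\<And>n m d q. N \<le> d \<Longrightarrow> 0 < q \<Longrightarrow> q \<le> 1 \<Longrightarrow> 3 * m \<le> n \<Longrightarrow> 0 < m \<Longrightarrow>
    1 - c * (12 / (q * real m)\<^sup>2 + 8 * real d / (q ^ 6 * real m ^ 3))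
      \<le> total_variation (erdos_renyi n p) (noisy_geometric_graph n p d q)"
    using total_variation_ge[OF p] by blast
  let ?d = "\<lambda>n. nat \<lfloor>real n powr \<alpha>\<rfloor>" and ?q = "\<lambda>n. real n powr (- \<beta>)"
  \<comment> \<open>Each block has at least n/4 vertices, so the constants are 192 = 12 * 16 and 512
    = 8 * 64.\<close>
  let ?e = "\<lambda>n. c * (192 * real n powr (2 * \<beta> - 2) + 512 * real n powr (\<alpha> + 6 * \<beta> - 3))"
  \<comment> \<open>Since \<alpha> is positive, the hypothesis forces \<beta> < 1/2, so the first
    exponent is negative as well.\<close>
  have "(\<lambda>n. real n powr (2 * \<beta> - 2)) \<longlonglongrightarrow> 0" "(\<lambda>n. real n powr (\<alpha> + 6 * \<beta> - 3)) \<longlonglongrightarrow> 0"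
    using \<alpha> exponent by (auto intro!: powr_tendsto_0)
  then have "(\<lambda>n. 1 - ?e n) \<longlonglongrightarrow> 1 - c * (192 * 0 + 512 * 0)" by (intro tendsto_intros)
  then have e: "(\<lambda>n. 1 - ?e n) \<longlonglongrightarrow> 1" by simp
  have "\<forall>\<^sub>F n in sequentially. 1 - ?e n \<le> total_variation (erdos_renyi n p) (noisy_geometric_graph n p (?d n) (?q n)) \<and>
      total_variation (erdos_renyi n p) (noisy_geometric_graph n p (?d n) (?q n)) \<le> 1"
    using eventually_dimension_ge[OF \<alpha>, of N] eventually_ge_at_top[of "8::nat"]
  proof eventually_elim
    case (elim n)
    let ?m = "n div 3"
    have n: "0 < n" using elim by simp
    have m: "3 * ?m \<le> n" "0 < ?m" using elim by auto
    \<comment> \<open>The step from a third to a quarter absorbs the remainder of the division,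
      given that \<open>n\<close> is at least 8.\<close>
    have "n \<le> 4 * ?m" using elim(2) by presburger
    then have mn: "real n / 4 \<le> real ?m" by simp
    have q: "0 < ?q n" "?q n \<le> 1" using noise_bounds[OF \<beta> n] by auto
    have q2: "(?q n)\<^sup>2 = real n powr (- 2 * \<beta>)" "?q n ^ 6 = real n powr (- 6 * \<beta>)"
      using n by (simp_all add: powr_realpow[symmetric] powr_powr mult.commute)
    have "12 / (?q n * real ?m)\<^sup>2 \<le> 12 / (?q n * (real n / 4))\<^sup>2"
      using q mn n by (intro divide_left_mono power_mono mult_left_mono mult_pos_pos) auto
    also have "\<dots> = 192 / (real n powr (- 2 * \<beta>) * real n powr 2)"
      unfolding power_mult_distrib q2 using n by (simp add: power_divide)
    also have "\<dots> = 192 * real n powr (2 * \<beta> - 2)"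
      using n by (simp add: powr_diff powr_minus field_simps flip: powr_add)
    finally have e1: "12 / (?q n * real ?m)\<^sup>2 \<le> 192 * real n powr (2 * \<beta> - 2)" .
    have "8 * real (?d n) / (?q n ^ 6 * real ?m ^ 3) \<le> 8 * real n powr \<alpha> / (?q n ^ 6 * (real n / 4) ^ 3)"
      using q mn n m dimension_le[of n \<alpha>] by (intro frac_le mult_left_mono power_mono mult_pos_pos) auto
    also have "\<dots> = 512 * (real n powr \<alpha> / (real n powr (- 6 * \<beta>) * real n powr 3))"
      unfolding q2 using n by (simp add: power_divide)
    also have "real n powr \<alpha> / (real n powr (- 6 * \<beta>) * real n powr 3) = real n powr (\<alpha> + 6 * \<beta> - 3)"
      using n by (simp add: powr_diff powr_add powr_minus field_simps)
    finally have e2: "8 * real (?d n) / (?q n ^ 6 * real ?m ^ 3) \<le> 512 * real n powr (\<alpha> + 6 * \<beta> - 3)" .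
    have "c * (12 / (?q n * real ?m)\<^sup>2 + 8 * real (?d n) / (?q n ^ 6 * real ?m ^ 3)) \<le> ?e n"
      using c e1 e2 by (intro mult_left_mono add_mono) auto
    then have "1 - ?e n \<le> total_variation (erdos_renyi n p) (noisy_geometric_graph n p (?d n) (?q n))"
      using ge[OF elim(1) q m] by linarith
    moreover have "total_variation (erdos_renyi n p) (noisy_geometric_graph n p (?d n) (?q n)) \<le> 1"
      using c elim q p by (intro total_variation_le_1) auto
    ultimately show ?case ..
  qed
  then show ?thesis
    using e by (intro tendsto_sandwich[OF _ _ e tendsto_const]) (auto elim: eventually_mono)
qed

theorem corollary1p2:
  fixes p \<alpha> \<beta> :: real
  assumes "0 < p" and "p < 1" and "\<alpha> > 0" and "\<beta> > 0"
  shows "(\<beta> > 1 \<or> \<alpha> + 2 * \<beta> > 3 \<longrightarrow>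
            (\<lambda>n::nat. total_variation (erdos_renyi n p)
               (noisy_geometric_graph n p (nat \<lfloor>real n powr \<alpha>\<rfloor>) (real n powr (- \<beta>)))) \<longlonglongrightarrow> 0)
       \<and> (\<alpha> + 6 * \<beta> < 3 \<longrightarrow>
            (\<lambda>n::nat. total_variation (erdos_renyi n p)
               (noisy_geometric_graph n p (nat \<lfloor>real n powr \<alpha>\<rfloor>) (real n powr (- \<beta>)))) \<longlonglongrightarrow> 1)"
proof (intro conjI impI)
  assume "\<beta> > 1 \<or> \<alpha> + 2 * \<beta> > 3"
  then have "3 < \<alpha> + 4 * \<beta>" using assms by auto
  then show "(\<lambda>n::nat. total_variation (erdos_renyi n p)
      (noisy_geometric_graph n p (nat \<lfloor>real n powr \<alpha>\<rfloor>) (real n powr (- \<beta>)))) \<longlonglongrightarrow> 0"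
    using assms by (intro total_variation_tendsto_0)
next
  assume "\<alpha> + 6 * \<beta> < 3"
  then show "(\<lambda>n::nat. total_variation (erdos_renyi n p)
      (noisy_geometric_graph n p (nat \<lfloor>real n powr \<alpha>\<rfloor>) (real n powr (- \<beta>)))) \<longlonglongrightarrow> 1"
    using assms by (intro total_variation_tendsto_1)
qed

end
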